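(* Fix the number of TV channels $L\ge 1$, and consider the binary alphabet with each colluder tuned in to exactly one TV channel. Let $J_{k,L}=J_{k,L}[f_W,p_{Y|Z,C},p_{\hat C}]=\frac1k I(\hat Y;\hat Z,\hat C\,|\,\hat W)$ be the multi-channel payoff defined in the context. Under the regularity assumption stated in the context, as the number of colluders $k\to\infty$, $$\max_{f_W}\ \min_{\{\pi\},\,p_{\hat C}} J_{k,L}\ \rightarrow\ \frac{L^2}{k^2\,2\ln 2},$$ i.e. the ratio of the two sides tends to $1$. Asymptotically optimal strategies are $(f_W^*,g^*,p^*_{\hat C})$, where $f_W^*(w)=\frac{1}{\pi\sqrt{w(1-w)}}$ on $(0,1)$ (arcsine distribution), $g^*(w)=w$ (interleaving attack), and $p^*_{\hat C}(\hat c)=\prod_{l=1}^L\delta(c^l,k/L)$, i.e. $\hat C=(k/L,\dots,k/L)$ with probability $1$.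
   Context: Setting. There are $L$ TV channels and a coalition $\mathcal K$ of $k\ge L$ colluders. Hats denote $L$-tuples indexed by the channel, e.g. $\hat Y=(Y^1,\dots,Y^L)$. Logarithms in entropies and mutual informations are to base 2. $\delta(i,j)$ is the Kronecker delta. Tracer. The tracer chooses a probability density $f_W$ on $(0,1)$; the biases $W^1,\dots,W^L$ are i.i.d. with density $f_W$. Given $\hat W=\hat w$, the symbols $X^l_j\in\{0,1\}$ ($j\in\mathcal K$, $1\le l\le L$) are independent with $P(X^l_j=1)=w^l$. Colluders. Independently of the biases and symbols, the coalition draws $\hat C=(C^1,\dots,C^L)$ from a distribution $p_{\hat C}$ on $L$-tuples of positive integers with sum $k$; $p_{\hat C}$ is symmetric under permutations of the channels, so all $C^l$ have a common marginal $p_C$ on $\{1,\dots,k-L+1\}$. Given $\hat C=\hat c$, an ordered partition $\hat S=(S^1,\dots,S^L)$ of $\mathcal K$ with $|S^l|=c^l$ is drawn uniformly. Put $Z^l=\sum_{j\in S^l}X^l_j$. Then, given $(\hat Z,\hat C,\hat W)$, the outputs $Y^l\in\{0,1\}$ are conditionally independent over $l$, with $P(Y^l=1\,|\,Z^l=z,C^l=c)=\pi_{z,c}$ for $0\le z\le c$, the same $\pi_{z,c}$ for all channels, satisfying the marking assumption $\pi_{0,c}=0$, $\pi_{c,c}=1$. The colluders' strategy consists of $p_{\hat C}$ and $\{\pi\}=\{\pi_{z,c}\}$ (equivalently $p_{Y|Z,C}$). Regularity assumption. For every $c\in\{1,\dots,k-L+1\}$ there is a bounded, twice differentiable function $g_c$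 on $[0,1]$ with $g_c(0)=0$, $g_c(1)=1$ and $\pi_{z,c}=g_c(z/c)$ for all $z\in\{0,\dots,c\}$; moreover, whenever $c=c(k)\to\infty$ as $k\to\infty$, $\lim_{k\to\infty}g_c(x)=g(x)$ for a function $g$, which is the asymptotic attack. Asymptotic optimality. The maximin game is understood asymptotically: the payoff is considered to leading order as $k\to\infty$. For a given $f_W$, a sequence of colluder strategies (indexed by $k$, with limiting attack $g$) is asymptotically optimal if it produces the lowest value of the payoff in the limit $k\to\infty$; $f_W$ is asymptotically optimal if it maximizes the resulting asymptotically minimal payoff. The strategy $p^*_{\hat C}$ is defined when $L$ divides $k$, and $k\to\infty$ is taken along such values. *)

theory Defs
  imports "HOL-Probability.Probability"
begin

(* Channels are {1..L}, colluders are {1..k}.  An L-tuple is an extensional function on {1..L}. *)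

definition bias_density :: "(real \<Rightarrow> real) \<Rightarrow> bool" where
  "bias_density f \<longleftrightarrow>
     f \<in> borel_measurable borel \<and> (\<forall>w\<in>{0<..<1}. 0 \<le> f w) \<and>
     (\<integral>\<^sup>+ w\<in>{0<..<1}. ennreal (f w) \<partial>lborel) = 1"

(* Only the values of f on (0,1) matter. *)
definition bias_law :: "(real \<Rightarrow> real) \<Rightarrow> real measure" where
  "bias_law f = density lborel (\<lambda>w. ennreal (f w) * indicator {0<..<1} w)"

definition allocations :: "nat \<Rightarrow> nat \<Rightarrow> (nat \<Rightarrow> nat) set" where
  "allocations L k = {c \<in> {1..L} \<rightarrow>\<^sub>E {1..}. (\<Sum>l\<in>{1..L}. c l) = k}"

definition ordered_partitions :: "nat \<Rightarrow> nat \<Rightarrow> (nat \<Rightarrow> nat) \<Rightarrow> (nat \<Rightarrow> nat set) set" where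
  "ordered_partitions L k c =
     {S \<in> {1..L} \<rightarrow>\<^sub>E Pow {1..k}.
        disjoint_family_on S {1..L} \<and> (\<Union>l\<in>{1..L}. S l) = {1..k} \<and>
        (\<forall>l\<in>{1..L}. card (S l) = c l)}"

definition valid_allocation_law :: "nat \<Rightarrow> nat \<Rightarrow> (nat \<Rightarrow> nat) pmf \<Rightarrow> bool" where
  "valid_allocation_law L k p \<longleftrightarrow>
     set_pmf p \<subseteq> allocations L k \<and>
     (\<forall>\<rho>. \<rho> permutes {1..L} \<longrightarrow> map_pmf (\<lambda>c. c \<circ> \<rho>) p = p)"

(* \<theta> z c is the probability of output 1 for z ones among the c colluders tuned in. *)
definition marking_attack :: "nat \<Rightarrow> nat \<Rightarrow> (nat \<Rightarrow> nat \<Rightarrow> real) \<Rightarrow> bool" where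
  "marking_attack L k \<theta> \<longleftrightarrow>
     (\<forall>c\<in>{1..k - L + 1}. (\<forall>z\<le>c. 0 \<le> \<theta> z c \<and> \<theta> z c \<le> 1) \<and> \<theta> 0 c = 0 \<and> \<theta> c c = 1)"

(* x (j, l) is the symbol of colluder j in channel l. *)
type_synonym outcome =
  "(nat \<times> nat \<Rightarrow> bool) \<times> (nat \<Rightarrow> nat) \<times> (nat \<Rightarrow> nat set) \<times> (nat \<Rightarrow> bool)"

definition channel_ones :: "(nat \<times> nat \<Rightarrow> bool) \<Rightarrow> (nat \<Rightarrow> nat set) \<Rightarrow> nat \<Rightarrow> nat" where
  "channel_ones x S l = (\<Sum>j\<in>S l. of_bool (x (j, l)))"

definition outcome_pmf ::
  "nat \<Rightarrow> nat \<Rightarrow> (nat \<Rightarrow> nat \<Rightarrow> real) \<Rightarrow> (nat \<Rightarrow> nat) pmf \<Rightarrow> (nat \<Rightarrow> real) \<Rightarrow> outcome pmf" where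
  "outcome_pmf L k \<theta> p w =
     do {
       x \<leftarrow> Pi_pmf ({1..k} \<times> {1..L}) False (\<lambda>(j, l). bernoulli_pmf (w l));
       c \<leftarrow> p;
       S \<leftarrow> pmf_of_set (ordered_partitions L k c);
       y \<leftarrow> Pi_pmf {1..L} False (\<lambda>l. bernoulli_pmf (\<theta> (channel_ones x S l) (c l)));
       return_pmf (x, c, S, y)
     }"

definition joint_law ::
  "nat \<Rightarrow> nat \<Rightarrow> (real \<Rightarrow> real) \<Rightarrow> (nat \<Rightarrow> nat \<Rightarrow> real) \<Rightarrow> (nat \<Rightarrow> nat) pmf
     \<Rightarrow> ((nat \<Rightarrow> real) \<times> outcome) measure" where
  "joint_law L k f \<theta> p =
     PiM {1..L} (\<lambda>_. bias_law f) \<bind>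
       (\<lambda>w. distr (measure_pmf (outcome_pmf L k \<theta> p w))
              (PiM {1..L} (\<lambda>_. borel) \<Otimes>\<^sub>M count_space UNIV) (\<lambda>\<omega>. (w, \<omega>)))"

definition bias_var :: "(nat \<Rightarrow> real) \<times> outcome \<Rightarrow> nat \<Rightarrow> real" where
  "bias_var = (\<lambda>(w, x, c, S, y). w)"

definition output_var :: "nat \<Rightarrow> (nat \<Rightarrow> real) \<times> outcome \<Rightarrow> nat \<Rightarrow> bool" where
  "output_var L = (\<lambda>(w, x, c, S, y). restrict y {1..L})"

definition ones_var :: "nat \<Rightarrow> (nat \<Rightarrow> real) \<times> outcome \<Rightarrow> nat \<Rightarrow> nat" where
  "ones_var L = (\<lambda>(w, x, c, S, y). restrict (channel_ones x S) {1..L})"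

definition size_var :: "nat \<Rightarrow> (nat \<Rightarrow> real) \<times> outcome \<Rightarrow> nat \<Rightarrow> nat" where
  "size_var L = (\<lambda>(w, x, c, S, y). restrict c {1..L})"

definition payoff ::
  "nat \<Rightarrow> nat \<Rightarrow> (real \<Rightarrow> real) \<Rightarrow> (nat \<Rightarrow> nat \<Rightarrow> real) \<Rightarrow> (nat \<Rightarrow> nat) pmf \<Rightarrow> real" where
  "payoff L k f \<theta> p =
     prob_space.conditional_mutual_information (joint_law L k f \<theta> p) 2
       (PiM {1..L} (\<lambda>_. count_space UNIV))
       (PiM {1..L} (\<lambda>_. count_space UNIV) \<Otimes>\<^sub>M PiM {1..L} (\<lambda>_. count_space UNIV))
       (PiM {1..L} (\<lambda>_. borel))
       (output_var L) (\<lambda>\<omega>. (ones_var L \<omega>, size_var L \<omega>)) bias_var / real k"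

definition twice_differentiable_on :: "(real \<Rightarrow> real) \<Rightarrow> real set \<Rightarrow> bool" where
  "twice_differentiable_on h A \<longleftrightarrow>
     (\<exists>h'. (\<forall>x\<in>A. (h has_real_derivative h' x) (at x within A)) \<and> h' differentiable_on A)"

(* Strategy sequences are indexed by the coalition size, which runs through the positive multiples
   L * n of L.  The interpolating functions G k c may depend on the coalition size k. *)
definition regular_attack ::
  "nat \<Rightarrow> (real \<Rightarrow> real) \<Rightarrow> (nat \<Rightarrow> nat \<Rightarrow> nat \<Rightarrow> real) \<Rightarrow> bool" where
  "regular_attack L g \<theta> \<longleftrightarrow>
     (\<exists>G :: nat \<Rightarrow> nat \<Rightarrow> real \<Rightarrow> real.
        (\<forall>n>0. \<forall>c\<in>{1..L * n - L + 1}.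
           bounded (G (L * n) c ` {0..1}) \<and>
           twice_differentiable_on (G (L * n) c) {0..1} \<and>
           G (L * n) c 0 = 0 \<and> G (L * n) c 1 = 1 \<and>
           (\<forall>z\<le>c. \<theta> (L * n) z c = G (L * n) c (real z / real c))) \<and>
        (\<forall>c :: nat \<Rightarrow> nat. (\<forall>n>0. c n \<in> {1..L * n - L + 1}) \<and> filterlim c at_top sequentially \<longrightarrow>
           (\<forall>x\<in>{0..1}. (\<lambda>n. G (L * n) (c n) x) \<longlonglongrightarrow> g x)))"

definition regular_strategy ::
  "nat \<Rightarrow> (real \<Rightarrow> real) \<Rightarrow> (nat \<Rightarrow> nat \<Rightarrow> nat \<Rightarrow> real) \<Rightarrow> (nat \<Rightarrow> (nat \<Rightarrow> nat) pmf) \<Rightarrow> bool" where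
  "regular_strategy L g \<theta> p \<longleftrightarrow>
     (\<forall>n>0. marking_attack L (L * n) (\<theta> (L * n)) \<and> valid_allocation_law L (L * n) (p (L * n))) \<and>
     regular_attack L g \<theta>"

definition regular_strategies ::
  "nat \<Rightarrow> ((nat \<Rightarrow> nat \<Rightarrow> nat \<Rightarrow> real) \<times> (nat \<Rightarrow> (nat \<Rightarrow> nat) pmf)) set" where
  "regular_strategies L = {(\<theta>, p). \<exists>g. regular_strategy L g \<theta> p}"

(* The value of the game at coalition size k.  Since 0 <= payoff <= L / k, both bounds are
   taken over bounded nonempty sets of reals when k is a positive multiple of L. *)
definition maximin_payoff :: "nat \<Rightarrow> nat \<Rightarrow> real" where
  "maximin_payoff L k =
     (SUP f\<in>Collect bias_density. INF (\<theta>, p)\<in>regular_strategies L. payoff L k f (\<theta> k) (p k))"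

(* The leading order of the payoff is k^-2, so payoffs of sequences are compared after
   multiplication by k^2. *)
definition scaled_payoff ::
  "nat \<Rightarrow> (real \<Rightarrow> real) \<Rightarrow> (nat \<Rightarrow> nat \<Rightarrow> nat \<Rightarrow> real) \<Rightarrow> (nat \<Rightarrow> (nat \<Rightarrow> nat) pmf) \<Rightarrow> nat \<Rightarrow> real" where
  "scaled_payoff L f \<theta> p k = (real k)\<^sup>2 * payoff L k f (\<theta> k) (p k)"

definition asymptotic_payoff ::
  "nat \<Rightarrow> (real \<Rightarrow> real) \<Rightarrow> (nat \<Rightarrow> nat \<Rightarrow> nat \<Rightarrow> real) \<Rightarrow> (nat \<Rightarrow> (nat \<Rightarrow> nat) pmf) \<Rightarrow> ereal" where
  "asymptotic_payoff L f \<theta> p = liminf (\<lambda>n. ereal (scaled_payoff L f \<theta> p (L * n)))"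

definition asymptotic_min_payoff :: "nat \<Rightarrow> (real \<Rightarrow> real) \<Rightarrow> ereal" where
  "asymptotic_min_payoff L f = (INF (\<theta>, p)\<in>regular_strategies L. asymptotic_payoff L f \<theta> p)"

definition asymptotically_optimal_colluders ::
  "nat \<Rightarrow> (real \<Rightarrow> real) \<Rightarrow> (real \<Rightarrow> real) \<Rightarrow> (nat \<Rightarrow> nat \<Rightarrow> nat \<Rightarrow> real) \<Rightarrow>
     (nat \<Rightarrow> (nat \<Rightarrow> nat) pmf) \<Rightarrow> bool" where
  "asymptotically_optimal_colluders L f g \<theta> p \<longleftrightarrow>
     regular_strategy L g \<theta> p \<and>
     (\<exists>v. (\<lambda>n. scaled_payoff L f \<theta> p (L * n)) \<longlonglongrightarrow> v \<and>
          (\<forall>(\<theta>', p')\<in>regular_strategies L. ereal v \<le> asymptotic_payoff L f \<theta>' p'))"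

definition asymptotically_optimal_tracer :: "nat \<Rightarrow> (real \<Rightarrow> real) \<Rightarrow> bool" where
  "asymptotically_optimal_tracer L f \<longleftrightarrow>
     bias_density f \<and>
     (\<forall>f'. bias_density f' \<longrightarrow> asymptotic_min_payoff L f' \<le> asymptotic_min_payoff L f)"

definition arcsine_density :: "real \<Rightarrow> real" where
  "arcsine_density w = 1 / (pi * sqrt (w * (1 - w)))"

definition interleaving :: "real \<Rightarrow> real" where
  "interleaving w = w"

definition attack_of :: "(real \<Rightarrow> real) \<Rightarrow> nat \<Rightarrow> nat \<Rightarrow> nat \<Rightarrow> real" where
  "attack_of g k z c = g (real z / real c)"

definition uniform_allocation :: "nat \<Rightarrow> nat \<Rightarrow> (nat \<Rightarrow> nat) pmf" where
  "uniform_allocation L k = return_pmf (\<lambda>l\<in>{1..L}. k div L)"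

end

(* Given the allocation, the channels are independent, so the payoff is at least the mean over
   allocations of the sum of single-channel informations, with equality for a deterministic
   allocation.

   Lower bound.  For a channel with c colluders and mean output p(w), convex duality of the binary
   divergence with a test function linear in the score z - c w gives, to leading order,
     I(w) >= v(p) p'(w) sqrt(w (1-w)) / c - 1 / (2c)    with v(p) ~ 1 / sqrt(p (1-p)).
   Against the arcsine density the weights sqrt(w (1-w)) cancel and the first term becomes an exact
   derivative, worth 1/c, because p runs from 0 to 1 whatever the attack is.  This leaves 1/(2c),
   and convexity of 1/c favours equal channel sizes.

   Upper bound.  The divergence may be taken with respect to any reference output distribution.
   Interleaving with reference w has I(w) ~ 1/(2c) pointwise with a uniform bound 1/c, hence any
   fixed tracer gets at most 1/(2c) asymptotically.  This is not uniform in w (for w of order 1/c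
   interleaving leaks more), so for a tracer depending on c the colluders flatten interleaving
   near 0 and 1: slope 1/2 at the ends, followed by a steepening x^(1+e) so slow that the bulk
   loses only a factor (1+e)^2. *)

theory Submission
  imports Defs
begin

section \<open>Conditional information of a finite kernel\<close>

text \<open>The lower bound has to hold for every table of output probabilities: at a single k the
  regularity assumption restricts nothing, so no expansion of the attack is available. What every
  attack does satisfy is an exact identity: \<open>w * (1 - w)\<close> times the derivative of the
  mean output is the covariance of the output with the score. A test function linear in the score
  sees nothing else. The normalisation comes from the integral of 1 / sqrt (p (1 - p)) over the unit
  interval, which is pi and cancels the pi of the arcsine density. The ideal slope is unbounded at
  the ends in both w and p. Hence the sharp estimate is run on \<open>{a..1 - a}\<close> with a
  regularised slope, and a cruder inequality, valid up to the ends, shows that p has made almost all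
  of its way inside that interval unless the information is large anyway. The sharp estimate is
  asymptotic in the size of one channel, and a channel may keep few colluders while k grows. In that
  case the crude inequality for this channel alone beats the target, which is of order 1 /
  k.\<close>

lemma nn_integral_distr_count_space_finite:
  assumes "finite F" "F \<subseteq> space T" and [measurable]: "h \<in> borel_measurable T"
  shows "(\<integral>\<^sup>+x. h x \<partial>distr (count_space F) T (\<lambda>x. x)) = (\<Sum>x\<in>F. h x)"
proof -
  have "(\<lambda>x. x) \<in> count_space F \<rightarrow>\<^sub>M T" using assms by auto
  then have "(\<integral>\<^sup>+x. h x \<partial>distr (count_space F) T (\<lambda>x. x)) = (\<integral>\<^sup>+x. h x \<partial>count_space F)"
    by (subst nn_integral_distr) auto
  then show ?thesis using assms by (simp add: nn_integral_count_space_finite)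
qed

lemma nn_integral_pair_distr_count_space_finite:
  assumes F: "finite F" "F \<subseteq> space T" and \<mu>: "sigma_finite_measure \<mu>"
    and [measurable]: "h \<in> borel_measurable (distr (count_space F) T (\<lambda>x. x) \<Otimes>\<^sub>M \<mu>)"
  shows "(\<integral>\<^sup>+z. h z \<partial>(distr (count_space F) T (\<lambda>x. x) \<Otimes>\<^sub>M \<mu>)) = (\<integral>\<^sup>+w. (\<Sum>x\<in>F. h (x, w)) \<partial>\<mu>)"
proof -
  interpret sigma_finite_measure \<mu> by fact
  let ?T = "distr (count_space F) T (\<lambda>x. x)"
  have "(\<lambda>x. \<integral>\<^sup>+w. h (x, w) \<partial>\<mu>) \<in> borel_measurable ?T" by measurable
  then have "(\<integral>\<^sup>+z. h z \<partial>(?T \<Otimes>\<^sub>M \<mu>)) = (\<Sum>x\<in>F. \<integral>\<^sup>+w. h (x, w) \<partial>\<mu>)"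
    by (subst nn_integral_fst[symmetric])
      (auto simp: nn_integral_distr_count_space_finite[OF F] measurable_cong_sets[OF sets_distr refl])
  also have "\<dots> = (\<integral>\<^sup>+w. (\<Sum>x\<in>F. h (x, w)) \<partial>\<mu>)"
    using F by (intro nn_integral_sum[symmetric]) auto
  finally show ?thesis .
qed

lemma finite_measure_distr_count_space_finite:
  assumes "finite F" "F \<subseteq> space T"
  shows "finite_measure (distr (count_space F) T (\<lambda>x. x))"
proof (rule finite_measure.finite_measure_distr)
  show "finite_measure (count_space F)" using assms
    by (intro finite_measureI) (simp add: emeasure_count_space)
  show "(\<lambda>x. x) \<in> count_space F \<rightarrow>\<^sub>M T" using assms by auto
qed

text \<open>\<open>N\<close> is kept apart from \<open>\<mu>\<close> because the joint law is
  declared on a product of Borel algebras, while \<open>\<mu>\<close> is a product of bias laws;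
  only their measurable sets agree. One finite set \<open>F\<close> has to carry the outcomes for
  all parameters.\<close>

locale finite_kernel =
  fixes \<mu> :: "'w measure" and N :: "'w measure" and K :: "'w \<Rightarrow> 'o pmf" and F :: "'o set"
  assumes prob_mu: "prob_space \<mu>" and sets_N: "sets N = sets \<mu>" and fin_F: "finite F"
    and K_sub: "\<And>w. w \<in> space \<mu> \<Longrightarrow> set_pmf (K w) \<subseteq> F"
    and K_meas [measurable]: "\<And>\<omega>. (\<lambda>w. pmf (K w) \<omega>) \<in> borel_measurable \<mu>"
begin

definition J where
  "J = \<mu> \<bind> (\<lambda>w. distr (measure_pmf (K w)) (N \<Otimes>\<^sub>M count_space UNIV) (\<lambda>\<omega>. (w, \<omega>)))"

lemma space_N: "space N = space \<mu>" using sets_N by (rule sets_eq_imp_space_eq)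

lemma measurable_Pair_outcome: "w \<in> space \<mu> \<Longrightarrow> (\<lambda>\<omega>. (w, \<omega>)) \<in> measure_pmf (K w) \<rightarrow>\<^sub>M N \<Otimes>\<^sub>M count_space UNIV"
  by (auto simp: space_N space_pair_measure)

lemma emeasure_K:
  assumes w: "w \<in> space \<mu>" and A: "A \<in> sets (N \<Otimes>\<^sub>M count_space UNIV)"
  shows "emeasure (distr (measure_pmf (K w)) (N \<Otimes>\<^sub>M count_space UNIV) (\<lambda>\<omega>. (w, \<omega>))) A
    = (\<Sum>\<omega>\<in>F. ennreal (pmf (K w) \<omega>) * indicator A (w, \<omega>))"
proof -
  have "emeasure (distr (measure_pmf (K w)) (N \<Otimes>\<^sub>M count_space UNIV) (\<lambda>\<omega>. (w, \<omega>))) A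
    = emeasure (measure_pmf (K w)) {\<omega>. (w, \<omega>) \<in> A}"
    using measurable_Pair_outcome[OF w] A by (subst emeasure_distr) (auto simp: vimage_def)
  also have "\<dots> = (\<integral>\<^sup>+\<omega>. indicator A (w, \<omega>) \<partial>measure_pmf (K w))"
    by (subst nn_integral_indicator[symmetric])
      (auto intro!: nn_integral_cong simp del: nn_integral_indicator split: split_indicator)
  also have "\<dots> = (\<Sum>\<omega>\<in>F. indicator A (w, \<omega>) * ennreal (pmf (K w) \<omega>))"
    using K_sub[OF w] by (intro nn_integral_measure_pmf_support fin_F) (auto simp: set_pmf_iff)
  finally show ?thesis by (simp add: mult.commute)
qed

lemma measurable_kernel: "(\<lambda>w. distr (measure_pmf (K w)) (N \<Otimes>\<^sub>M count_space UNIV) (\<lambda>\<omega>. (w, \<omega>)))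
  \<in> \<mu> \<rightarrow>\<^sub>M subprob_algebra (N \<Otimes>\<^sub>M count_space UNIV)"
proof (rule measurable_subprob_algebra)
  fix w assume w: "w \<in> space \<mu>"
  show "subprob_space (distr (measure_pmf (K w)) (N \<Otimes>\<^sub>M count_space UNIV) (\<lambda>\<omega>. (w, \<omega>)))"
    using w by (intro prob_space_imp_subprob_space prob_space.prob_space_distr measurable_Pair_outcome measure_pmf.prob_space_axioms)
next
  fix A assume A: "A \<in> sets (N \<Otimes>\<^sub>M count_space (UNIV :: 'o set))"
  have [measurable]: "(\<lambda>w. indicator A (w, \<omega>) :: ennreal) \<in> borel_measurable \<mu>" for \<omega>
  proof -
    have "(\<lambda>w. (w, \<omega>)) \<in> \<mu> \<rightarrow>\<^sub>M N \<Otimes>\<^sub>M count_space UNIV"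
      by (intro measurable_Pair) (auto simp: measurable_ident_sets sets_N)
    then show ?thesis using A by measurable
  qed
  have "(\<lambda>w. \<Sum>\<omega>\<in>F. ennreal (pmf (K w) \<omega>) * indicator A (w, \<omega>)) \<in> borel_measurable \<mu>"
    by measurable
  then show "(\<lambda>w. emeasure (distr (measure_pmf (K w)) (N \<Otimes>\<^sub>M count_space UNIV) (\<lambda>\<omega>. (w, \<omega>))) A) \<in> borel_measurable \<mu>"
    using A by (subst measurable_cong[OF emeasure_K]) auto
qed simp

lemma space_mu_ne: "space \<mu> \<noteq> {}"
  using prob_mu by (rule prob_space.not_empty)

lemma sets_J [simp, measurable_cong]: "sets J = sets (N \<Otimes>\<^sub>M count_space UNIV)"
  unfolding J_def by (rule sets_bind) (auto simp: space_mu_ne)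

lemma space_J: "space J = space \<mu> \<times> UNIV"
  using sets_eq_imp_space_eq[OF sets_J] by (simp add: space_pair_measure space_N)

lemma prob_J: "prob_space J"
  unfolding J_def
proof (rule prob_space_bind'[where N = "N \<Otimes>\<^sub>M count_space UNIV"])
  show "\<mu> \<in> space (prob_algebra \<mu>)" using prob_mu by (simp add: space_prob_algebra)
  show "(\<lambda>w. distr (measure_pmf (K w)) (N \<Otimes>\<^sub>M count_space UNIV) (\<lambda>\<omega>. (w, \<omega>)))
    \<in> \<mu> \<rightarrow>\<^sub>M prob_algebra (N \<Otimes>\<^sub>M count_space UNIV)"
    by (rule measurable_prob_algebraI[OF _ measurable_kernel])
      (intro prob_space.prob_space_distr measurable_Pair_outcome measure_pmf.prob_space_axioms)
qed

lemma emeasure_J: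
  assumes A: "A \<in> sets (N \<Otimes>\<^sub>M count_space UNIV)"
  shows "emeasure J A = (\<integral>\<^sup>+w. (\<Sum>\<omega>\<in>F. ennreal (pmf (K w) \<omega>) * indicator A (w, \<omega>)) \<partial>\<mu>)"
  unfolding J_def
  by (subst emeasure_bind[OF space_mu_ne measurable_kernel A]) (auto intro!: nn_integral_cong emeasure_K[OF _ A])

text \<open>All densities below are verified through this reduction: expectations under
  \<open>J\<close> are integrals over \<open>\<mu>\<close> of finite sums over
  \<open>F\<close>.\<close>

lemma distributed_J_I:
  assumes f: "f \<in> borel_measurable R" and \<Phi>: "\<Phi> \<in> N \<Otimes>\<^sub>M count_space UNIV \<rightarrow>\<^sub>M R"
    and eq: "\<And>A. A \<in> sets R \<Longrightarrow>
      (\<integral>\<^sup>+w. (\<Sum>\<omega>\<in>F. ennreal (pmf (K w) \<omega>) * indicator A (\<Phi> (w, \<omega>))) \<partial>\<mu>) = (\<integral>\<^sup>+x. f x * indicator A x \<partial>R)"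
  shows "distributed J R \<Phi> f"
proof -
  have \<Phi>': "\<Phi> \<in> J \<rightarrow>\<^sub>M R" using \<Phi> by (subst measurable_cong_sets[OF sets_J refl])
  have "distr J R \<Phi> = density R f"
  proof (rule measure_eqI)
    fix A assume "A \<in> sets (distr J R \<Phi>)"
    then have A: "A \<in> sets R" by simp
    have sA: "\<Phi> -` A \<inter> space J \<in> sets (N \<Otimes>\<^sub>M count_space UNIV)"
      using measurable_sets[OF \<Phi>' A] by simp
    have "emeasure (distr J R \<Phi>) A = emeasure J (\<Phi> -` A \<inter> space J)"
      using \<Phi>' A by (rule emeasure_distr)
    also have "\<dots> = (\<integral>\<^sup>+w. (\<Sum>\<omega>\<in>F. ennreal (pmf (K w) \<omega>) * indicator A (\<Phi> (w, \<omega>))) \<partial>\<mu>)"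
      unfolding emeasure_J[OF sA]
      by (intro nn_integral_cong sum.cong refl) (auto simp: indicator_def space_J)
    also have "\<dots> = emeasure (density R f) A"
      using f A by (subst emeasure_density) (auto simp: eq)
    finally show "emeasure (distr J R \<Phi>) A = emeasure (density R f) A" .
  qed simp
  then show ?thesis using f \<Phi>' by (simp add: distributed_def)
qed

end

text \<open>Boundedness of \<open>x * ln x\<close> makes every entropy integrand bounded, hence
  integrable over the finite measures involved.\<close>

lemma abs_mult_ln_le_1:
  fixes x :: real assumes "0 \<le> x" "x \<le> 1" shows "\<bar>x * ln x\<bar> \<le> 1"
proof (cases "x = 0")
  case False
  then have x: "0 < x" using assms by simp
  have "ln (1/x) \<le> 1/x - 1" using x by (intro ln_le_minus_one) simp
  then have "- ln x \<le> 1/x - 1" using x by (simp add: ln_div)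
  then have "x * (- ln x) \<le> x * (1/x - 1)" using x by (intro mult_left_mono) auto
  also have "\<dots> \<le> 1" using x by (simp add: field_simps)
  finally have "- (x * ln x) \<le> 1" by simp
  moreover have "x * ln x \<le> 0" using x assms by (simp add: mult_le_0_iff)
  ultimately show ?thesis by simp
qed simp

lemma abs_mult_log_le:
  fixes x :: real assumes "0 \<le> x" "x \<le> 1" "1 < b" shows "\<bar>x * log b x\<bar> \<le> 1 / ln b"
  using abs_mult_ln_le_1[OF assms(1,2)] assms(3)
  by (simp add: log_def abs_mult divide_right_mono)

section \<open>Densities of two discrete variables together with the parameter\<close>

locale finite_kernel_vars = finite_kernel \<mu> N K F
  for \<mu> :: "'w measure" and N :: "'w measure" and K :: "'w \<Rightarrow> 'o pmf" and F :: "'o set" +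
  fixes S :: "'x measure" and T :: "'y measure" and X :: "'o \<Rightarrow> 'x" and Y :: "'o \<Rightarrow> 'y"
    and FX :: "'x set" and FY :: "'y set"
  assumes fin_FX: "finite FX" and fin_FY: "finite FY"
    and X_FX: "\<And>\<omega>. \<omega> \<in> F \<Longrightarrow> X \<omega> \<in> FX" and Y_FY: "\<And>\<omega>. \<omega> \<in> F \<Longrightarrow> Y \<omega> \<in> FY"
    and X_S: "\<And>\<omega>. X \<omega> \<in> space S" and Y_T: "\<And>\<omega>. Y \<omega> \<in> space T"
    and FX_S: "\<And>x. x \<in> FX \<Longrightarrow> {x} \<in> sets S" and FY_T: "\<And>y. y \<in> FY \<Longrightarrow> {y} \<in> sets T"
begin

text \<open>Only the \<open>\<sigma>\<close>-algebras of \<open>S\<close> and \<open>T\<close> enter the mutual information, so these may be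
  replaced by finite counting measures, with respect to which all the laws involved have densities.\<close>

definition "S' = distr (count_space FX) S (\<lambda>x. x)"
definition "T' = distr (count_space FY) T (\<lambda>x. x)"

lemma sets_S' [simp, measurable_cong]: "sets S' = sets S" by (simp add: S'_def)
lemma sets_T' [simp, measurable_cong]: "sets T' = sets T" by (simp add: T'_def)
lemma space_S' [simp]: "space S' = space S" by (simp add: S'_def)
lemma space_T' [simp]: "space T' = space T" by (simp add: T'_def)

lemma FX_sub: "FX \<subseteq> space S" using FX_S sets.sets_into_space by blast
lemma FY_sub: "FY \<subseteq> space T" using FY_T sets.sets_into_space by blast

lemma finite_measure_S: "finite_measure S'" unfolding S'_def
  by (rule finite_measure_distr_count_space_finite[OF fin_FX FX_sub])
lemma finite_measure_T: "finite_measure T'" unfolding T'_def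
  by (rule finite_measure_distr_count_space_finite[OF fin_FY FY_sub])
lemma finite_measure_mu: "finite_measure \<mu>" using prob_mu by (rule prob_space.finite_measure)

lemma sigma_finite_measures: "sigma_finite_measure S'" "sigma_finite_measure T'" "sigma_finite_measure \<mu>"
  using finite_measure_S finite_measure_T finite_measure_mu finite_measure.sigma_finite_measure by auto

lemma nn_integral_S: "h \<in> borel_measurable S \<Longrightarrow> (\<integral>\<^sup>+x. h x \<partial>S') = (\<Sum>x\<in>FX. h x)"
  unfolding S'_def by (rule nn_integral_distr_count_space_finite[OF fin_FX FX_sub])
lemma nn_integral_Tmu: "h \<in> borel_measurable (T' \<Otimes>\<^sub>M \<mu>) \<Longrightarrow> (\<integral>\<^sup>+z. h z \<partial>(T' \<Otimes>\<^sub>M \<mu>)) = (\<integral>\<^sup>+w. (\<Sum>y\<in>FY. h (y, w)) \<partial>\<mu>)"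
  unfolding T'_def by (rule nn_integral_pair_distr_count_space_finite[OF fin_FY FY_sub sigma_finite_measures(3)])

lemma nn_integral_Smu: "h \<in> borel_measurable (S' \<Otimes>\<^sub>M \<mu>) \<Longrightarrow> (\<integral>\<^sup>+z. h z \<partial>(S' \<Otimes>\<^sub>M \<mu>)) = (\<integral>\<^sup>+w. (\<Sum>x\<in>FX. h (x, w)) \<partial>\<mu>)"
  unfolding S'_def by (rule nn_integral_pair_distr_count_space_finite[OF fin_FX FX_sub sigma_finite_measures(3)])

lemma nn_integral_STmu:
  assumes [measurable]: "h \<in> borel_measurable (S' \<Otimes>\<^sub>M T' \<Otimes>\<^sub>M \<mu>)"
  shows "(\<integral>\<^sup>+z. h z \<partial>(S' \<Otimes>\<^sub>M T' \<Otimes>\<^sub>M \<mu>)) = (\<integral>\<^sup>+w. (\<Sum>x\<in>FX. \<Sum>y\<in>FY. h (x, y, w)) \<partial>\<mu>)"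
proof -
  interpret T: sigma_finite_measure T' by (rule sigma_finite_measures)
  interpret M: sigma_finite_measure \<mu> by (rule sigma_finite_measures)
  interpret pair_sigma_finite T' \<mu> ..
  interpret sigma_finite_measure "T' \<Otimes>\<^sub>M \<mu>" by (rule sigma_finite_measure_axioms)
  have "(\<lambda>x. \<integral>\<^sup>+z. h (x, z) \<partial>(T' \<Otimes>\<^sub>M \<mu>)) \<in> borel_measurable S'" by measurable
  then have "(\<integral>\<^sup>+z. h z \<partial>(S' \<Otimes>\<^sub>M T' \<Otimes>\<^sub>M \<mu>)) = (\<Sum>x\<in>FX. \<integral>\<^sup>+z. h (x, z) \<partial>(T' \<Otimes>\<^sub>M \<mu>))"
    by (subst nn_integral_fst[symmetric]) (auto simp: nn_integral_S measurable_cong_sets[OF sets_S' refl])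
  also have "\<dots> = (\<Sum>x\<in>FX. \<integral>\<^sup>+w. (\<Sum>y\<in>FY. h (x, y, w)) \<partial>\<mu>)"
    using FX_sub by (intro sum.cong refl) (subst nn_integral_Tmu, auto)
  also have "\<dots> = (\<integral>\<^sup>+w. (\<Sum>x\<in>FX. \<Sum>y\<in>FY. h (x, y, w)) \<partial>\<mu>)"
  proof (intro nn_integral_sum[symmetric] borel_measurable_sum)
    fix x y assume "x \<in> FX" "y \<in> FY"
    then have "(\<lambda>w. (x, y, w)) \<in> \<mu> \<rightarrow>\<^sub>M S' \<Otimes>\<^sub>M T' \<Otimes>\<^sub>M \<mu>"
      using FX_sub FY_sub by (intro measurable_Pair measurable_const) auto
    then show "(\<lambda>w. h (x, y, w)) \<in> borel_measurable \<mu>" by measurable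
  qed
  finally show ?thesis .
qed

text \<open>Conditional laws given \<open>w\<close>. Since \<open>\<mu>\<close> is its own reference
  measure, with density 1, they are at the same time the joint densities with \<open>w\<close>; as
  finite sums over \<open>F\<close> they are measurable in all arguments jointly.\<close>

definition "aX w x = (\<Sum>\<omega>\<in>F. pmf (K w) \<omega> * indicator {X \<omega>} x)"
definition "aY w y = (\<Sum>\<omega>\<in>F. pmf (K w) \<omega> * indicator {Y \<omega>} y)"
definition "aXY w x y = (\<Sum>\<omega>\<in>F. pmf (K w) \<omega> * (indicator {X \<omega>} x * indicator {Y \<omega>} y))"

lemma sum_K: "w \<in> space \<mu> \<Longrightarrow> (\<Sum>\<omega>\<in>F. pmf (K w) \<omega>) = 1"
  using K_sub fin_F by (intro sum_pmf_eq_1) auto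

lemma a_bounds:
  shows "0 \<le> aX w x" "0 \<le> aY w y" "0 \<le> aXY w x y"
    and "w \<in> space \<mu> \<Longrightarrow> aX w x \<le> 1" "w \<in> space \<mu> \<Longrightarrow> aY w y \<le> 1" "w \<in> space \<mu> \<Longrightarrow> aXY w x y \<le> 1"
proof -
  show "0 \<le> aX w x" "0 \<le> aY w y" "0 \<le> aXY w x y"
    by (auto simp: aX_def aY_def aXY_def intro!: sum_nonneg)
  assume w: "w \<in> space \<mu>"
  have *: "(\<Sum>\<omega>\<in>F. pmf (K w) \<omega> * c \<omega>) \<le> 1" if "\<And>\<omega>. c \<omega> \<le> (1::real)" for c
  proof -
    have "(\<Sum>\<omega>\<in>F. pmf (K w) \<omega> * c \<omega>) \<le> (\<Sum>\<omega>\<in>F. pmf (K w) \<omega> * 1)"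
      using that by (intro sum_mono mult_left_mono) auto
    then show ?thesis using sum_K[OF w] by simp
  qed
  show "aX w x \<le> 1" "aY w y \<le> 1" "aXY w x y \<le> 1"
    unfolding aX_def aY_def aXY_def by (auto intro!: * simp: indicator_def)
qed

lemma measurable_indicators:
  "\<omega> \<in> F \<Longrightarrow> indicator {X \<omega>} \<in> borel_measurable S" "\<omega> \<in> F \<Longrightarrow> indicator {Y \<omega>} \<in> borel_measurable T"
  using FX_S FY_T X_FX Y_FY by auto

lemma aX_meas [measurable]: "(\<lambda>(x, w). aX w x) \<in> borel_measurable (S' \<Otimes>\<^sub>M \<mu>)"
  unfolding aX_def split_beta'
  by (intro borel_measurable_sum borel_measurable_times measurable_compose[OF measurable_snd K_meas]
      measurable_compose[OF measurable_fst]) (auto simp: measurable_indicators measurable_cong_sets[OF sets_S' refl])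

lemma aY_meas [measurable]: "(\<lambda>(x, w). aY w x) \<in> borel_measurable (T' \<Otimes>\<^sub>M \<mu>)"
  unfolding aY_def split_beta'
  by (intro borel_measurable_sum borel_measurable_times measurable_compose[OF measurable_snd K_meas]
      measurable_compose[OF measurable_fst]) (auto simp: measurable_indicators measurable_cong_sets[OF sets_T' refl])

lemma aXY_meas [measurable]: "(\<lambda>(x, y, w). aXY w x y) \<in> borel_measurable (S' \<Otimes>\<^sub>M T' \<Otimes>\<^sub>M \<mu>)"
proof -
  have 1: "(\<lambda>z. indicator {X \<omega>} (fst z) :: real) \<in> borel_measurable (S' \<Otimes>\<^sub>M T' \<Otimes>\<^sub>M \<mu>)" if "\<omega> \<in> F" for \<omega>
    by (rule measurable_compose[OF measurable_fst]) (auto simp: measurable_indicators that measurable_cong_sets[OF sets_S' refl])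
  have 2: "(\<lambda>z. indicator {Y \<omega>} (fst (snd z)) :: real) \<in> borel_measurable (S' \<Otimes>\<^sub>M T' \<Otimes>\<^sub>M \<mu>)" if "\<omega> \<in> F" for \<omega>
    by (rule measurable_compose[OF measurable_compose[OF measurable_snd measurable_fst]])
      (auto simp: measurable_indicators that measurable_cong_sets[OF sets_T' refl])
  have 3: "(\<lambda>z. pmf (K (snd (snd z))) \<omega>) \<in> borel_measurable (S' \<Otimes>\<^sub>M T' \<Otimes>\<^sub>M \<mu>)" for \<omega>
    by measurable
  show ?thesis unfolding aXY_def split_beta'
    by (intro borel_measurable_sum borel_measurable_times 1 2 3)
qed

lemma measurable_X: "(\<lambda>(w, \<omega>). X \<omega>) \<in> N \<Otimes>\<^sub>M count_space UNIV \<rightarrow>\<^sub>M S'"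
  unfolding split_beta' by (rule measurable_compose[OF measurable_snd]) (auto simp: X_S)
lemma measurable_Y: "(\<lambda>(w, \<omega>). Y \<omega>) \<in> N \<Otimes>\<^sub>M count_space UNIV \<rightarrow>\<^sub>M T'"
  unfolding split_beta' by (rule measurable_compose[OF measurable_snd]) (auto simp: Y_T)
lemma measurable_W: "fst \<in> N \<Otimes>\<^sub>M count_space (UNIV :: 'o set) \<rightarrow>\<^sub>M \<mu>"
  by (subst measurable_cong_sets[OF refl sets_N[symmetric]]) (rule measurable_fst)

lemma sum_indicator_pick:
  fixes g :: "'z \<Rightarrow> ennreal"
  assumes "finite G" "z \<in> G" shows "(\<Sum>x\<in>G. indicator {z} x * g x) = g z"
  using assms by (subst sum.remove[of _ z]) (auto intro!: sum.neutral)

text \<open>Transfers expectations from the values of \<open>V\<close> to the outcomes, in the shape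
  in which \<open>distributed_J_I\<close> asks for them.\<close>

lemma sum_law_swap:
  fixes g :: "'z \<Rightarrow> ennreal"
  assumes "finite G" "\<And>\<omega>. \<omega> \<in> F \<Longrightarrow> V \<omega> \<in> G"
  shows "(\<Sum>x\<in>G. ennreal (\<Sum>\<omega>\<in>F. pmf (K w) \<omega> * indicator {V \<omega>} x) * g x)
    = (\<Sum>\<omega>\<in>F. ennreal (pmf (K w) \<omega>) * g (V \<omega>))"
proof -
  have "(\<Sum>x\<in>G. ennreal (\<Sum>\<omega>\<in>F. pmf (K w) \<omega> * indicator {V \<omega>} x) * g x)
     = (\<Sum>x\<in>G. \<Sum>\<omega>\<in>F. ennreal (pmf (K w) \<omega>) * (indicator {V \<omega>} x * g x))"
    by (subst sum_ennreal[symmetric])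
      (auto simp: sum_distrib_right ennreal_mult ennreal_indicator mult.assoc)
  also have "\<dots> = (\<Sum>\<omega>\<in>F. \<Sum>x\<in>G. ennreal (pmf (K w) \<omega>) * (indicator {V \<omega>} x * g x))"
    by (rule sum.swap)
  also have "\<dots> = (\<Sum>\<omega>\<in>F. ennreal (pmf (K w) \<omega>) * g (V \<omega>))"
    unfolding sum_distrib_left[symmetric]
    by (intro sum.cong refl arg_cong2[where f = "(*)"] sum_indicator_pick assms)
  finally show ?thesis .
qed

lemma distributed_W: "distributed J \<mu> fst (\<lambda>_. ennreal 1)"
proof (rule distributed_J_I[OF _ measurable_W])
  fix A assume A: "A \<in> sets \<mu>"
  have "(\<integral>\<^sup>+w. (\<Sum>\<omega>\<in>F. ennreal (pmf (K w) \<omega>) * indicator A (fst (w, \<omega>))) \<partial>\<mu>)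
    = (\<integral>\<^sup>+w. indicator A w \<partial>\<mu>)"
    by (intro nn_integral_cong) (simp add: sum_distrib_right[symmetric] sum_K)
  then show "(\<integral>\<^sup>+w. (\<Sum>\<omega>\<in>F. ennreal (pmf (K w) \<omega>) * indicator A (fst (w, \<omega>))) \<partial>\<mu>)
    = (\<integral>\<^sup>+x. ennreal 1 * indicator A x \<partial>\<mu>)" by simp
qed simp

lemma distributed_pair:
  assumes G: "finite G" "\<And>\<omega>. \<omega> \<in> F \<Longrightarrow> V \<omega> \<in> G"
    and meas: "(\<lambda>(x, w). \<Sum>\<omega>\<in>F. pmf (K w) \<omega> * indicator {V \<omega>} x) \<in> borel_measurable (R \<Otimes>\<^sub>M \<mu>)"
    and V: "(\<lambda>(w, \<omega>). V \<omega>) \<in> N \<Otimes>\<^sub>M count_space UNIV \<rightarrow>\<^sub>M R"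
    and R: "\<And>h. h \<in> borel_measurable (R \<Otimes>\<^sub>M \<mu>) \<Longrightarrow> (\<integral>\<^sup>+z. h z \<partial>(R \<Otimes>\<^sub>M \<mu>)) = (\<integral>\<^sup>+w. (\<Sum>x\<in>G. h (x, w)) \<partial>\<mu>)"
  shows "distributed J (R \<Otimes>\<^sub>M \<mu>) (\<lambda>z. ((\<lambda>(w, \<omega>). V \<omega>) z, fst z))
    (\<lambda>z. ennreal ((\<lambda>(x, w). \<Sum>\<omega>\<in>F. pmf (K w) \<omega> * indicator {V \<omega>} x) z))"
proof (rule distributed_J_I)
  note [measurable] = meas
  show "(\<lambda>z. ennreal ((\<lambda>(x, w). \<Sum>\<omega>\<in>F. pmf (K w) \<omega> * indicator {V \<omega>} x) z)) \<in> borel_measurable (R \<Otimes>\<^sub>M \<mu>)"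
    by measurable
  show "(\<lambda>z. ((\<lambda>(w, \<omega>). V \<omega>) z, fst z)) \<in> N \<Otimes>\<^sub>M count_space UNIV \<rightarrow>\<^sub>M R \<Otimes>\<^sub>M \<mu>"
    by (intro measurable_Pair V measurable_W)
  fix A assume [measurable]: "A \<in> sets (R \<Otimes>\<^sub>M \<mu>)"
  show "(\<integral>\<^sup>+w. (\<Sum>\<omega>\<in>F. ennreal (pmf (K w) \<omega>) * indicator A ((\<lambda>(w, \<omega>). V \<omega>) (w, \<omega>), fst (w, \<omega>))) \<partial>\<mu>)
    = (\<integral>\<^sup>+z. ennreal ((\<lambda>(x, w). \<Sum>\<omega>\<in>F. pmf (K w) \<omega> * indicator {V \<omega>} x) z) * indicator A z \<partial>(R \<Otimes>\<^sub>M \<mu>))"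
    by (subst R, measurable) (auto intro!: nn_integral_cong simp: sum_law_swap[OF G])
qed

lemma distributed_XW: "distributed J (S' \<Otimes>\<^sub>M \<mu>) (\<lambda>z. ((\<lambda>(w, \<omega>). X \<omega>) z, fst z)) (\<lambda>z. ennreal ((\<lambda>(x, w). aX w x) z))"
  using aX_meas unfolding aX_def by (intro distributed_pair[OF fin_FX X_FX _ measurable_X nn_integral_Smu])

lemma distributed_YW: "distributed J (T' \<Otimes>\<^sub>M \<mu>) (\<lambda>z. ((\<lambda>(w, \<omega>). Y \<omega>) z, fst z)) (\<lambda>z. ennreal ((\<lambda>(x, w). aY w x) z))"
  using aY_meas unfolding aY_def by (intro distributed_pair[OF fin_FY Y_FY _ measurable_Y nn_integral_Tmu])

lemma distributed_XYW: "distributed J (S' \<Otimes>\<^sub>M T' \<Otimes>\<^sub>M \<mu>)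
  (\<lambda>z. ((\<lambda>(w, \<omega>). X \<omega>) z, (\<lambda>(w, \<omega>). Y \<omega>) z, fst z)) (\<lambda>z. ennreal ((\<lambda>(x, y, w). aXY w x y) z))"
proof (rule distributed_J_I)
  show "(\<lambda>z. ennreal ((\<lambda>(x, y, w). aXY w x y) z)) \<in> borel_measurable (S' \<Otimes>\<^sub>M T' \<Otimes>\<^sub>M \<mu>)" by measurable
  show "(\<lambda>z. ((\<lambda>(w, \<omega>). X \<omega>) z, (\<lambda>(w, \<omega>). Y \<omega>) z, fst z)) \<in> N \<Otimes>\<^sub>M count_space UNIV \<rightarrow>\<^sub>M S' \<Otimes>\<^sub>M T' \<Otimes>\<^sub>M \<mu>"
    by (intro measurable_Pair measurable_X measurable_Y measurable_W)
  fix A assume [measurable]: "A \<in> sets (S' \<Otimes>\<^sub>M T' \<Otimes>\<^sub>M \<mu>)"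
  have eq: "(\<Sum>x\<in>FX. \<Sum>y\<in>FY. ennreal (aXY w x y) * indicator A (x, y, w))
      = (\<Sum>\<omega>\<in>F. ennreal (pmf (K w) \<omega>) * indicator A (X \<omega>, Y \<omega>, w))" for w
  proof -
    have "(\<Sum>x\<in>FX. \<Sum>y\<in>FY. ennreal (aXY w x y) * indicator A (x, y, w))
      = (\<Sum>z\<in>FX \<times> FY. ennreal (\<Sum>\<omega>\<in>F. pmf (K w) \<omega> * indicator {(X \<omega>, Y \<omega>)} z) * indicator A (fst z, snd z, w))"
    proof -
      have "indicat_real {X \<omega>} x * indicat_real {Y \<omega>} y = indicator {(X \<omega>, Y \<omega>)} (x, y)" for \<omega> x y
        by (simp split: split_indicator)
      then show ?thesis
        unfolding sum.cartesian_product aXY_def by (simp add: split_beta')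
    qed
    also have "\<dots> = (\<Sum>\<omega>\<in>F. ennreal (pmf (K w) \<omega>) * indicator A (X \<omega>, Y \<omega>, w))"
      by (subst sum_law_swap) (auto simp: fin_FX fin_FY X_FX Y_FY)
    finally show ?thesis .
  qed
  show "(\<integral>\<^sup>+w. (\<Sum>\<omega>\<in>F. ennreal (pmf (K w) \<omega>) * indicator A ((\<lambda>(w, \<omega>). X \<omega>) (w, \<omega>), (\<lambda>(w, \<omega>). Y \<omega>) (w, \<omega>), fst (w, \<omega>))) \<partial>\<mu>)
    = (\<integral>\<^sup>+z. ennreal ((\<lambda>(x, y, w). aXY w x y) z) * indicator A z \<partial>(S' \<Otimes>\<^sub>M T' \<Otimes>\<^sub>M \<mu>))"
    by (subst nn_integral_STmu, measurable) (auto intro!: nn_integral_cong simp: eq)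
qed

lemma aX_meas1 [measurable]: "x \<in> FX \<Longrightarrow> (\<lambda>w. aX w x) \<in> borel_measurable \<mu>"
  unfolding aX_def by measurable

text \<open>The marginal averaged over the bias enters as one of the finite entropies that the
  generic formula for conditional mutual information asks for.\<close>

lemma distributed_X: "distributed J S' (\<lambda>(w, \<omega>). X \<omega>) (\<lambda>x. ennreal (\<integral>w. aX w x \<partial>\<mu>))"
proof (rule distributed_J_I[OF _ measurable_X])
  interpret sigma_finite_measure \<mu> by (rule sigma_finite_measures)
  have eq: "ennreal (\<integral>w. aX w x \<partial>\<mu>) = (\<integral>\<^sup>+w. ennreal (aX w x) \<partial>\<mu>)" for x
  proof (rule nn_integral_eq_integral[symmetric])
    show "integrable \<mu> (\<lambda>w. aX w x)"
    proof (rule finite_measure.integrable_const_bound[OF finite_measure_mu, where B = 1])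
      show "AE w in \<mu>. norm (aX w x) \<le> 1" by (auto simp: a_bounds)
      show "(\<lambda>w. aX w x) \<in> borel_measurable \<mu>" unfolding aX_def by measurable
    qed
  qed (simp add: a_bounds)
  show "(\<lambda>x. ennreal (\<integral>w. aX w x \<partial>\<mu>)) \<in> borel_measurable S'"
    unfolding eq by measurable
  fix A assume [measurable]: "A \<in> sets S'"
  have "(\<lambda>x. (\<integral>\<^sup>+w. ennreal (aX w x) \<partial>\<mu>) * indicator A x) \<in> borel_measurable S'" by measurable
  then have "(\<integral>\<^sup>+x. ennreal (\<integral>w. aX w x \<partial>\<mu>) * indicator A x \<partial>S')
    = (\<Sum>x\<in>FX. (\<integral>\<^sup>+w. ennreal (aX w x) \<partial>\<mu>) * indicator A x)"
    unfolding eq by (subst nn_integral_S) (auto simp: measurable_cong_sets[OF sets_S' refl])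
  also have "\<dots> = (\<Sum>x\<in>FX. (\<integral>\<^sup>+w. ennreal (aX w x) * indicator A x \<partial>\<mu>))"
    by (intro sum.cong refl nn_integral_multc[symmetric]) auto
  also have "\<dots> = (\<integral>\<^sup>+w. (\<Sum>x\<in>FX. ennreal (aX w x) * indicator A x) \<partial>\<mu>)"
    by (intro nn_integral_sum[symmetric]) auto
  also have "\<dots> = (\<integral>\<^sup>+w. (\<Sum>\<omega>\<in>F. ennreal (pmf (K w) \<omega>) * indicator A ((\<lambda>(w, \<omega>). X \<omega>) (w, \<omega>))) \<partial>\<mu>)"
    by (auto intro!: nn_integral_cong simp: aX_def sum_law_swap[OF fin_FX X_FX])
  finally show "(\<integral>\<^sup>+w. (\<Sum>\<omega>\<in>F. ennreal (pmf (K w) \<omega>) * indicator A ((\<lambda>(w, \<omega>). X \<omega>) (w, \<omega>))) \<partial>\<mu>)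
    = (\<integral>\<^sup>+x. ennreal (\<integral>w. aX w x \<partial>\<mu>) * indicator A x \<partial>S')" ..
qed

lemma finite_measure_prods:
  "finite_measure (S' \<Otimes>\<^sub>M \<mu>)" "finite_measure (T' \<Otimes>\<^sub>M \<mu>)" "finite_measure (S' \<Otimes>\<^sub>M T' \<Otimes>\<^sub>M \<mu>)"
  by (intro finite_measure_pair_measure finite_measure_S finite_measure_T finite_measure_mu)+

lemma finite_entropyI:
  assumes "1 < b" "finite_measure R" "distributed J R V (\<lambda>z. ennreal (f z))" "f \<in> borel_measurable R"
    and "\<And>z. z \<in> space R \<Longrightarrow> 0 \<le> f z \<and> f z \<le> 1"
  shows "information_space.finite_entropy J b R V f"
proof -
  interpret prob_space J by (rule prob_J)
  interpret information_space J b using assms by unfold_locales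
  have "integrable R (\<lambda>z. f z * log b (f z))"
    using assms(5) abs_mult_log_le[OF _ _ assms(1)] assms(4)
    by (intro finite_measure.integrable_const_bound[OF assms(2), where B = "1 / ln b"]) auto
  then show ?thesis using assms by (auto simp: finite_entropy_def)
qed

lemma aXY_le: "aXY w x y \<le> aX w x" "aXY w x y \<le> aY w y"
  by (auto simp: aX_def aY_def aXY_def intro!: sum_mono mult_left_mono split: split_indicator)

text \<open>Write a for the joint mass and p, q for the marginal ones. From a \<le> p, a \<le> q and
  p q \<le> 1 the quotient a / (p q) lies between a and 1 / a, so the term is at most |a ln a|, up
  to the base. The bound is uniform in \<open>w\<close>, which settles integrability.\<close>

lemma mi_term_bound:
  assumes b: "1 < b" and w: "w \<in> space \<mu>"
  shows "\<bar>aXY w x y * log b (aXY w x y / (aX w x * aY w y))\<bar> \<le> 1 / ln b"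
proof (cases "aXY w x y = 0")
  case False
  define a p q where "a = aXY w x y" "p = aX w x" "q = aY w y"
  have a: "0 < a" using False a_bounds(3)[of w x y] by (simp add: a_p_q_def)
  have le: "a \<le> p" "a \<le> q" "a \<le> 1" "p \<le> 1" "q \<le> 1"
    using aXY_le a_bounds w by (auto simp: a_p_q_def)
  have pq: "0 < p" "0 < q" using a le by auto
  have "p * q \<le> 1" "a * a \<le> p * q" using le a pq by (auto intro!: mult_le_one mult_mono)
  then have "a / (p * q) \<le> 1 / a" "a \<le> a / (p * q)"
    using a pq by (auto simp: field_simps mult_left_le)
  then have "ln (a / (p * q)) \<le> ln (1 / a)" "ln a \<le> ln (a / (p * q))"
    using a pq by (subst ln_le_cancel_iff; simp)+
  then have "\<bar>ln (a / (p * q))\<bar> \<le> \<bar>ln a\<bar>"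
  proof -
    have "ln (1 / a) = - ln a" "ln a \<le> 0" using a le by (auto simp: ln_div)
    then show ?thesis using \<open>ln (a / (p * q)) \<le> ln (1 / a)\<close> \<open>ln a \<le> ln (a / (p * q))\<close> by linarith
  qed
  then have "\<bar>a * ln (a / (p * q))\<bar> \<le> \<bar>a * ln a\<bar>"
    using a by (simp add: abs_mult)
  also have "\<dots> \<le> 1" using abs_mult_ln_le_1[of a] a le by simp
  finally show ?thesis using b unfolding a_p_q_def[symmetric]
    by (simp add: log_def abs_mult divide_right_mono)
qed (use b in simp)

lemma integralS:
  fixes h :: "_ \<Rightarrow> real"
  shows "h \<in> borel_measurable S \<Longrightarrow> (\<integral>x. h x \<partial>S') = (\<Sum>x\<in>FX. h x)"
  unfolding S'_def using FX_sub fin_FX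
  by (subst integral_distr) (auto simp: lebesgue_integral_count_space_finite)

lemma integralT:
  fixes h :: "_ \<Rightarrow> real"
  shows "h \<in> borel_measurable T \<Longrightarrow> (\<integral>x. h x \<partial>T') = (\<Sum>x\<in>FY. h x)"
  unfolding T'_def using FY_sub fin_FY
  by (subst integral_distr) (auto simp: lebesgue_integral_count_space_finite)

text \<open>The parameter may be continuous while everything else is discrete, so the abstract
  conditional information becomes an average over \<open>\<mu>\<close> of finite sums.\<close>

theorem conditional_mutual_information_J:
  assumes b: "1 < b"
  shows "prob_space.conditional_mutual_information J b S T N (\<lambda>(w, \<omega>). X \<omega>) (\<lambda>(w, \<omega>). Y \<omega>) fst
    = (\<integral>w. (\<Sum>x\<in>FX. \<Sum>y\<in>FY. aXY w x y * log b (aXY w x y / (aX w x * aY w y))) \<partial>\<mu>)"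
proof -
  interpret prob_space J by (rule prob_J)
  interpret information_space J b using b by unfold_locales
  interpret T: sigma_finite_measure T' by (rule sigma_finite_measures)
  interpret S: sigma_finite_measure S' by (rule sigma_finite_measures)
  interpret M: sigma_finite_measure \<mu> by (rule sigma_finite_measures)
  interpret TM: pair_sigma_finite T' \<mu> ..
  interpret TM: sigma_finite_measure "T' \<Otimes>\<^sub>M \<mu>" by (rule TM.sigma_finite_measure_axioms)
  interpret STM: pair_sigma_finite S' "T' \<Otimes>\<^sub>M \<mu>" ..
  let ?X = "\<lambda>(w, \<omega>). X \<omega>" and ?Y = "\<lambda>(w, \<omega>). Y \<omega>"
  let ?G = "\<lambda>(x, y, w). aXY w x y * log b (aXY w x y / (aX w x * aY w y))"
  have G_meas: "?G \<in> borel_measurable (S' \<Otimes>\<^sub>M T' \<Otimes>\<^sub>M \<mu>)"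
  proof -
    have 1: "(\<lambda>z. aX (snd (snd z)) (fst z)) \<in> borel_measurable (S' \<Otimes>\<^sub>M T' \<Otimes>\<^sub>M \<mu>)"
      using measurable_compose[OF _ aX_meas, of "\<lambda>z. (fst z, snd (snd z))" "S' \<Otimes>\<^sub>M T' \<Otimes>\<^sub>M \<mu>"] by simp
    have 2: "(\<lambda>z. aY (snd (snd z)) (fst (snd z))) \<in> borel_measurable (S' \<Otimes>\<^sub>M T' \<Otimes>\<^sub>M \<mu>)"
      using measurable_compose[OF _ aY_meas, of "\<lambda>z. (fst (snd z), snd (snd z))" "S' \<Otimes>\<^sub>M T' \<Otimes>\<^sub>M \<mu>"] by simp
    have 3: "(\<lambda>z. aXY (snd (snd z)) (fst z) (fst (snd z))) \<in> borel_measurable (S' \<Otimes>\<^sub>M T' \<Otimes>\<^sub>M \<mu>)"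
      using aXY_meas by (simp add: split_beta')
    show ?thesis unfolding split_beta'
      by (intro borel_measurable_times borel_measurable_log borel_measurable_divide 1 2 3 borel_measurable_const)
  qed
  have int3: "integrable (S' \<Otimes>\<^sub>M T' \<Otimes>\<^sub>M \<mu>) ?G"
    by (rule finite_measure.integrable_const_bound[OF finite_measure_prods(3) _ G_meas, where B = "1 / ln b"])
      (auto simp: space_pair_measure intro!: mi_term_bound[OF b])
  have int2: "integrable (T' \<Otimes>\<^sub>M \<mu>) (\<lambda>z. ?G (x, z))" if "x \<in> space S" for x
  proof (rule finite_measure.integrable_const_bound[OF finite_measure_prods(2), where B = "1 / ln b"])
    show "AE z in T' \<Otimes>\<^sub>M \<mu>. norm (?G (x, z)) \<le> 1 / ln b"
      by (auto simp: space_pair_measure intro!: mi_term_bound[OF b])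
    have "(\<lambda>z. (x, z)) \<in> T' \<Otimes>\<^sub>M \<mu> \<rightarrow>\<^sub>M S' \<Otimes>\<^sub>M T' \<Otimes>\<^sub>M \<mu>" using that by (intro measurable_Pair1') simp
    from measurable_compose[OF this G_meas]
    show "(\<lambda>z. ?G (x, z)) \<in> borel_measurable (T' \<Otimes>\<^sub>M \<mu>)" .
  qed
  have "conditional_mutual_information b S T N ?X ?Y fst = conditional_mutual_information b S' T' \<mu> ?X ?Y fst"
    unfolding conditional_mutual_information_def mutual_information_def
    by (intro arg_cong2[where f = "(-)"] arg_cong2[where f = "KL_divergence b"]
        arg_cong2[where f = "(\<Otimes>\<^sub>M)"] distr_cong refl sets_pair_measure_cong)
      (auto simp: sets_N)
  also have "\<dots> = (\<integral>z. (\<lambda>(x, y, z). (\<lambda>(x, y, w). aXY w x y) (x, y, z) * log b ((\<lambda>(x, y, w). aXY w x y) (x, y, z) /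
      ((\<lambda>(x, w). aX w x) (x, z) * ((\<lambda>(x, w). aY w x) (y, z) / (\<lambda>_. 1) z)))) z \<partial>(S' \<Otimes>\<^sub>M T' \<Otimes>\<^sub>M \<mu>))"
  proof (rule conditional_mutual_information_generic_eq')
    show "finite_entropy S' ?X (\<lambda>x. (\<integral>w. aX w x \<partial>\<mu>))"
    proof (rule finite_entropyI[OF b finite_measure_S distributed_X])
      show "(\<lambda>x. \<integral>w. aX w x \<partial>\<mu>) \<in> borel_measurable S'"
        by (rule M.borel_measurable_lebesgue_integral) (use aX_meas in \<open>simp add: split_beta'\<close>)
      fix x
      have "(\<integral>w. aX w x \<partial>\<mu>) \<le> (\<integral>w. 1 \<partial>\<mu>)"
        using a_bounds finite_measure_mu by (intro integral_mono') (auto simp: finite_measure.integrable_const)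
      then show "0 \<le> (\<integral>w. aX w x \<partial>\<mu>) \<and> (\<integral>w. aX w x \<partial>\<mu>) \<le> 1"
        using a_bounds prob_space.prob_space[OF prob_mu] by (auto intro!: integral_nonneg_AE)
    qed
    show "finite_entropy \<mu> fst (\<lambda>_. 1)"
      by (rule finite_entropyI[OF b finite_measure_mu distributed_W]) auto
    show "finite_entropy (S' \<Otimes>\<^sub>M \<mu>) (\<lambda>z. (?X z, fst z)) (\<lambda>(x, w). aX w x)"
      by (rule finite_entropyI[OF b finite_measure_prods(1) distributed_XW])
        (auto simp: a_bounds space_pair_measure)
    show "finite_entropy (T' \<Otimes>\<^sub>M \<mu>) (\<lambda>z. (?Y z, fst z)) (\<lambda>(x, w). aY w x)"
      by (rule finite_entropyI[OF b finite_measure_prods(2) distributed_YW])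
        (auto simp: a_bounds space_pair_measure)
    show "finite_entropy (S' \<Otimes>\<^sub>M T' \<Otimes>\<^sub>M \<mu>) (\<lambda>z. (?X z, ?Y z, fst z)) (\<lambda>(x, y, w). aXY w x y)"
      by (rule finite_entropyI[OF b finite_measure_prods(3) distributed_XYW])
        (auto simp: a_bounds space_pair_measure)
  qed (rule sigma_finite_measures)+
  also have "\<dots> = (\<integral>z. ?G z \<partial>(S' \<Otimes>\<^sub>M T' \<Otimes>\<^sub>M \<mu>))"
    by (intro Bochner_Integration.integral_cong) auto
  \<comment> \<open>Fubini peels off the two finite coordinates first and leaves the integral over
    the parameter innermost.\<close>
  also have "\<dots> = (\<integral>x. (\<integral>z. ?G (x, z) \<partial>(T' \<Otimes>\<^sub>M \<mu>)) \<partial>S')"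
    by (rule STM.integral_fst'[symmetric, OF int3])
  also have "\<dots> = (\<Sum>x\<in>FX. (\<integral>z. ?G (x, z) \<partial>(T' \<Otimes>\<^sub>M \<mu>)))"
    using TM.borel_measurable_lebesgue_integral[of "\<lambda>x z. ?G (x, z)" S'] G_meas
    by (intro integralS) (simp add: split_beta' measurable_cong_sets[OF sets_S' refl])
  also have "\<dots> = (\<Sum>x\<in>FX. (\<integral>y. (\<integral>w. ?G (x, y, w) \<partial>\<mu>) \<partial>T'))"
    using FX_sub by (intro sum.cong refl TM.integral_fst'[symmetric, OF int2]) auto
  also have "\<dots> = (\<Sum>x\<in>FX. \<Sum>y\<in>FY. (\<integral>w. ?G (x, y, w) \<partial>\<mu>))"
  proof (intro sum.cong refl integralT)
    fix x assume "x \<in> FX"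
    then have "(\<lambda>z. ?G (x, z)) \<in> borel_measurable (T' \<Otimes>\<^sub>M \<mu>)"
      using int2[of x] FX_sub by auto
    then show "(\<lambda>y. \<integral>w. ?G (x, y, w) \<partial>\<mu>) \<in> borel_measurable T"
      using M.borel_measurable_lebesgue_integral[of "\<lambda>y w. ?G (x, y, w)" T']
      by (simp add: split_beta' measurable_cong_sets[OF sets_T' refl])
  qed
  also have "\<dots> = (\<integral>w. (\<Sum>x\<in>FX. \<Sum>y\<in>FY. ?G (x, y, w)) \<partial>\<mu>)"
  proof -
    have "integrable \<mu> (\<lambda>w. ?G (x, y, w))" if "x \<in> FX" "y \<in> FY" for x y
    proof (rule finite_measure.integrable_const_bound[OF finite_measure_mu, where B = "1 / ln b"])
      show "AE w in \<mu>. norm (?G (x, y, w)) \<le> 1 / ln b" by (auto intro!: mi_term_bound[OF b])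
      have [measurable]: "(\<lambda>w. aX w x) \<in> borel_measurable \<mu>" "(\<lambda>w. aY w y) \<in> borel_measurable \<mu>"
        "(\<lambda>w. aXY w x y) \<in> borel_measurable \<mu>"
        unfolding aX_def aY_def aXY_def by measurable
      show "(\<lambda>w. ?G (x, y, w)) \<in> borel_measurable \<mu>" by simp
    qed
    then show ?thesis by (simp add: integral_sum)
  qed
  finally show ?thesis by simp
qed

end

section \<open>The outcome of one fingerprinting round\<close>

text \<open>Relative entropy of two Bernoulli laws, in nats; bits enter only through the factor
  \<open>ln 2\<close> of the payoff. At \<open>u = 0\<close> and \<open>u = 1\<close> the vanishing
  factor realises the usual convention for 0 ln 0.\<close>

definition bin_kl :: "real \<Rightarrow> real \<Rightarrow> real" where
  "bin_kl u q = u * ln (u / q) + (1 - u) * ln ((1 - u) / (1 - q))"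

text \<open>\<open>Bernstein c z w\<close> is the binomial weight of z, so this is the Bernstein
  polynomial of the table \<open>t\<close>: the probability of output 1 given the bias.\<close>

definition mean_output :: "nat \<Rightarrow> (nat \<Rightarrow> real) \<Rightarrow> real \<Rightarrow> real" where
  "mean_output c t w = (\<Sum>z\<le>c. Bernstein c z w * t z)"

text \<open>Mutual information, in nats, between the number of ones and the output of one channel
  with \<open>c\<close> colluders at bias \<open>w\<close>.\<close>

definition channel_info :: "nat \<Rightarrow> (nat \<Rightarrow> real) \<Rightarrow> real \<Rightarrow> real" where
  "channel_info c t w = (\<Sum>z\<le>c. Bernstein c z w * bin_kl (t z) (mean_output c t w))"

lemma expectation_bind_finite:
  fixes h :: "'b \<Rightarrow> real"
  assumes "finite (set_pmf p)" "\<And>x. x \<in> set_pmf p \<Longrightarrow> finite (set_pmf (f x))"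
  shows "measure_pmf.expectation (p \<bind> f) h = measure_pmf.expectation p (\<lambda>x. measure_pmf.expectation (f x) h)"
proof -
  have "measure_pmf.expectation (p \<bind> f) h = (\<Sum>a\<in>set_pmf p. pmf p a *\<^sub>R measure_pmf.expectation (f a) h)"
    using assms by (intro pmf_expectation_bind) auto
  also have "\<dots> = measure_pmf.expectation p (\<lambda>x. measure_pmf.expectation (f x) h)"
    using assms by (intro integral_measure_pmf[symmetric]) auto
  finally show ?thesis .
qed

text \<open>Because \<open>v\<close> is recorded next to \<open>y\<close>, only one branch of the
  mixture can produce a given pair.\<close>

lemma pmf_bind_graph:
  "pmf (P \<bind> (\<lambda>v. map_pmf (\<lambda>y. (y, v)) (Q v))) (y, v) = pmf P v * pmf (Q v) y"
proof -
  have "pmf (map_pmf (\<lambda>y. (y, v')) (Q v')) (y, v) = indicator {v} v' * pmf (Q v) y" for v'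
  proof (cases "v' = v")
    case True
    then show ?thesis using pmf_map_inj'[of "\<lambda>y. (y, v)" "Q v" y] by (simp add: inj_def)
  next
    case False
    then show ?thesis by (auto simp: pmf_eq_0_set_pmf)
  qed
  then have "pmf (P \<bind> (\<lambda>v. map_pmf (\<lambda>y. (y, v)) (Q v))) (y, v)
      = measure_pmf.expectation P (\<lambda>v'. indicator {v} v' * pmf (Q v) y)"
    by (simp add: pmf_bind)
  then show ?thesis by (simp add: measure_pmf_single)
qed

lemma expectation_binomial_Bernstein:
  fixes h :: "nat \<Rightarrow> real"
  assumes "0 \<le> w" "w \<le> 1"
  shows "measure_pmf.expectation (binomial_pmf c w) h = (\<Sum>z\<le>c. Bernstein c z w * h z)"
  using assms by (simp add: expectation_binomial_pmf' Bernstein_def mult_ac)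

text \<open>Both ends \<open>z = 0\<close> and \<open>z = c\<close> have positive weight, and the
  marking assumption fixes the outputs there to 0 and 1. Strictness keeps the divergences from the
  mean output finite.\<close>

lemma mean_output_bounds:
  assumes w: "0 < w" "w < 1" and c: "1 \<le> c" and t: "\<And>z. z \<le> c \<Longrightarrow> 0 \<le> t z \<and> t z \<le> 1" "t 0 = 0" "t c = 1"
  shows "0 < mean_output c t w" "mean_output c t w < 1"
proof -
  have B: "0 < Bernstein c z w" if "z \<le> c" for z using Bernstein_pos w that by blast
  show "0 < mean_output c t w" unfolding mean_output_def
    using B[of c] t by (intro sum_pos2[of _ c]) (auto intro!: mult_nonneg_nonneg less_imp_le[OF B])
  have "mean_output c t w < (\<Sum>z\<le>c. Bernstein c z w)" unfolding mean_output_def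
  proof (rule sum_strict_mono_ex1)
    show "\<forall>z\<in>{..c}. Bernstein c z w * t z \<le> Bernstein c z w"
      using t less_imp_le[OF B] by (auto intro!: mult_left_le)
    show "\<exists>z\<in>{..c}. Bernstein c z w * t z < Bernstein c z w"
      using t B[of 0] by (intro bexI[of _ 0]) auto
  qed simp
  then show "mean_output c t w < 1" by simp
qed

lemma binomial_bind_bernoulli:
  assumes w: "0 < w" "w < 1" and t: "\<And>z. z \<le> c \<Longrightarrow> 0 \<le> t z \<and> t z \<le> 1"
    and m: "0 \<le> mean_output c t w" "mean_output c t w \<le> 1"
  shows "binomial_pmf c w \<bind> (\<lambda>z. bernoulli_pmf (t z)) = bernoulli_pmf (mean_output c t w)"
proof -
  have T: "pmf (binomial_pmf c w \<bind> (\<lambda>z. bernoulli_pmf (t z))) True = mean_output c t w"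
    using w t by (simp add: pmf_bind expectation_binomial_Bernstein mean_output_def)
  have F: "pmf (binomial_pmf c w \<bind> (\<lambda>z. bernoulli_pmf (t z))) False = 1 - mean_output c t w"
    using w t by (simp add: pmf_bind expectation_binomial_Bernstein mean_output_def right_diff_distrib sum_subtractf)
  show ?thesis
  proof (rule pmf_eqI)
    fix b show "pmf (binomial_pmf c w \<bind> (\<lambda>z. bernoulli_pmf (t z))) b = pmf (bernoulli_pmf (mean_output c t w)) b"
      using T F m by (cases b) auto
  qed
qed

section \<open>Partitions, allocations and the law of the counts\<close>

lemma ordered_partition_exists:
  assumes "finite I" "finite A" "card A = sum c I"
  shows "\<exists>S. S \<in> I \<rightarrow>\<^sub>E Pow A \<and> disjoint_family_on S I \<and> (\<Union>l\<in>I. S l) = A \<and> (\<forall>l\<in>I. card (S l) = c l)"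
  using assms
proof (induction I arbitrary: A rule: finite_induct)
  case empty
  then show ?case by (auto simp: disjoint_family_on_def)
next
  case (insert i I)
  have "c i \<le> card A" using insert.prems(2) insert.hyps by simp
  then obtain B where B: "B \<subseteq> A" "card B = c i" by (rule obtain_subset_with_card_n)
  have card': "card (A - B) = sum c I" using insert.prems insert.hyps B finite_subset[OF B(1) insert.prems(1)]
    by (simp add: card_Diff_subset)
  have "finite (A - B)" using insert.prems by simp
  from insert.IH[OF this card'] obtain S where
    S: "S \<in> I \<rightarrow>\<^sub>E Pow (A - B)" "disjoint_family_on S I" "(\<Union>l\<in>I. S l) = A - B" "\<forall>l\<in>I. card (S l) = c l"
    by (elim exE conjE)
  have Sl: "S l \<subseteq> A - B" if "l \<in> I" for l using S(1) that by (simp add: PiE_iff)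
  have eq: "(S(i := B)) l = S l" if "l \<in> I" for l using that insert.hyps by auto
  show ?case
  proof (intro exI[of _ "S(i := B)"] conjI)
    show "disjoint_family_on (S(i := B)) (insert i I)"
    proof -
      have "disjoint_family_on (S(i := B)) I"
        using S(2) eq by (simp add: disjoint_family_on_def del: fun_upd_apply)
      moreover have "B \<inter> (\<Union>l\<in>I. S l) = {}" using S(3) by simp
      ultimately show ?thesis using insert.hyps(2) eq
        by (simp add: disjoint_family_on_insert del: fun_upd_apply add: fun_upd_same)
    qed
    have "(\<Union>l\<in>insert i I. (S(i := B)) l) = B \<union> (\<Union>l\<in>I. S l)"
      using eq by (simp del: fun_upd_apply add: fun_upd_same)
    then show "(\<Union>l\<in>insert i I. (S(i := B)) l) = A" using S(3) B(1) by (simp add: Un_absorb1)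
    show "\<forall>l\<in>insert i I. card ((S(i := B)) l) = c l" using S(4) eq B(2) by (simp del: fun_upd_apply add: fun_upd_same)
    have "S \<in> I \<rightarrow>\<^sub>E Pow A" using S(1) by (auto simp: PiE_iff)
    then show "S(i := B) \<in> insert i I \<rightarrow>\<^sub>E Pow A" using B(1) by (intro PiE_fun_upd) auto
  qed
qed

text \<open>\<open>pmf_of_set\<close> is a uniform draw only on a nonempty finite set, so every
  allocation in the support must admit a partition.\<close>

lemma ordered_partitions_nonempty:
  assumes "c \<in> allocations L k" shows "ordered_partitions L k c \<noteq> {}"
  using ordered_partition_exists[of "{1..L}" "{1..k}" c] assms
  by (auto simp: ordered_partitions_def allocations_def)

lemma finite_ordered_partitions: "finite (ordered_partitions L k c)"
  by (rule finite_subset[of _ "{1..L} \<rightarrow>\<^sub>E Pow {1..k}"]) (auto simp: ordered_partitions_def intro!: finite_PiE)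

text \<open>The other \<open>L - 1\<close> channels take at least one colluder each.\<close>

lemma allocations_bounds:
  assumes "c \<in> allocations L k" "l \<in> {1..L}"
  shows "c l \<in> {1..k - L + 1}"
proof -
  have 1: "1 \<le> c i" if "i \<in> {1..L}" for i using assms that by (auto simp: allocations_def PiE_iff)
  have "k = c l + (\<Sum>i\<in>{1..L} - {l}. c i)"
    using assms by (subst sum.remove[symmetric]) (auto simp: allocations_def)
  moreover have "(\<Sum>i\<in>{1..L} - {l}. 1) \<le> (\<Sum>i\<in>{1..L} - {l}. c i)"
    using 1 by (intro sum_mono) auto
  moreover have "(\<Sum>i\<in>{1..L} - {l}. 1::nat) = L - 1" using assms by simp
  moreover have "1 \<le> L" using assms by simp
  ultimately show ?thesis using 1[OF assms(2)] by simp
qed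

lemma finite_allocations: "finite (allocations L k)"
proof (rule finite_subset)
  show "allocations L k \<subseteq> {1..L} \<rightarrow>\<^sub>E {..k + 1}"
  proof
    fix c assume c: "c \<in> allocations L k"
    have "c l \<le> k + 1" if "l \<in> {1..L}" for l using allocations_bounds[OF c that]
      unfolding atLeastAtMost_iff by linarith
    then show "c \<in> {1..L} \<rightarrow>\<^sub>E {..k + 1}" using c by (simp add: allocations_def PiE_iff)
  qed
qed (simp add: finite_PiE)

text \<open>After regrouping by channel, the count in each channel is a function of one factor, so
  that \<open>Pi_pmf_bind\<close> can push the counts through channel by channel.\<close>

lemma symbols_as_nested_product:
  "Pi_pmf ({1..k} \<times> {1..L}) False (\<lambda>(j, l). bernoulli_pmf (w l)) =
   map_pmf (\<lambda>h (j::nat, l::nat). h l j) (Pi_pmf {1..L} (\<lambda>_. False) (\<lambda>l. Pi_pmf {1..k} False (\<lambda>_. bernoulli_pmf (w l))))"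
  (is "?L = map_pmf ?f ?R")
proof (rule pmf_eqI)
  fix x :: "nat \<times> nat \<Rightarrow> bool"
  let ?h = "\<lambda>l j. x (j, l)"
  have inj: "inj ?f" by (auto simp: inj_def fun_eq_iff)
  have "?f ?h = x" by (simp add: fun_eq_iff)
  then have "pmf (map_pmf ?f ?R) x = pmf ?R ?h" using pmf_map_inj'[OF inj, of ?R ?h] by simp
  also have "\<dots> = pmf ?L x"
  proof (cases "\<forall>z. z \<notin> {1..k} \<times> {1..L} \<longrightarrow> x z = False")
    case True
    then have "pmf ?R ?h = (\<Prod>l\<in>{1..L}. \<Prod>j\<in>{1..k}. pmf (bernoulli_pmf (w l)) (x (j, l)))"
      by (subst pmf_Pi') (auto intro!: prod.cong pmf_Pi')
    also have "\<dots> = (\<Prod>(j, l)\<in>{1..k} \<times> {1..L}. pmf (bernoulli_pmf (w l)) (x (j, l)))"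
      by (subst prod.swap) (simp add: prod.cartesian_product)
    also have "\<dots> = pmf ?L x" using True by (subst pmf_Pi'[OF _ True[rule_format]]) (auto intro!: prod.cong)
    finally show ?thesis .
  next
    case False
    then obtain j l where jl: "(j, l) \<notin> {1..k} \<times> {1..L}" "x (j, l)" by auto
    have "pmf ?R ?h = 0"
    proof (cases "l \<in> {1..L}")
      case True
      then have "j \<notin> {1..k}" using jl by auto
      then have "pmf (Pi_pmf {1..k} False (\<lambda>_. bernoulli_pmf (w l))) (\<lambda>j. x (j, l)) = 0"
        using jl by (intro pmf_Pi_outside) auto
      then show ?thesis using True by (subst pmf_Pi) (auto intro!: prod_zero)
    next
      case False
      then show ?thesis using jl by (intro pmf_Pi_outside) (auto simp: fun_eq_iff)
    qed
    moreover have "pmf ?L x = 0" using jl by (intro pmf_Pi_outside) auto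
    ultimately show ?thesis by simp
  qed
  finally show "pmf ?L x = pmf (map_pmf ?f ?R) x" ..
qed

text \<open>Channel l reads only the symbols \<open>x (j, l)\<close> with
  \<open>j \<in> S l\<close>: these are \<open>c l\<close> independent bits of bias
  \<open>w l\<close>, and different channels read different coordinates. The law therefore depends
  on the partition only through its sizes.\<close>

lemma channel_ones_law:
  assumes S: "S \<in> ordered_partitions L k c" and w: "\<And>l. l \<in> {1..L} \<Longrightarrow> 0 < w l \<and> w l < 1"
  shows "map_pmf (\<lambda>x. restrict (channel_ones x S) {1..L})
      (Pi_pmf ({1..k} \<times> {1..L}) False (\<lambda>(j, l). bernoulli_pmf (w l)))
    = Pi_pmf {1..L} undefined (\<lambda>l. binomial_pmf (c l) (w l))"
proof -
  let ?X = "\<lambda>l. Pi_pmf {1..k} False (\<lambda>_. bernoulli_pmf (w l))"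
  have Sl: "S l \<subseteq> {1..k}" "card (S l) = c l" if "l \<in> {1..L}" for l
    using S that by (auto simp: ordered_partitions_def PiE_iff)
  have fS: "finite (S l)" if "l \<in> {1..L}" for l using Sl[OF that] finite_subset by blast
  have 1: "binomial_pmf (c l) (w l) = ?X l \<bind> (\<lambda>g. return_pmf (card {j \<in> S l. g j}))" if l: "l \<in> {1..L}" for l
  proof -
    have "binomial_pmf (c l) (w l) = map_pmf (\<lambda>f. card {x \<in> S l. f x}) (Pi_pmf (S l) False (\<lambda>_. bernoulli_pmf (w l)))"
      using Sl[OF l] fS[OF l] w[OF l] by (intro binomial_pmf_altdef') auto
    also have "\<dots> = map_pmf (\<lambda>f. card {x \<in> S l. f x}) (?X l)"
      using Sl[OF l] by (subst Pi_pmf_subset[of "{1..k}" "S l"])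
        (auto simp: pmf.map_comp o_def intro!: map_pmf_cong arg_cong[where f = card])
    finally show ?thesis by (simp add: map_pmf_def)
  qed
  have "Pi_pmf {1..L} undefined (\<lambda>l. binomial_pmf (c l) (w l))
    = Pi_pmf {1..L} undefined (\<lambda>l. ?X l \<bind> (\<lambda>g. return_pmf (card {j \<in> S l. g j})))"
    by (rule Pi_pmf_cong) (auto simp: 1)
  also have "\<dots> = map_pmf (\<lambda>h l. if l \<in> {1..L} then card {j \<in> S l. h l j} else undefined) (Pi_pmf {1..L} (\<lambda>_. False) ?X)"
    by (subst Pi_pmf_bind[where d' = "\<lambda>_. False"]) (simp_all add: map_pmf_def)
  also have "\<dots> = map_pmf (\<lambda>x. restrict (channel_ones x S) {1..L})
      (Pi_pmf ({1..k} \<times> {1..L}) False (\<lambda>(j, l). bernoulli_pmf (w l)))"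
    unfolding symbols_as_nested_product pmf.map_comp
    using fS by (intro map_pmf_cong refl)
      (auto simp: channel_ones_def fun_eq_iff sum_of_bool_eq Int_def)
  finally show ?thesis ..
qed

lemma map_restrict_Pi_pmf:
  "finite A \<Longrightarrow> map_pmf (\<lambda>y. restrict y A) (Pi_pmf A d q) = Pi_pmf A undefined q"
  unfolding restrict_def by (rule Pi_pmf_default_swap)

text \<open>The default \<open>undefined\<close> makes the tuples extensional, in agreement with the
  \<open>restrict\<close> in \<open>observed\<close>; the same convention is used in the next two
  laws.\<close>

definition ones_law :: "nat \<Rightarrow> (nat \<Rightarrow> real) \<Rightarrow> (nat \<Rightarrow> nat) \<Rightarrow> (nat \<Rightarrow> nat) pmf" where
  "ones_law L w c = Pi_pmf {1..L} undefined (\<lambda>l. binomial_pmf (c l) (w l))"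

definition output_law :: "nat \<Rightarrow> (nat \<Rightarrow> nat \<Rightarrow> real) \<Rightarrow> (nat \<Rightarrow> nat) \<times> (nat \<Rightarrow> nat) \<Rightarrow> (nat \<Rightarrow> bool) pmf" where
  "output_law L \<theta> = (\<lambda>(z, c). Pi_pmf {1..L} undefined (\<lambda>l. bernoulli_pmf (\<theta> (z l) (c l))))"

definition mean_law :: "nat \<Rightarrow> (nat \<Rightarrow> nat \<Rightarrow> real) \<Rightarrow> (nat \<Rightarrow> real) \<Rightarrow> (nat \<Rightarrow> nat) \<Rightarrow> (nat \<Rightarrow> bool) pmf" where
  "mean_law L \<theta> w c = Pi_pmf {1..L} undefined (\<lambda>l. bernoulli_pmf (mean_output (c l) (\<lambda>z. \<theta> z (c l)) (w l)))"

definition observed :: "nat \<Rightarrow> outcome \<Rightarrow> (nat \<Rightarrow> bool) \<times> (nat \<Rightarrow> nat) \<times> (nat \<Rightarrow> nat)" where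
  "observed L = (\<lambda>(x, c, S, y). (restrict y {1..L}, restrict (channel_ones x S) {1..L}, restrict c {1..L}))"

text \<open>Written as the graph of \<open>output_law\<close> over the law of counts and sizes, the
  form in which \<open>pmf_bind_graph\<close> factors the mass.\<close>

definition observed_law where
  "observed_law L \<theta> p w = (p \<bind> (\<lambda>c. map_pmf (\<lambda>z. (z, c)) (ones_law L w c)))
     \<bind> (\<lambda>v. map_pmf (\<lambda>y. (y, v)) (output_law L \<theta> v))"

text \<open>Once the symbols are drawn after allocation and partition, the law of the counts no
  longer depends on the partition, and the partition integrates out.\<close>

lemma observed_outcome:
  assumes p: "set_pmf p \<subseteq> allocations L k" and w: "\<And>l. l \<in> {1..L} \<Longrightarrow> 0 < w l \<and> w l < 1"
  shows "map_pmf (observed L) (outcome_pmf L k \<theta> p w) = observed_law L \<theta> p w"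
proof -
  let ?X = "Pi_pmf ({1..k} \<times> {1..L}) False (\<lambda>(j, l). bernoulli_pmf (w l))"
  let ?O = "\<lambda>x S. restrict (channel_ones x S) {1..L}"
  have "map_pmf (observed L) (outcome_pmf L k \<theta> p w) =
    ?X \<bind> (\<lambda>x. p \<bind> (\<lambda>c. pmf_of_set (ordered_partitions L k c) \<bind>
      (\<lambda>S. map_pmf (\<lambda>y. (restrict y {1..L}, ?O x S, restrict c {1..L}))
        (Pi_pmf {1..L} False (\<lambda>l. bernoulli_pmf (\<theta> (channel_ones x S l) (c l)))))))"
    unfolding outcome_pmf_def
    by (simp add: map_pmf_def bind_assoc_pmf bind_return_pmf observed_def)
  also have "\<dots> = ?X \<bind> (\<lambda>x. p \<bind> (\<lambda>c. pmf_of_set (ordered_partitions L k c) \<bind>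
      (\<lambda>S. map_pmf (\<lambda>y. (y, ?O x S, restrict c {1..L})) (output_law L \<theta> (?O x S, c)))))"
  proof (intro bind_pmf_cong refl)
    fix x c S
    have "map_pmf (\<lambda>y. (restrict y {1..L}, ?O x S, restrict c {1..L}))
        (Pi_pmf {1..L} False (\<lambda>l. bernoulli_pmf (\<theta> (channel_ones x S l) (c l))))
      = map_pmf (\<lambda>y. (y, ?O x S, restrict c {1..L}))
        (map_pmf (\<lambda>y. restrict y {1..L}) (Pi_pmf {1..L} False (\<lambda>l. bernoulli_pmf (\<theta> (channel_ones x S l) (c l)))))"
      by (simp add: pmf.map_comp o_def)
    also have "map_pmf (\<lambda>y. restrict y {1..L}) (Pi_pmf {1..L} False (\<lambda>l. bernoulli_pmf (\<theta> (channel_ones x S l) (c l))))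
      = output_law L \<theta> (?O x S, c)"
      unfolding output_law_def by (subst map_restrict_Pi_pmf) (auto intro!: Pi_pmf_cong)
    finally show "map_pmf (\<lambda>y. (restrict y {1..L}, ?O x S, restrict c {1..L}))
        (Pi_pmf {1..L} False (\<lambda>l. bernoulli_pmf (\<theta> (channel_ones x S l) (c l))))
      = map_pmf (\<lambda>y. (y, ?O x S, restrict c {1..L})) (output_law L \<theta> (?O x S, c))" .
  qed
  \<comment> \<open>The symbols are independent of allocation and partition, so the draws may be
    exchanged.\<close>
  also have "\<dots> = p \<bind> (\<lambda>c. pmf_of_set (ordered_partitions L k c) \<bind> (\<lambda>S. ?X \<bind>
      (\<lambda>x. map_pmf (\<lambda>y. (y, ?O x S, restrict c {1..L})) (output_law L \<theta> (?O x S, c)))))"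
    by (subst bind_commute_pmf, intro bind_pmf_cong refl) (rule bind_commute_pmf)
  also have "\<dots> = p \<bind> (\<lambda>c. pmf_of_set (ordered_partitions L k c) \<bind> (\<lambda>S. ones_law L w c \<bind>
      (\<lambda>z. map_pmf (\<lambda>y. (y, z, c)) (output_law L \<theta> (z, c)))))"
  proof (intro bind_pmf_cong refl)
    fix c S assume c: "c \<in> set_pmf p" and S: "S \<in> set_pmf (pmf_of_set (ordered_partitions L k c))"
    then have ca: "c \<in> allocations L k" using p by auto
    then have "S \<in> ordered_partitions L k c"
      using S set_pmf_of_set[OF ordered_partitions_nonempty[OF ca] finite_ordered_partitions] by simp
    from channel_ones_law[OF this w]
    have "ones_law L w c = map_pmf (\<lambda>x. ?O x S) ?X" by (simp add: ones_law_def)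
    moreover have "restrict c {1..L} = c" using ca
      by (auto simp: allocations_def PiE_iff extensional_restrict)
    ultimately show "?X \<bind> (\<lambda>x. map_pmf (\<lambda>y. (y, ?O x S, restrict c {1..L})) (output_law L \<theta> (?O x S, c)))
      = ones_law L w c \<bind> (\<lambda>z. map_pmf (\<lambda>y. (y, z, c)) (output_law L \<theta> (z, c)))"
      by (simp add: bind_map_pmf)
  qed
  also have "\<dots> = observed_law L \<theta> p w"
    by (simp add: observed_law_def bind_assoc_pmf bind_map_pmf)
  finally show ?thesis .
qed

lemma finite_set_ones_law:
  "(\<And>l. l \<in> {1..L} \<Longrightarrow> 0 < w l \<and> w l < 1) \<Longrightarrow> finite (set_pmf (ones_law L w c))"
  unfolding ones_law_def by (subst set_Pi_pmf) (auto intro!: finite_PiE_dflt)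

lemma finite_set_output_law [simp]: "finite (set_pmf (output_law L \<theta> v))"
  unfolding output_law_def split_beta'
  by (subst set_Pi_pmf) (auto intro!: finite_PiE_dflt)

lemma expectation_output_component:
  fixes h :: "bool \<Rightarrow> real"
  assumes "l \<in> {1..L}" "0 \<le> \<theta> (z l) (c l)" "\<theta> (z l) (c l) \<le> 1"
  shows "measure_pmf.expectation (output_law L \<theta> (z, c)) (\<lambda>y. h (y l))
    = h True * \<theta> (z l) (c l) + h False * (1 - \<theta> (z l) (c l))"
proof -
  have "measure_pmf.expectation (output_law L \<theta> (z, c)) (\<lambda>y. h (y l))
    = measure_pmf.expectation (map_pmf (\<lambda>y. y l) (output_law L \<theta> (z, c))) h" by simp
  also have "map_pmf (\<lambda>y. y l) (output_law L \<theta> (z, c)) = bernoulli_pmf (\<theta> (z l) (c l))"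
    using assms by (simp add: output_law_def Pi_pmf_component)
  finally show ?thesis using assms by simp
qed

lemma expectation_ones_component:
  fixes h :: "nat \<Rightarrow> real"
  assumes "l \<in> {1..L}" "0 < w l \<and> w l < 1"
  shows "measure_pmf.expectation (ones_law L w c) (\<lambda>z. h (z l)) = (\<Sum>z\<le>c l. Bernstein (c l) z (w l) * h z)"
proof -
  have "measure_pmf.expectation (ones_law L w c) (\<lambda>z. h (z l))
    = measure_pmf.expectation (map_pmf (\<lambda>y. y l) (ones_law L w c)) h" by simp
  also have "map_pmf (\<lambda>y. y l) (ones_law L w c) = binomial_pmf (c l) (w l)"
    using assms by (simp add: ones_law_def Pi_pmf_component)
  finally show ?thesis using assms by (simp add: expectation_binomial_Bernstein)
qed

section \<open>Chain rule for the information at a fixed bias vector\<close>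

locale attack_at =
  fixes L k :: nat and \<theta> :: "nat \<Rightarrow> nat \<Rightarrow> real" and p :: "(nat \<Rightarrow> nat) pmf" and w :: "nat \<Rightarrow> real"
  assumes p: "set_pmf p \<subseteq> allocations L k" and w: "\<And>l. l \<in> {1..L} \<Longrightarrow> 0 < w l \<and> w l < 1"
    and \<theta>: "marking_attack L k \<theta>"
begin

abbreviation "mean_at c l \<equiv> mean_output (c l) (\<lambda>z. \<theta> z (c l)) (w l)"

lemma c_ge: "c \<in> set_pmf p \<Longrightarrow> l \<in> {1..L} \<Longrightarrow> 1 \<le> c l"
  using allocations_bounds p by fastforce

lemma \<theta>_bounds:
  assumes "c \<in> set_pmf p" "l \<in> {1..L}"
  shows "z \<le> c l \<Longrightarrow> 0 \<le> \<theta> z (c l) \<and> \<theta> z (c l) \<le> 1" "\<theta> 0 (c l) = 0" "\<theta> (c l) (c l) = 1"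
proof -
  have "c l \<in> {1..k - L + 1}" using allocations_bounds assms p by blast
  then show "z \<le> c l \<Longrightarrow> 0 \<le> \<theta> z (c l) \<and> \<theta> z (c l) \<le> 1" "\<theta> 0 (c l) = 0" "\<theta> (c l) (c l) = 1"
    using \<theta> unfolding marking_attack_def by blast+
qed

lemma mean_at_bounds:
  assumes "c \<in> set_pmf p" "l \<in> {1..L}" shows "0 < mean_at c l" "mean_at c l < 1"
  using mean_output_bounds[of "w l" "c l" "\<lambda>z. \<theta> z (c l)"] w[OF assms(2)] c_ge[OF assms] \<theta>_bounds[OF assms]
  by auto

lemma fin_p: "finite (set_pmf p)" using p finite_allocations finite_subset by blast
lemma fin_ones [simp]: "finite (set_pmf (ones_law L w c))"
  by (rule finite_set_ones_law) (rule w)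

lemma ones_le: "z \<in> set_pmf (ones_law L w c) \<Longrightarrow> l \<in> {1..L} \<Longrightarrow> z l \<le> c l"
  unfolding ones_law_def using w[of l] set_Pi_pmf_subset'[of "{1..L}" undefined "\<lambda>l. binomial_pmf (c l) (w l)"]
  by (fastforce simp: PiE_dflt_def)

text \<open>A product of mixtures is a mixture of products when the indices are drawn independently:
  given the allocation, the outputs stay independent after averaging over the counts.\<close>

lemma mean_law_bind: "c \<in> set_pmf p \<Longrightarrow> ones_law L w c \<bind> (\<lambda>z. output_law L \<theta> (z, c)) = mean_law L \<theta> w c"
proof -
  assume c: "c \<in> set_pmf p"
  have "mean_law L \<theta> w c = Pi_pmf {1..L} undefined (\<lambda>l. binomial_pmf (c l) (w l) \<bind> (\<lambda>z. bernoulli_pmf (\<theta> z (c l))))"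
    unfolding mean_law_def
  proof (intro Pi_pmf_cong refl)
    fix l assume l: "l \<in> {1..L}"
    show "bernoulli_pmf (mean_at c l) = binomial_pmf (c l) (w l) \<bind> (\<lambda>z. bernoulli_pmf (\<theta> z (c l)))"
      using w[OF l] mean_at_bounds[OF c l] \<theta>_bounds(1)[OF c l] by (intro binomial_bind_bernoulli[symmetric]) auto
  qed
  also have "\<dots> = ones_law L w c \<bind> (\<lambda>z. output_law L \<theta> (z, c))"
    by (subst Pi_pmf_bind[where d' = undefined]) (auto simp: ones_law_def output_law_def)
  finally show ?thesis ..
qed

lemma mean_law_pos:
  assumes "c \<in> set_pmf p" "y \<in> extensional {1..L}"
  shows "pmf (mean_law L \<theta> w c) y = (\<Prod>l\<in>{1..L}. pmf (bernoulli_pmf (mean_at c l)) (y l))" "0 < pmf (mean_law L \<theta> w c) y"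
proof -
  show eq: "pmf (mean_law L \<theta> w c) y = (\<Prod>l\<in>{1..L}. pmf (bernoulli_pmf (mean_at c l)) (y l))"
    unfolding mean_law_def using assms(2) by (subst pmf_Pi') (auto simp: extensional_def)
  have "0 < pmf (bernoulli_pmf (mean_at c l)) b" if "l \<in> {1..L}" for l b
    using mean_at_bounds[OF assms(1) that] by (cases b) auto
  then show "0 < pmf (mean_law L \<theta> w c) y" unfolding eq by (intro prod_pos) auto
qed

definition "P = p \<bind> mean_law L \<theta> w"

lemma fst_observed: "map_pmf fst (observed_law L \<theta> p w) = P"
proof -
  have "map_pmf fst (observed_law L \<theta> p w) = p \<bind> (\<lambda>c. ones_law L w c \<bind> (\<lambda>z. output_law L \<theta> (z, c)))"
    by (simp add: observed_law_def bind_assoc_pmf bind_map_pmf map_bind_pmf pmf.map_comp o_def)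
  also have "\<dots> = P" unfolding P_def by (intro bind_pmf_cong refl mean_law_bind)
  finally show ?thesis .
qed

lemma snd_observed: "map_pmf snd (observed_law L \<theta> p w) = p \<bind> (\<lambda>c. map_pmf (\<lambda>z. (z, c)) (ones_law L w c))"
  by (simp add: observed_law_def bind_assoc_pmf bind_map_pmf map_bind_pmf pmf.map_comp o_def map_pmf_const)
    (simp add: map_pmf_def)

lemma expectation_observed:
  fixes h :: "_ \<Rightarrow> real"
  shows "measure_pmf.expectation (observed_law L \<theta> p w) h
    = measure_pmf.expectation p (\<lambda>c. measure_pmf.expectation (ones_law L w c)
        (\<lambda>z. measure_pmf.expectation (output_law L \<theta> (z, c)) (\<lambda>y. h (y, z, c))))"
proof -
  have "observed_law L \<theta> p w = p \<bind> (\<lambda>c. ones_law L w c \<bind> (\<lambda>z. map_pmf (\<lambda>y. (y, z, c)) (output_law L \<theta> (z, c))))"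
    by (simp add: observed_law_def bind_assoc_pmf bind_map_pmf)
  then show ?thesis
    by (simp add: expectation_bind_finite fin_p fin_ones)
qed

lemma P_pos: "y \<in> extensional {1..L} \<Longrightarrow> 0 < pmf P y"
proof -
  assume y: "y \<in> extensional {1..L}"
  obtain c where c: "c \<in> set_pmf p" using set_pmf_not_empty by fast
  then have "y \<in> set_pmf (mean_law L \<theta> w c)" using mean_law_pos(2)[OF c y] by (simp add: set_pmf_iff)
  then have "y \<in> set_pmf P" using c by (auto simp: P_def)
  then show ?thesis by (simp add: pmf_positive_iff)
qed

lemma fin_mean: "finite (set_pmf (mean_law L \<theta> w c))"
  unfolding mean_law_def by (subst set_Pi_pmf) (auto intro!: finite_PiE_dflt)

lemma output_ext: "y \<in> set_pmf (output_law L \<theta> v) \<Longrightarrow> y \<in> extensional {1..L}"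
  unfolding output_law_def split_beta' using set_Pi_pmf_subset[of "{1..L}"] by (fastforce simp: extensional_def)
lemma mean_ext: "y \<in> set_pmf (mean_law L \<theta> w c) \<Longrightarrow> y \<in> extensional {1..L}"
  unfolding mean_law_def using set_Pi_pmf_subset[of "{1..L}"] by (fastforce simp: extensional_def)

text \<open>The mutual information, in nats, between the outputs and the allocation at fixed
  \<open>w\<close>: what the outputs reveal about random channel sizes.\<close>

definition "allocation_gain = measure_pmf.expectation p (\<lambda>c. measure_pmf.expectation (mean_law L \<theta> w c)
   (\<lambda>y. ln (pmf (mean_law L \<theta> w c) y / pmf P y)))"

text \<open>Gibbs' inequality for each allocation separately: ln x \<le> x - 1 is averaged under
  \<open>mean_law\<close>, and the masses of \<open>P\<close> on its support add up to at most
  1.\<close>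

lemma allocation_gain_nonneg: "0 \<le> allocation_gain"
  unfolding allocation_gain_def
proof (rule integral_nonneg_AE, rule AE_pmfI)
  fix c assume c: "c \<in> set_pmf p"
  let ?M = "mean_law L \<theta> w c"
  have "(\<Sum>y\<in>set_pmf ?M. pmf P y) = measure_pmf.prob P (set_pmf ?M)"
    using fin_mean by (simp add: measure_measure_pmf_finite)
  also have "\<dots> \<le> 1" by simp
  finally have le: "(\<Sum>y\<in>set_pmf ?M. pmf P y) \<le> 1" .
  have "0 \<le> (\<Sum>y\<in>set_pmf ?M. pmf ?M y) - (\<Sum>y\<in>set_pmf ?M. pmf P y)"
    using le fin_mean by (simp add: sum_pmf_eq_1)
  also have "\<dots> = (\<Sum>y\<in>set_pmf ?M. pmf ?M y - pmf P y)" by (simp add: sum_subtractf)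
  also have "\<dots> \<le> (\<Sum>y\<in>set_pmf ?M. ln (pmf ?M y / pmf P y) * pmf ?M y)"
  proof (rule sum_mono)
    fix y assume y: "y \<in> set_pmf ?M"
    then have pos: "0 < pmf ?M y" "0 < pmf P y" using P_pos[OF mean_ext[OF y]] by (auto simp: pmf_positive_iff)
    have "ln (pmf P y / pmf ?M y) \<le> pmf P y / pmf ?M y - 1" using pos by (intro ln_le_minus_one) auto
    then have "1 - pmf P y / pmf ?M y \<le> ln (pmf ?M y / pmf P y)"
      using pos by (simp add: ln_div)
    then have "(1 - pmf P y / pmf ?M y) * pmf ?M y \<le> ln (pmf ?M y / pmf P y) * pmf ?M y"
      using pos by (intro mult_right_mono) auto
    then show "pmf ?M y - pmf P y \<le> ln (pmf ?M y / pmf P y) * pmf ?M y"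
      using pos by (simp add: left_diff_distrib)
  qed
  also have "\<dots> = measure_pmf.expectation ?M (\<lambda>y. ln (pmf ?M y / pmf P y))"
    using fin_mean by (intro integral_measure_pmf_real[symmetric]) auto
  finally show "0 \<le> measure_pmf.expectation ?M (\<lambda>y. ln (pmf ?M y / pmf P y))" .
qed

lemma allocation_gain_return: "p = return_pmf c0 \<Longrightarrow> allocation_gain = 0"
proof -
  assume pc: "p = return_pmf c0"
  have "measure_pmf.expectation (mean_law L \<theta> w c0) (\<lambda>y. ln (pmf (mean_law L \<theta> w c0) y / pmf P y))
    = measure_pmf.expectation (mean_law L \<theta> w c0) (\<lambda>y. 0)"
  proof (intro integral_cong_AE AE_pmfI)
    have "P = mean_law L \<theta> w c0" unfolding P_def by (subst pc) (simp add: bind_return_pmf)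
    then show "ln (pmf (mean_law L \<theta> w c0) y / pmf P y) = 0" if "y \<in> set_pmf (mean_law L \<theta> w c0)" for y
      using that by (simp add: set_pmf_iff)
  qed auto
  then show ?thesis unfolding allocation_gain_def by (subst pc) simp
qed

text \<open>Chain rule: the information about counts and sizes splits into the part given the sizes
  and the part about the sizes alone. Given the sizes the channels are independent, so the first
  part is a sum over channels.\<close>

theorem observed_information:
  defines "A \<equiv> observed_law L \<theta> p w"
  shows "measure_pmf.expectation A (\<lambda>(y, v). ln (pmf A (y, v) / (pmf (map_pmf fst A) y * pmf (map_pmf snd A) v)))
    = measure_pmf.expectation p (\<lambda>c. \<Sum>l\<in>{1..L}. channel_info (c l) (\<lambda>z. \<theta> z (c l)) (w l)) + allocation_gain"
proof -
  let ?M = "\<lambda>c. mean_law L \<theta> w c" and ?Q = "\<lambda>z c. output_law L \<theta> (z, c)"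
  let ?g = "\<lambda>c l z b. ln (pmf (bernoulli_pmf (\<theta> z (c l))) b / pmf (bernoulli_pmf (mean_at c l)) b)"
  let ?h = "\<lambda>(y, v). ln (pmf A (y, v) / (pmf (map_pmf fst A) y * pmf (map_pmf snd A) v))"
  have pt: "?h (y, z, c) = (\<Sum>l\<in>{1..L}. ?g c l (z l) (y l)) + ln (pmf (?M c) y / pmf P y)"
    if c: "c \<in> set_pmf p" and z: "z \<in> set_pmf (ones_law L w c)" and y: "y \<in> set_pmf (?Q z c)" for y z c
  proof -
    let ?V = "p \<bind> (\<lambda>c. map_pmf (\<lambda>z. (z, c)) (ones_law L w c))"
    have e: "y \<in> extensional {1..L}" using output_ext[OF y] .
    have "(z, c) \<in> set_pmf ?V" using c z by auto
    then have V: "0 < pmf ?V (z, c)" by (simp add: pmf_positive_iff)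
    have "pmf A (y, z, c) = pmf ?V (z, c) * pmf (?Q z c) y"
      unfolding A_def observed_law_def by (rule pmf_bind_graph)
    then have "?h (y, z, c) = ln (pmf (?Q z c) y / pmf P y)"
      using V by (simp add: A_def fst_observed snd_observed)
    \<comment> \<open>Inserting the output law given the allocation separates the two parts of the
      chain rule.\<close>
    also have "\<dots> = ln ((pmf (?Q z c) y / pmf (?M c) y) * (pmf (?M c) y / pmf P y))"
      using mean_law_pos(2)[OF c e] by simp
    also have "\<dots> = ln (pmf (?Q z c) y / pmf (?M c) y) + ln (pmf (?M c) y / pmf P y)"
      using mean_law_pos[OF c e] P_pos[OF e] y by (intro ln_mult_pos) (auto simp: pmf_positive_iff)
    also have "pmf (?Q z c) y = (\<Prod>l\<in>{1..L}. pmf (bernoulli_pmf (\<theta> (z l) (c l))) (y l))"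
      unfolding output_law_def prod.case using e by (subst pmf_Pi') (auto simp: extensional_def)
    also have "ln ((\<Prod>l\<in>{1..L}. pmf (bernoulli_pmf (\<theta> (z l) (c l))) (y l)) / pmf (?M c) y)
      = ln (\<Prod>l\<in>{1..L}. pmf (bernoulli_pmf (\<theta> (z l) (c l))) (y l) / pmf (bernoulli_pmf (mean_at c l)) (y l))"
      unfolding mean_law_pos(1)[OF c e] by (simp add: prod_dividef)
    also have "\<dots> = (\<Sum>l\<in>{1..L}. ?g c l (z l) (y l))"
    proof (rule ln_prod)
      fix l assume l: "l \<in> {1..L}"
      have "y l \<in> set_pmf (bernoulli_pmf (\<theta> (z l) (c l)))"
        using y l set_Pi_pmf_subset'[of "{1..L}" undefined "\<lambda>l. bernoulli_pmf (\<theta> (z l) (c l))"]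
        by (fastforce simp: output_law_def PiE_dflt_def)
      moreover have "0 < pmf (bernoulli_pmf (mean_at c l)) (y l)"
        using mean_at_bounds[OF c l] by (cases "y l") auto
      ultimately show "pmf (bernoulli_pmf (\<theta> (z l) (c l))) (y l) / pmf (bernoulli_pmf (mean_at c l)) (y l) \<noteq> 0"
        by (simp add: set_pmf_iff)
    qed simp
    finally show ?thesis .
  qed
  \<comment> \<open>Each summand reads a single channel, so its expectation involves only one
    binomial and one Bernoulli component.\<close>
  have Eg: "measure_pmf.expectation (ones_law L w c) (\<lambda>z. measure_pmf.expectation (?Q z c) (\<lambda>y. ?g c l (z l) (y l)))
     = channel_info (c l) (\<lambda>z. \<theta> z (c l)) (w l)" if c: "c \<in> set_pmf p" and l: "l \<in> {1..L}" for c l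
  proof -
    have "measure_pmf.expectation (ones_law L w c) (\<lambda>z. measure_pmf.expectation (?Q z c) (\<lambda>y. ?g c l (z l) (y l)))
      = measure_pmf.expectation (ones_law L w c) (\<lambda>z. bin_kl (\<theta> (z l) (c l)) (mean_at c l))"
    proof (intro integral_cong_AE AE_pmfI)
      fix z assume "z \<in> set_pmf (ones_law L w c)"
      then have b: "0 \<le> \<theta> (z l) (c l)" "\<theta> (z l) (c l) \<le> 1"
        using \<theta>_bounds(1)[OF c l] ones_le[OF _ l] by auto
      show "measure_pmf.expectation (?Q z c) (\<lambda>y. ?g c l (z l) (y l)) = bin_kl (\<theta> (z l) (c l)) (mean_at c l)"
        using expectation_output_component[where l = l and L = L and \<theta> = \<theta> and z = z and c = c and
            h = "\<lambda>b. ?g c l (z l) b", OF l b] b mean_at_bounds[OF c l]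
        by (simp add: bin_kl_def mult.commute)
    qed auto
    also have "\<dots> = channel_info (c l) (\<lambda>z. \<theta> z (c l)) (w l)"
      using expectation_ones_component[where w = w and L = L and l = l and c = c and
          h = "\<lambda>z. bin_kl (\<theta> z (c l)) (mean_at c l)", OF l w[OF l]] by (simp add: channel_info_def)
    finally show ?thesis .
  qed
  have "measure_pmf.expectation A ?h
     = measure_pmf.expectation p (\<lambda>c. measure_pmf.expectation (ones_law L w c)
        (\<lambda>z. measure_pmf.expectation (?Q z c) (\<lambda>y. ?h (y, z, c))))"
    unfolding A_def by (rule expectation_observed)
  also have "\<dots> = measure_pmf.expectation p (\<lambda>c. measure_pmf.expectation (ones_law L w c)
        (\<lambda>z. measure_pmf.expectation (?Q z c) (\<lambda>y. (\<Sum>l\<in>{1..L}. ?g c l (z l) (y l)) + ln (pmf (?M c) y / pmf P y))))"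
    by (intro integral_cong_AE AE_pmfI pt) auto
  also have "\<dots> = measure_pmf.expectation p (\<lambda>c.
       (\<Sum>l\<in>{1..L}. measure_pmf.expectation (ones_law L w c) (\<lambda>z. measure_pmf.expectation (?Q z c) (\<lambda>y. ?g c l (z l) (y l))))
       + measure_pmf.expectation (ones_law L w c) (\<lambda>z. measure_pmf.expectation (?Q z c) (\<lambda>y. ln (pmf (?M c) y / pmf P y))))"
    by (simp add: integrable_measure_pmf_finite fin_ones)
  also have "\<dots> = measure_pmf.expectation p (\<lambda>c.
       (\<Sum>l\<in>{1..L}. channel_info (c l) (\<lambda>z. \<theta> z (c l)) (w l))
       + measure_pmf.expectation (?M c) (\<lambda>y. ln (pmf (?M c) y / pmf P y)))"
  proof (intro integral_cong_AE AE_pmfI)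
    fix c assume c: "c \<in> set_pmf p"
    have "measure_pmf.expectation (ones_law L w c) (\<lambda>z. measure_pmf.expectation (?Q z c) (\<lambda>y. ln (pmf (?M c) y / pmf P y)))
      = measure_pmf.expectation (?M c) (\<lambda>y. ln (pmf (?M c) y / pmf P y))"
      by (simp add: mean_law_bind[OF c, symmetric] expectation_bind_finite fin_ones)
    then show "(\<Sum>l\<in>{1..L}. measure_pmf.expectation (ones_law L w c) (\<lambda>z. measure_pmf.expectation (?Q z c) (\<lambda>y. ?g c l (z l) (y l))))
       + measure_pmf.expectation (ones_law L w c) (\<lambda>z. measure_pmf.expectation (?Q z c) (\<lambda>y. ln (pmf (?M c) y / pmf P y)))
      = (\<Sum>l\<in>{1..L}. channel_info (c l) (\<lambda>z. \<theta> z (c l)) (w l))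
       + measure_pmf.expectation (?M c) (\<lambda>y. ln (pmf (?M c) y / pmf P y))"
      using Eg[OF c] by simp
  qed auto
  also have "\<dots> = measure_pmf.expectation p (\<lambda>c. \<Sum>l\<in>{1..L}. channel_info (c l) (\<lambda>z. \<theta> z (c l)) (w l)) + allocation_gain"
    unfolding allocation_gain_def by (simp add: integrable_measure_pmf_finite fin_p)
  finally show ?thesis .
qed

end

section \<open>Binary divergence and binomial moments\<close>

lemma exp_upper_taylor:
  fixes x :: real shows "exp x \<le> 1 + x + x\<^sup>2 / 2 + \<bar>x\<bar> ^ 3 * exp \<bar>x\<bar> / 6"
proof -
  obtain t where t: "\<bar>t\<bar> \<le> \<bar>x\<bar>" "exp x = (\<Sum>m<3. x ^ m / fact m) + exp t / fact 3 * x ^ 3"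
    using Maclaurin_exp_le[of x 3] by auto
  have "exp t * x ^ 3 \<le> exp \<bar>x\<bar> * \<bar>x\<bar> ^ 3"
  proof -
    have "exp t * x ^ 3 \<le> exp t * \<bar>x\<bar> ^ 3" by (intro mult_left_mono) (auto simp flip: power_abs)
    also have "\<dots> \<le> exp \<bar>x\<bar> * \<bar>x\<bar> ^ 3" using t(1) by (intro mult_right_mono) auto
    finally show ?thesis .
  qed
  then show ?thesis using t(2) by (simp add: eval_nat_numeral field_simps)
qed

lemma exp_upper_quadratic:
  fixes x :: real assumes "\<bar>x\<bar> \<le> 1" shows "exp x \<le> 1 + x + x\<^sup>2"
proof -
  have "exp \<bar>x\<bar> \<le> 3" using assms exp_le order_trans[of "exp \<bar>x\<bar>" "exp 1" 3] by simp
  then have "\<bar>x\<bar> ^ 3 * exp \<bar>x\<bar> \<le> \<bar>x\<bar> ^ 2 * 1 * 3"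
    using assms unfolding power3_eq_cube power2_eq_square by (intro mult_mono) auto
  then show ?thesis using exp_upper_taylor[of x] by simp
qed

text \<open>Young's inequality \<open>v * s + v - q * exp s \<le> v * ln (v / q)\<close> is applied
  to each of the two outcomes, with exponents \<open>t * (1 - p)\<close> and \<open>- t * p\<close>.
  These are centred under \<open>p\<close>, so the linear part is exactly
  \<open>t * (u - p)\<close>, and \<open>t\<close> stays free for later optimisation.\<close>

lemma bin_kl_dual:
  assumes u: "0 \<le> u" "u \<le> 1" and p: "0 < p" "p < 1"
  shows "t * (u - p) + 1 - p * exp (t * (1 - p)) - (1 - p) * exp (- t * p) \<le> bin_kl u p"
proof -
  have gen: "v * s + v - q * exp s \<le> v * ln (v / q)" if "0 \<le> v" "0 < q" for v q s :: real
  proof (cases "v = 0")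
    case False
    then have v: "0 < v" using that by simp
    have "ln (q * exp s / v) \<le> q * exp s / v - 1" using v that by (intro ln_le_minus_one) auto
    then have "v * ln (q * exp s / v) \<le> v * (q * exp s / v - 1)" using v by (intro mult_left_mono) auto
    also have "\<dots> = q * exp s - v" using v by (simp add: field_simps)
    also have "ln (q * exp s / v) = s - ln (v / q)"
      using v that by (simp add: ln_div ln_mult)
    finally show ?thesis by (simp add: algebra_simps)
  qed (use that in auto)
  have "u * (t * (1 - p)) + u - p * exp (t * (1 - p)) \<le> u * ln (u / p)"
    by (rule gen) (use u p in auto)
  moreover have "(1 - u) * (- t * p) + (1 - u) - (1 - p) * exp (- t * p) \<le> (1 - u) * ln ((1 - u) / (1 - p))"
    by (rule gen) (use u p in auto)
  ultimately show ?thesis unfolding bin_kl_def by (simp add: algebra_simps)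
qed

lemma bin_kl_nonneg: "0 \<le> u \<Longrightarrow> u \<le> 1 \<Longrightarrow> 0 < p \<Longrightarrow> p < 1 \<Longrightarrow> 0 \<le> bin_kl u p"
  using bin_kl_dual[of u p 0] by simp

text \<open>The dual bound at \<open>t = u - p\<close>. It is Pinsker's inequality with 1/2 in place
  of 2, which is enough for the weak estimate.\<close>

lemma bin_kl_ge_square:
  assumes u: "0 \<le> u" "u \<le> 1" and p: "0 < p" "p < 1"
  shows "(u - p)\<^sup>2 / 2 \<le> bin_kl u p"
proof -
  define t where "t = u - p"
  have t: "\<bar>t\<bar> \<le> 1" using u p by (auto simp: t_def)
  have "exp (t * (1 - p)) \<le> 1 + t * (1 - p) + (t * (1 - p))\<^sup>2"
    using t p by (intro exp_upper_quadratic) (auto simp: abs_mult intro!: mult_le_one)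
  moreover have "exp (- t * p) \<le> 1 + (- t * p) + (- t * p)\<^sup>2"
    using t p by (intro exp_upper_quadratic) (auto simp: abs_mult intro!: mult_le_one)
  ultimately have "p * exp (t * (1 - p)) + (1 - p) * exp (- t * p)
     \<le> p * (1 + t * (1 - p) + (t * (1 - p))\<^sup>2) + (1 - p) * (1 + (- t * p) + (- t * p)\<^sup>2)"
    using p by (intro add_mono mult_left_mono) auto
  also have "\<dots> = 1 + t\<^sup>2 * (p * (1 - p))" by (simp add: power2_eq_square algebra_simps)
  also have "\<dots> \<le> 1 + t\<^sup>2 * (1 / 2)"
  proof -
    have "p * (1 - p) \<le> 1/2"
      using zero_le_power2[of "p - 1/2"] by (simp add: power2_eq_square algebra_simps)
    then show ?thesis by (intro add_left_mono mult_left_mono) auto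
  qed
  finally show ?thesis using bin_kl_dual[OF u p, of t] by (simp add: t_def power2_eq_square)
qed

text \<open>The coefficient \<open>p * (1 - p)\<close> is the output variance, the second-order term
  of the centred exponential moment. The error is uniform in \<open>u\<close> and
  \<open>p\<close>.\<close>

lemma bin_kl_ge_taylor:
  assumes u: "0 \<le> u" "u \<le> 1" and p: "0 < p" "p < 1" and T: "\<bar>t\<bar> \<le> T"
  shows "t * (u - p) - p * (1 - p) * t\<^sup>2 / 2 - \<bar>t\<bar> ^ 3 * exp T \<le> bin_kl u p"
proof -
  have ex: "exp (t * c) \<le> 1 + t * c + (t * c)\<^sup>2 / 2 + \<bar>t\<bar> ^ 3 * exp T" if "\<bar>c\<bar> \<le> 1" for c
  proof -
    have tc: "\<bar>t * c\<bar> \<le> \<bar>t\<bar>" using that by (simp add: abs_mult mult_left_le)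
    have "\<bar>t * c\<bar> ^ 3 * exp \<bar>t * c\<bar> \<le> \<bar>t\<bar> ^ 3 * exp T"
      using tc T by (intro mult_mono power_mono) auto
    moreover have "0 \<le> \<bar>t * c\<bar> ^ 3 * exp \<bar>t * c\<bar>" by simp
    ultimately show ?thesis using exp_upper_taylor[of "t * c"] by linarith
  qed
  have "p * exp (t * (1 - p)) + (1 - p) * exp (t * (- p))
     \<le> p * (1 + t * (1 - p) + (t * (1 - p))\<^sup>2 / 2 + \<bar>t\<bar> ^ 3 * exp T)
       + (1 - p) * (1 + t * (- p) + (t * (- p))\<^sup>2 / 2 + \<bar>t\<bar> ^ 3 * exp T)"
    using p ex[of "1 - p"] ex[of "- p"] by (intro add_mono mult_left_mono) auto
  also have "\<dots> = 1 + p * (1 - p) * t\<^sup>2 / 2 + \<bar>t\<bar> ^ 3 * exp T"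
    by (simp add: power2_eq_square field_simps)
  finally show ?thesis using bin_kl_dual[OF u p, of t] by simp
qed

text \<open>From ln x \<le> x - 1 in both terms. It is twice the local quadratic form but has no
  remainder, so it remains useful when \<open>q\<close> is close to 0 or 1.\<close>

lemma bin_kl_chi2:
  assumes u: "0 \<le> u" "u \<le> 1" and q: "0 < q" "q < 1"
  shows "bin_kl u q \<le> (u - q)\<^sup>2 / (q * (1 - q))"
proof -
  have gen: "v * ln (v / r) \<le> v * (v / r - 1)" if "0 \<le> v" "0 < r" for v r :: real
    using that by (cases "v = 0") (auto intro!: mult_left_mono ln_le_minus_one)
  have "bin_kl u q \<le> u * (u / q - 1) + (1 - u) * ((1 - u) / (1 - q) - 1)"
    unfolding bin_kl_def using u q by (intro add_mono gen) auto
  also have "\<dots> = (u - q)\<^sup>2 / (q * (1 - q))"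
    using q by (simp add: field_simps power2_eq_square)
  finally show ?thesis .
qed

lemma ln_one_plus_le_neg:
  fixes x :: real assumes "- 1 < x" "x \<le> 0" shows "ln (1 + x) \<le> x - x\<^sup>2 / 2"
proof -
  define h where "h = (\<lambda>y::real. ln (1 + y) - y + y\<^sup>2 / 2)"
  have "h x \<le> h 0"
  proof (rule DERIV_nonneg_imp_nondecreasing[of x 0 h])
    fix z :: real assume z: "x \<le> z" "z \<le> 0"
    then have z1: "0 < 1 + z" using assms by simp
    have "(h has_real_derivative 1 / (1 + z) - 1 + z) (at z)"
      unfolding h_def using z1 by (auto intro!: derivative_eq_intros)
    moreover have "1 / (1 + z) - 1 + z = z\<^sup>2 / (1 + z)" using z1 by (simp add: field_simps power2_eq_square)
    ultimately show "\<exists>d. (h has_real_derivative d) (at z) \<and> 0 \<le> d"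
      using z1 by (intro exI[of _ "z\<^sup>2 / (1 + z)"]) auto
  qed (use assms in simp)
  then show ?thesis by (simp add: h_def)
qed

text \<open>For nonnegative \<open>x\<close> the quadratic polynomial suffices; for negative
  \<open>x\<close> the product of \<open>1 + x\<close> with the bound for the logarithm leaves
  \<open>- x ^ 3 / 2\<close>.\<close>

lemma xlnx_taylor:
  fixes x :: real assumes "- 1 \<le> x"
  shows "(1 + x) * ln (1 + x) \<le> x + x\<^sup>2 / 2 + \<bar>x\<bar> ^ 3 / 2"
proof (cases "x = -1")
  case False
  then have x1: "-1 < x" using assms by simp
  define g where "g = (\<lambda>x::real. x + x\<^sup>2 / 2 - (1 + x) * ln (1 + x))"
  show ?thesis
  proof (cases "0 \<le> x")
    case True
    have "g 0 \<le> g x"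
    proof (rule DERIV_nonneg_imp_nondecreasing[OF True])
      fix y :: real assume y: "0 \<le> y" "y \<le> x"
      have "(g has_real_derivative y - ln (1 + y)) (at y)"
        unfolding g_def using y by (auto intro!: derivative_eq_intros)
      moreover have "ln (1 + y) \<le> y" using y by (intro ln_add_one_self_le_self) auto
      ultimately show "\<exists>d. (g has_real_derivative d) (at y) \<and> 0 \<le> d" by (intro exI[of _ "y - ln (1 + y)"]) auto
    qed
    then have "(1 + x) * ln (1 + x) \<le> x + x\<^sup>2 / 2" by (simp add: g_def)
    moreover have "0 \<le> \<bar>x\<bar> ^ 3" by simp
    ultimately show ?thesis by linarith
  next
    case False
    have "(1 + x) * ln (1 + x) \<le> (1 + x) * (x - x\<^sup>2 / 2)"
      using x1 False by (intro mult_left_mono ln_one_plus_le_neg) auto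
    also have "\<dots> = x + x\<^sup>2 / 2 - x ^ 3 / 2" by (simp add: field_simps power2_eq_square power3_eq_cube)
    finally show ?thesis using False by (simp add: power3_eq_cube abs_mult)
  qed
qed (auto simp: power2_eq_square)

text \<open>The linear terms of the two outcomes cancel and the quadratic term has the sharp factor
  1/2. The price is a cubic remainder that blows up as \<open>q\<close> approaches 0 or 1.\<close>

lemma bin_kl_le_taylor:
  assumes u: "0 \<le> u" "u \<le> 1" and q: "0 < q" "q < 1"
  shows "bin_kl u q \<le> (u - q)\<^sup>2 / (2 * (q * (1 - q))) + \<bar>u - q\<bar> ^ 3 * (1 / (2 * q\<^sup>2) + 1 / (2 * (1 - q)\<^sup>2))"
proof -
  have gen: "v * ln (v / r) \<le> (v - r) + (v - r)\<^sup>2 / (2 * r) + \<bar>v - r\<bar> ^ 3 / (2 * r\<^sup>2)" if "0 \<le> v" "0 < r" for v r :: real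
  proof -
    define x where "x = (v - r) / r"
    have x: "- 1 \<le> x" "v = r * (1 + x)" "v - r = r * x" using that by (auto simp: x_def field_simps)
    have "v * ln (v / r) = r * ((1 + x) * ln (1 + x))" using that by (simp add: x(2))
    also have "\<dots> \<le> r * (x + x\<^sup>2 / 2 + \<bar>x\<bar> ^ 3 / 2)" using that x by (intro mult_left_mono xlnx_taylor) auto
    also have "\<dots> = (v - r) + (v - r)\<^sup>2 / (2 * r) + \<bar>v - r\<bar> ^ 3 / (2 * r\<^sup>2)"
      unfolding x(3) using that by (simp add: abs_mult power_mult_distrib field_simps power2_eq_square power3_eq_cube)
    finally show ?thesis .
  qed
  have "bin_kl u q \<le> ((u - q) + (u - q)\<^sup>2 / (2 * q) + \<bar>u - q\<bar> ^ 3 / (2 * q\<^sup>2))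
     + (((1 - u) - (1 - q)) + ((1 - u) - (1 - q))\<^sup>2 / (2 * (1 - q)) + \<bar>(1 - u) - (1 - q)\<bar> ^ 3 / (2 * (1 - q)\<^sup>2))"
    unfolding bin_kl_def using u q by (intro add_mono gen) auto
  also have "((1 - u) - (1 - q)) = - (u - q)" by simp
  also have "(u - q) + (u - q)\<^sup>2 / (2 * q) + \<bar>u - q\<bar> ^ 3 / (2 * q\<^sup>2)
     + (- (u - q) + (- (u - q))\<^sup>2 / (2 * (1 - q)) + \<bar>- (u - q)\<bar> ^ 3 / (2 * (1 - q)\<^sup>2))
     = (u - q)\<^sup>2 * (1 / (2 * q) + 1 / (2 * (1 - q))) + \<bar>u - q\<bar> ^ 3 * (1 / (2 * q\<^sup>2) + 1 / (2 * (1 - q)\<^sup>2))"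
    by (simp only: abs_minus_cancel power2_minus) (simp add: algebra_simps)
  also have "1 / (2 * q) + 1 / (2 * (1 - q)) = 1 / (2 * (q * (1 - q)))"
    using q by (simp add: field_simps)
  finally show ?thesis by simp
qed

section \<open>Derivatives and central moments of the binomial weights\<close>

lemma Bernstein_deriv:
  assumes "0 < x" "x < 1"
  shows "((\<lambda>x. Bernstein c z x) has_real_derivative (real z - real c * x) * Bernstein c z x / (x * (1 - x))) (at x)"
proof (cases "z \<le> c")
  case True
  have "((\<lambda>x. Bernstein c z x) has_real_derivative
     real (c choose z) * (real z * x ^ (z - 1) * (1 - x) ^ (c - z) - x ^ z * (real (c - z) * (1 - x) ^ (c - z - 1)))) (at x)"
    unfolding Bernstein_def by (auto intro!: derivative_eq_intros simp: algebra_simps)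
  moreover have "real (c choose z) * (real z * x ^ (z - 1) * (1 - x) ^ (c - z) - x ^ z * (real (c - z) * (1 - x) ^ (c - z - 1)))
    = (real z - real c * x) * Bernstein c z x / (x * (1 - x))"
  proof -
    have 1: "real z * x ^ (z - 1) = real z * x ^ z / x" using assms by (cases z) auto
    have 2: "real (c - z) * (1 - x) ^ (c - z - 1) = real (c - z) * (1 - x) ^ (c - z) / (1 - x)"
      using assms by (cases "c - z") auto
    have 3: "real (c - z) = real c - real z" using True by simp
    have "real (c choose z) * (real z * x ^ (z - 1) * (1 - x) ^ (c - z) - x ^ z * (real (c - z) * (1 - x) ^ (c - z - 1)))
      = real (c choose z) * x ^ z * (1 - x) ^ (c - z) * (real z / x - (real c - real z) / (1 - x))"
      unfolding 1 2 unfolding 3 by (simp add: algebra_simps)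
    also have "real z / x - (real c - real z) / (1 - x) = (real z - real c * x) / (x * (1 - x))"
      using assms by (simp add: field_simps)
    finally show ?thesis by (simp add: Bernstein_def mult_ac)
  qed
  ultimately show ?thesis by (simp only:)
next
  case False
  then have "(\<lambda>x. Bernstein c z x) = (\<lambda>x. 0)" by (auto simp: Bernstein_def binomial_eq_0)
  then show ?thesis by simp
qed

definition central_moment :: "nat \<Rightarrow> nat \<Rightarrow> real \<Rightarrow> real" where
  "central_moment m c x = (\<Sum>z\<le>c. Bernstein c z x * (real z - real c * x) ^ m)"

text \<open>The logarithmic derivative of a Bernstein weight is
  \<open>(z - c * x) / (x * (1 - x))\<close>, so differentiating a moment raises its order by
  one.\<close>

lemma central_moment_deriv:
  assumes "0 < x" "x < 1"
  shows "(central_moment (Suc m) c has_real_derivative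
     central_moment (Suc (Suc m)) c x / (x * (1 - x)) - real (Suc m) * real c * central_moment m c x) (at x)"
proof -
  have "((\<lambda>x. \<Sum>z\<le>c. Bernstein c z x * (real z - real c * x) ^ Suc m) has_real_derivative
     (\<Sum>z\<le>c. (real z - real c * x) * Bernstein c z x / (x * (1 - x)) * (real z - real c * x) ^ Suc m
        + Bernstein c z x * (real (Suc m) * (real z - real c * x) ^ m * (- real c)))) (at x)"
    by (rule DERIV_sum) (rule derivative_eq_intros Bernstein_deriv[OF assms] refl | simp)+
  also have "(\<Sum>z\<le>c. (real z - real c * x) * Bernstein c z x / (x * (1 - x)) * (real z - real c * x) ^ Suc m
        + Bernstein c z x * (real (Suc m) * (real z - real c * x) ^ m * (- real c)))
     = central_moment (Suc (Suc m)) c x / (x * (1 - x)) - real (Suc m) * real c * central_moment m c x"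
    unfolding central_moment_def sum.distrib sum_divide_distrib sum_distrib_left sum_negf[symmetric]
      diff_conv_add_uminus
    by (intro arg_cong2[where f = "(+)"] sum.cong refl) (simp_all add: mult_ac)
  finally show ?thesis unfolding central_moment_def[abs_def] .
qed

text \<open>The derivative formula solved for its highest moment; starting from orders 0 and 1 it
  yields all moments up to order four.\<close>

lemma central_moment_rec:
  assumes x: "0 < x" "x < 1" and D: "\<And>y. 0 < y \<Longrightarrow> y < 1 \<Longrightarrow> central_moment (Suc m) c y = g y"
    and d: "(g has_real_derivative d) (at x)"
  shows "central_moment (Suc (Suc m)) c x = x * (1 - x) * (d + real (Suc m) * real c * central_moment m c x)"
proof -
  have "(central_moment (Suc m) c has_real_derivative d) (at x)"
  proof (rule has_field_derivative_transform_within_open[OF d])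
    show "open {0<..<1::real}" "x \<in> {0<..<1}" using x by auto
  qed (use D in auto)
  from DERIV_unique[OF this central_moment_deriv[OF x]]
  show ?thesis using x by (simp add: field_simps)
qed

lemma central_moments:
  assumes x: "0 < x" "x < 1"
  shows "central_moment 0 c x = 1" "central_moment 1 c x = 0" "central_moment 2 c x = real c * (x * (1 - x))"
    and "central_moment 3 c x = real c * (x * (1 - x)) * (1 - 2 * x)"
    and "central_moment 4 c x = x * (1 - x) * (real c * (1 - 6 * (x * (1 - x))) + 3 * (real c)\<^sup>2 * (x * (1 - x)))"
proof -
  have m0: "central_moment 0 c y = 1" for y by (simp add: central_moment_def)
  have m1: "central_moment (Suc 0) c y = 0" for y
    using sum_k_Bernstein[of c y] by (simp add: central_moment_def right_diff_distrib sum_subtractf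
        sum_distrib_left[symmetric] sum_distrib_right[symmetric] mult.commute)
  have m2: "central_moment (Suc (Suc 0)) c y = real c * (y * (1 - y))" if "0 < y" "y < 1" for y
    by (subst central_moment_rec[OF that m1 DERIV_const]) (simp add: m0)
  have m3: "central_moment (Suc (Suc (Suc 0))) c y = real c * (y * (1 - y)) * (1 - 2 * y)" if "0 < y" "y < 1" for y
    by (subst central_moment_rec[OF that m2, of "real c * (1 - 2 * y)"])
      (auto intro!: derivative_eq_intros simp: m1 algebra_simps)
  have m4: "central_moment (Suc (Suc (Suc (Suc 0)))) c x = x * (1 - x) * (real c * (1 - 6 * (x * (1 - x))) + 3 * (real c)\<^sup>2 * (x * (1 - x)))"
    by (subst central_moment_rec[OF x m3, of "real c * (1 - 6 * (x * (1 - x)))"])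
      (auto intro!: derivative_eq_intros simp: m2 x algebra_simps power2_eq_square)
  show "central_moment 0 c x = 1" "central_moment 1 c x = 0" "central_moment 2 c x = real c * (x * (1 - x))"
    "central_moment 3 c x = real c * (x * (1 - x)) * (1 - 2 * x)"
    "central_moment 4 c x = x * (1 - x) * (real c * (1 - 6 * (x * (1 - x))) + 3 * (real c)\<^sup>2 * (x * (1 - x)))"
    using m0 m1 m2[OF x] m3[OF x] m4 by (simp_all add: eval_nat_numeral)
qed

section \<open>Information of a single channel\<close>

definition valid_channel :: "nat \<Rightarrow> (nat \<Rightarrow> real) \<Rightarrow> bool" where
  "valid_channel c t \<longleftrightarrow> 1 \<le> c \<and> (\<forall>z\<le>c. 0 \<le> t z \<and> t z \<le> 1) \<and> t 0 = 0 \<and> t c = 1"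

lemma valid_mean_output:
  "valid_channel c t \<Longrightarrow> 0 < w \<Longrightarrow> w < 1 \<Longrightarrow> 0 < mean_output c t w \<and> mean_output c t w < 1"
  unfolding valid_channel_def using mean_output_bounds[of w c t] by blast

text \<open>Compensation identity: replacing the mean output by a reference \<open>q\<close> raises
  the average divergence by exactly the divergence of the mean output from \<open>q\<close>. Upper
  bounds can thus be computed without knowing the mean output of the attack.\<close>

lemma channel_info_le_reference:
  assumes v: "valid_channel c t" and w: "0 < w" "w < 1" and q: "0 < q" "q < 1"
  shows "channel_info c t w \<le> (\<Sum>z\<le>c. Bernstein c z w * bin_kl (t z) q)"
proof -
  let ?p = "mean_output c t w"
  have p: "0 < ?p" "?p < 1" using valid_mean_output[OF v w] by auto
  have split: "bin_kl u q - bin_kl u ?p = u * ln (?p / q) + (1 - u) * ln ((1 - ?p) / (1 - q))"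
    if "0 \<le> u" "u \<le> 1" for u
  proof -
    have 1: "u * ln (u / q) - u * ln (u / ?p) = u * ln (?p / q)"
      using p q that by (cases "u = 0") (auto simp: ln_div algebra_simps)
    have 2: "(1 - u) * ln ((1 - u) / (1 - q)) - (1 - u) * ln ((1 - u) / (1 - ?p)) = (1 - u) * ln ((1 - ?p) / (1 - q))"
      using p q that by (cases "u = 1") (auto simp: ln_div algebra_simps)
    show ?thesis using 1 2 by (simp add: bin_kl_def)
  qed
  have "(\<Sum>z\<le>c. Bernstein c z w * bin_kl (t z) q) - channel_info c t w
    = (\<Sum>z\<le>c. Bernstein c z w * (bin_kl (t z) q - bin_kl (t z) ?p))"
    by (simp add: channel_info_def sum_subtractf right_diff_distrib)
  also have "\<dots> = (\<Sum>z\<le>c. Bernstein c z w * t z * ln (?p / q) + (Bernstein c z w - Bernstein c z w * t z) * ln ((1 - ?p) / (1 - q)))"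
    using v by (intro sum.cong refl) (simp add: split valid_channel_def algebra_simps)
  also have "\<dots> = bin_kl ?p q"
    by (simp add: sum.distrib sum_distrib_right[symmetric] sum_subtractf bin_kl_def
        mean_output_def[symmetric])
  also have "0 \<le> \<dots>" using p q by (intro bin_kl_nonneg) auto
  finally show ?thesis by simp
qed

text \<open>The upper bound takes 1/2 as reference, where the chi-square bound is four times the
  squared distance of \<open>t z\<close> from 1/2. It provides integrability against every bias
  law.\<close>

lemma channel_info_bounds:
  assumes v: "valid_channel c t" and w: "0 < w" "w < 1"
  shows "0 \<le> channel_info c t w" "channel_info c t w \<le> 1"
proof -
  have B: "0 \<le> Bernstein c z w" for z using w by (intro Bernstein_nonneg) auto
  have tz: "0 \<le> t z" "t z \<le> 1" if "z \<le> c" for z using v that by (auto simp: valid_channel_def)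
  show "0 \<le> channel_info c t w" unfolding channel_info_def
    using valid_mean_output[OF v w] tz by (intro sum_nonneg mult_nonneg_nonneg B bin_kl_nonneg) auto
  have "channel_info c t w \<le> (\<Sum>z\<le>c. Bernstein c z w * bin_kl (t z) (1/2))"
    by (rule channel_info_le_reference[OF v w]) auto
  also have "\<dots> \<le> (\<Sum>z\<le>c. Bernstein c z w * 1)"
  proof (intro sum_mono mult_left_mono B)
    fix z assume "z \<in> {..c}"
    then have u: "0 \<le> t z" "t z \<le> 1" using tz by auto
    have "bin_kl (t z) (1/2) \<le> (t z - 1/2)\<^sup>2 / (1/2 * (1 - 1/2))" by (rule bin_kl_chi2) (use u in auto)
    also have "\<dots> \<le> 1"
    proof -
      have "\<bar>t z - 1/2\<bar> \<le> 1/2" using u by linarith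
      then have "(t z - 1/2)\<^sup>2 \<le> (1/2)\<^sup>2" by (intro power2_le_iff_abs_le[THEN iffD2]) auto
      then show ?thesis by (simp add: power2_eq_square)
    qed
    finally show "bin_kl (t z) (1/2) \<le> 1" .
  qed
  finally show "channel_info c t w \<le> 1" by simp
qed

lemma Bernstein_measurable [measurable]: "(\<lambda>w. Bernstein c z w) \<in> borel_measurable borel"
  unfolding Bernstein_def by measurable

lemma channel_info_measurable [measurable]: "channel_info c t \<in> borel_measurable borel"
proof -
  have [measurable]: "mean_output c t \<in> borel_measurable borel"
    unfolding mean_output_def[abs_def] by measurable
  show ?thesis unfolding channel_info_def[abs_def] bin_kl_def by measurable
qed

section \<open>The payoff as a sum over channels\<close>

lemma prob_space_bias_law:
  assumes "bias_density f" shows "prob_space (bias_law f)"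
proof (rule prob_spaceI)
  have [measurable]: "f \<in> borel_measurable borel" using assms by (simp add: bias_density_def)
  show "emeasure (bias_law f) (space (bias_law f)) = 1"
    using assms by (simp add: bias_law_def emeasure_density bias_density_def)
qed

lemma sets_bias_law [measurable_cong, simp]: "sets (bias_law f) = sets borel"
  by (simp add: bias_law_def)

lemma AE_bias_law:
  assumes "bias_density f" shows "AE w in bias_law f. 0 < w \<and> w < 1"
proof -
  have [measurable]: "f \<in> borel_measurable borel" using assms by (simp add: bias_density_def)
  show ?thesis unfolding bias_law_def
    by (subst AE_density) (auto intro!: AE_I2 simp: indicator_def split: if_splits)
qed

text \<open>\<open>bernoulli_pmf\<close> clips its parameter to the unit interval, so measurability
  holds on the whole real line.\<close>

lemma bernoulli_pmf_measurable [measurable]: "(\<lambda>p. pmf (bernoulli_pmf p) b) \<in> borel_measurable borel"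
proof -
  have "pmf (bernoulli_pmf p) b = (if b then min 1 (max 0 p) else 1 - min 1 (max 0 p))" for p
    by (simp add: bernoulli_pmf.rep_eq)
  then show ?thesis by simp
qed

section \<open>Finite support and measurability of the outcome law\<close>

definition symbol_configs :: "nat \<Rightarrow> nat \<Rightarrow> (nat \<times> nat \<Rightarrow> bool) set" where
  "symbol_configs L k = PiE_dflt ({1..k} \<times> {1..L}) False (\<lambda>_. UNIV)"

text \<open>A single superset of the supports for all bias vectors. The set component ranges over
  all families of subsets, so that the superset is a plain product.\<close>

definition outcomes :: "nat \<Rightarrow> nat \<Rightarrow> outcome set" where
  "outcomes L k = symbol_configs L k \<times> allocations L k \<times> ({1..L} \<rightarrow>\<^sub>E Pow {1..k}) \<times> PiE_dflt {1..L} False (\<lambda>_. UNIV)"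

lemma finite_symbol_configs: "finite (symbol_configs L k)"
  unfolding symbol_configs_def by (intro finite_PiE_dflt) auto

lemma finite_outcomes: "finite (outcomes L k)"
  unfolding outcomes_def
  by (intro finite_cartesian_product finite_symbol_configs finite_allocations finite_PiE finite_PiE_dflt) auto

lemma set_outcome_pmf:
  assumes p: "set_pmf p \<subseteq> allocations L k"
  shows "set_pmf (outcome_pmf L k \<theta> p w) \<subseteq> outcomes L k"
proof -
  have 1: "set_pmf (Pi_pmf A d q) \<subseteq> PiE_dflt A d (\<lambda>_. UNIV)" if "finite A" for A d and q :: "_ \<Rightarrow> bool pmf"
    using set_Pi_pmf_subset[OF that, of d q] by (auto simp: PiE_dflt_def)
  have 2: "S \<in> {1..L} \<rightarrow>\<^sub>E Pow {1..k}" if "c \<in> set_pmf p" "S \<in> set_pmf (pmf_of_set (ordered_partitions L k c))" for c S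
  proof -
    have ca: "c \<in> allocations L k" using that p by auto
    have "S \<in> ordered_partitions L k c"
      using that set_pmf_of_set[OF ordered_partitions_nonempty[OF ca] finite_ordered_partitions] by simp
    then show ?thesis by (simp add: ordered_partitions_def)
  qed
  show ?thesis
  proof
    fix \<omega> assume "\<omega> \<in> set_pmf (outcome_pmf L k \<theta> p w)"
    then obtain x c S y where "\<omega> = (x, c, S, y)"
      "x \<in> set_pmf (Pi_pmf ({1..k} \<times> {1..L}) False (\<lambda>(j, l). bernoulli_pmf (w l)))" "c \<in> set_pmf p"
      "S \<in> set_pmf (pmf_of_set (ordered_partitions L k c))"
      "y \<in> set_pmf (Pi_pmf {1..L} False (\<lambda>l. bernoulli_pmf (\<theta> (channel_ones x S l) (c l))))"
      unfolding outcome_pmf_def by auto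
    then show "\<omega> \<in> outcomes L k"
      using p 1[of "{1..k} \<times> {1..L}"] 1[of "{1..L}"] 2[of c S]
      unfolding outcomes_def symbol_configs_def by (simp add: subset_iff)
  qed
qed

lemma outcome_pmf_measurable:
  "(\<lambda>w. pmf (outcome_pmf L k \<theta> p w) \<omega>) \<in> borel_measurable (PiM {1..L} (\<lambda>_. bias_law f))"
proof -
  \<comment> \<open>Everything drawn after the symbols. It does not involve \<open>w\<close>, so the
    mass of an outcome is a finite sum of products of Bernoulli masses.\<close>
  define R where "R = (\<lambda>x. p \<bind> (\<lambda>c. pmf_of_set (ordered_partitions L k c) \<bind> (\<lambda>S.
      Pi_pmf {1..L} False (\<lambda>l. bernoulli_pmf (\<theta> (channel_ones x S l) (c l))) \<bind> (\<lambda>y. return_pmf (x, c, S, y)))))"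
  let ?X = "\<lambda>w. Pi_pmf ({1..k} \<times> {1..L}) False (\<lambda>(j, l). bernoulli_pmf (w l))"
  have eq: "pmf (outcome_pmf L k \<theta> p w) \<omega> = (\<Sum>x\<in>symbol_configs L k.
     pmf (R x) \<omega> * (\<Prod>(j, l)\<in>{1..k} \<times> {1..L}. pmf (bernoulli_pmf (w l)) (x (j, l))))" for w
  proof -
    have "outcome_pmf L k \<theta> p w = ?X w \<bind> R" by (simp add: outcome_pmf_def R_def)
    then have "pmf (outcome_pmf L k \<theta> p w) \<omega> = measure_pmf.expectation (?X w) (\<lambda>x. pmf (R x) \<omega>)"
      by (simp add: pmf_bind)
    also have "\<dots> = (\<Sum>x\<in>symbol_configs L k. pmf (R x) \<omega> * pmf (?X w) x)"
      using set_Pi_pmf_subset[of "{1..k} \<times> {1..L}" False]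
      by (intro integral_measure_pmf_real finite_symbol_configs) (fastforce simp: symbol_configs_def PiE_dflt_def)
    also have "\<dots> = (\<Sum>x\<in>symbol_configs L k. pmf (R x) \<omega> *
       (\<Prod>(j, l)\<in>{1..k} \<times> {1..L}. pmf (bernoulli_pmf (w l)) (x (j, l))))"
    proof (intro sum.cong refl arg_cong2[where f = "(*)"])
      fix x assume "x \<in> symbol_configs L k"
      then have "x d = False" if "d \<notin> {1..k} \<times> {1..L}" for d
        using that unfolding symbol_configs_def PiE_dflt_def by blast
      then show "pmf (?X w) x = (\<Prod>(j, l)\<in>{1..k} \<times> {1..L}. pmf (bernoulli_pmf (w l)) (x (j, l)))"
        by (subst pmf_Pi') (auto simp: split_beta')
    qed
    finally show ?thesis .
  qed
  show ?thesis unfolding eq split_beta'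
  proof (intro borel_measurable_sum borel_measurable_times borel_measurable_prod borel_measurable_const)
    fix x and jl assume "jl \<in> {1..k} \<times> {1..L}"
    then have "snd jl \<in> {1..L}" by auto
    then have "(\<lambda>w. w (snd jl)) \<in> PiM {1..L} (\<lambda>_. bias_law f) \<rightarrow>\<^sub>M bias_law f"
      by (rule measurable_component_singleton)
    then have "(\<lambda>w. w (snd jl)) \<in> PiM {1..L} (\<lambda>_. bias_law f) \<rightarrow>\<^sub>M borel"
      by (subst measurable_cong_sets[OF refl sets_bias_law[symmetric]])
    then show "(\<lambda>w. pmf (bernoulli_pmf (w (snd jl))) (x (fst jl, snd jl))) \<in> borel_measurable (PiM {1..L} (\<lambda>_. bias_law f))"
      by measurable
  qed
qed

lemma singleton_PiM_count_space:
  "finite I \<Longrightarrow> x \<in> extensional I \<Longrightarrow> {x} \<in> sets (PiM I (\<lambda>_. count_space UNIV))"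
proof -
  assume "finite I" "x \<in> extensional I"
  then have "{x} = PiE I (\<lambda>i. {x i})" by (auto simp: PiE_def extensional_def fun_eq_iff) (metis singletonD Pi_mem)
  then show ?thesis using \<open>finite I\<close> by (simp add: sets_PiM_I_finite)
qed

locale fingerprinting =
  fixes L k :: nat and f :: "real \<Rightarrow> real" and \<theta> :: "nat \<Rightarrow> nat \<Rightarrow> real" and p :: "(nat \<Rightarrow> nat) pmf"
  assumes f: "bias_density f" and p: "set_pmf p \<subseteq> allocations L k" and \<theta>: "marking_attack L k \<theta>"
begin

abbreviation "\<mu> \<equiv> PiM {1..L} (\<lambda>_. bias_law f)"
definition "X = (\<lambda>\<omega>. fst (observed L \<omega>))"
definition "V = (\<lambda>\<omega>. snd (observed L \<omega>))"
abbreviation "TX \<equiv> PiM {1..L} (\<lambda>_. count_space (UNIV :: bool set))"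
abbreviation "TV \<equiv> PiM {1..L} (\<lambda>_. count_space (UNIV :: nat set)) \<Otimes>\<^sub>M PiM {1..L} (\<lambda>_. count_space (UNIV :: nat set))"

sublocale P: prob_space "bias_law f" using f by (rule prob_space_bias_law)
sublocale PP: product_prob_space "\<lambda>_. bias_law f" "{1..L}" ..

sublocale finite_kernel_vars \<mu> "PiM {1..L} (\<lambda>_. borel)" "outcome_pmf L k \<theta> p" "outcomes L k"
  TX TV X V "X ` outcomes L k" "V ` outcomes L k"
proof
  show "sets (PiM {1..L} (\<lambda>_. borel)) = sets \<mu>" by (intro sets_PiM_cong) auto
  show "finite (outcomes L k)" by (rule finite_outcomes)
  show "set_pmf (outcome_pmf L k \<theta> p w) \<subseteq> outcomes L k" for w by (rule set_outcome_pmf[OF p])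
  show "(\<lambda>w. pmf (outcome_pmf L k \<theta> p w) \<omega>) \<in> borel_measurable \<mu>" for \<omega> by (rule outcome_pmf_measurable)
  show "finite (X ` outcomes L k)" "finite (V ` outcomes L k)" by (simp_all add: finite_outcomes)
  show "X \<omega> \<in> space TX" for \<omega> by (auto simp: X_def observed_def space_PiM split_beta')
  show "V \<omega> \<in> space TV" for \<omega> by (auto simp: V_def observed_def space_PiM space_pair_measure split_beta')
  show "{x} \<in> sets TX" if "x \<in> X ` outcomes L k" for x
    using that by (intro singleton_PiM_count_space) (auto simp: X_def observed_def)
  show "{v} \<in> sets TV" if "v \<in> V ` outcomes L k" for v
  proof -
    have "{v} = {fst v} \<times> {snd v}" by auto
    moreover have "fst v \<in> extensional {1..L}" "snd v \<in> extensional {1..L}"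
      using that by (auto simp: V_def observed_def)
    ultimately show ?thesis by (metis pair_measureI singleton_PiM_count_space finite_atLeastAtMost)
  qed
qed auto

lemma sum_pmf_indicator:
  assumes "set_pmf M \<subseteq> F" "finite F"
  shows "(\<Sum>\<omega>\<in>F. pmf M \<omega> * indicator {g \<omega>} x) = pmf (map_pmf g M) x"
proof -
  have "pmf (map_pmf g M) x = measure_pmf.expectation M (indicator (g -` {x}))"
    by (simp add: pmf_map)
  also have "\<dots> = (\<Sum>\<omega>\<in>F. indicator (g -` {x}) \<omega> * pmf M \<omega>)"
    using assms by (intro integral_measure_pmf_real) auto
  also have "\<dots> = (\<Sum>\<omega>\<in>F. pmf M \<omega> * indicator {g \<omega>} x)"
    by (intro sum.cong refl) (auto split: split_indicator)
  finally show ?thesis ..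
qed

abbreviation "A w \<equiv> map_pmf (observed L) (outcome_pmf L k \<theta> p w)"

lemma a_eq_pmf: "aX w x = pmf (map_pmf fst (A w)) x" "aY w v = pmf (map_pmf snd (A w)) v" "aXY w x v = pmf (A w) (x, v)"
proof -
  show "aX w x = pmf (map_pmf fst (A w)) x" "aY w v = pmf (map_pmf snd (A w)) v"
    unfolding aX_def aY_def
    by (simp_all add: sum_pmf_indicator[OF set_outcome_pmf[OF p] finite_outcomes] pmf.map_comp o_def X_def V_def)
  have ind: "indicat_real {X \<omega>} x * indicat_real {V \<omega>} v = indicator {observed L \<omega>} (x, v)" for \<omega>
    by (simp add: X_def V_def prod_eq_iff split: split_indicator)
  show "aXY w x v = pmf (A w) (x, v)"
    unfolding aXY_def ind by (rule sum_pmf_indicator[OF set_outcome_pmf[OF p] finite_outcomes])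
qed

lemma joint_law_J: "joint_law L k f \<theta> p = J"
  unfolding joint_law_def J_def ..

definition "info w = (\<Sum>x\<in>X ` outcomes L k. \<Sum>y\<in>V ` outcomes L k. aXY w x y * log 2 (aXY w x y / (aX w x * aY w y)))"

lemma payoff_info: "payoff L k f \<theta> p = (\<integral>w. info w \<partial>\<mu>) / real k"
proof -
  have "output_var L = (\<lambda>(w, \<omega>). X \<omega>)" "(\<lambda>\<omega>. (ones_var L \<omega>, size_var L \<omega>)) = (\<lambda>(w, \<omega>). V \<omega>)" "bias_var = fst"
    by (auto simp: output_var_def ones_var_def size_var_def bias_var_def X_def V_def observed_def fun_eq_iff)
  then show ?thesis
    unfolding payoff_def joint_law_J info_def[abs_def]
    by (simp only: conditional_mutual_information_J[of 2])
qed

lemma integrable_info: "integrable \<mu> info"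
  unfolding info_def[abs_def]
proof (intro Bochner_Integration.integrable_sum)
  fix x y assume "x \<in> X ` outcomes L k" "y \<in> V ` outcomes L k"
  show "integrable \<mu> (\<lambda>w. aXY w x y * log 2 (aXY w x y / (aX w x * aY w y)))"
  proof (rule finite_measure.integrable_const_bound[OF finite_measure_mu, where B = "1 / ln 2"])
    show "AE w in \<mu>. norm (aXY w x y * log 2 (aXY w x y / (aX w x * aY w y))) \<le> 1 / ln 2"
      by (auto intro!: mi_term_bound)
    have [measurable]: "(\<lambda>w. aX w x) \<in> borel_measurable \<mu>" "(\<lambda>w. aY w y) \<in> borel_measurable \<mu>"
      "(\<lambda>w. aXY w x y) \<in> borel_measurable \<mu>"
      unfolding aX_def aY_def aXY_def by measurable
    show "(\<lambda>w. aXY w x y * log 2 (aXY w x y / (aX w x * aY w y))) \<in> borel_measurable \<mu>" by measurable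
  qed
qed

lemma info_expectation:
  "info w = measure_pmf.expectation (A w) (\<lambda>(y, v). ln (pmf (A w) (y, v) / (pmf (map_pmf fst (A w)) y * pmf (map_pmf snd (A w)) v))) / ln 2"
proof -
  let ?h = "\<lambda>(y, v). ln (pmf (A w) (y, v) / (pmf (map_pmf fst (A w)) y * pmf (map_pmf snd (A w)) v))"
  have "set_pmf (A w) \<subseteq> X ` outcomes L k \<times> V ` outcomes L k"
    using set_outcome_pmf[OF p] by (fastforce simp: X_def V_def prod_eq_iff image_iff)
  then have "measure_pmf.expectation (A w) ?h = (\<Sum>z\<in>X ` outcomes L k \<times> V ` outcomes L k. ?h z * pmf (A w) z)"
    by (intro integral_measure_pmf_real) (auto simp: finite_outcomes)
  also have "\<dots> = info w * ln 2"
    unfolding info_def a_eq_pmf sum.cartesian_product sum_distrib_right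
    by (intro sum.cong refl) (auto simp: log_def)
  finally show ?thesis by simp
qed

definition "total_channel_info w = measure_pmf.expectation p (\<lambda>c. \<Sum>l\<in>{1..L}. channel_info (c l) (\<lambda>z. \<theta> z (c l)) (w l))"

text \<open>\<open>info\<close> is in bits and the channel informations are in nats, hence the
  factor \<open>ln 2\<close>. The two sides differ by \<open>allocation_gain\<close>, which vanishes
  for a deterministic allocation.\<close>

lemma info_channels:
  assumes w: "\<And>l. l \<in> {1..L} \<Longrightarrow> 0 < w l \<and> w l < 1"
  shows "total_channel_info w \<le> info w * ln 2"
    and "p = return_pmf c0 \<Longrightarrow> total_channel_info w = info w * ln 2"
proof -
  interpret attack_at L k \<theta> p w by unfold_locales (use p w \<theta> in auto)
  have e: "A w = observed_law L \<theta> p w" by (rule observed_outcome[OF p w])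
  have "info w * ln 2 = total_channel_info w + allocation_gain"
    using info_expectation[of w] unfolding e observed_information total_channel_info_def by simp
  then show "total_channel_info w \<le> info w * ln 2"
    and "p = return_pmf c0 \<Longrightarrow> total_channel_info w = info w * ln 2"
    using allocation_gain_nonneg allocation_gain_return by auto
qed

lemma AE_w: "AE w in \<mu>. \<forall>l\<in>{1..L}. 0 < w l \<and> w l < 1"
proof (rule AE_finite_allI)
  fix l assume "l \<in> {1..L}"
  then show "AE w in \<mu>. 0 < w l \<and> w l < 1"
    using AE_bias_law[OF f] by (intro AE_PiM_component[of "{1..L}" "\<lambda>_. bias_law f"] P.prob_space_axioms)
qed simp

lemma fin_p: "finite (set_pmf p)" using p finite_allocations finite_subset by blast

lemma valid_channel_p:
  assumes "c \<in> set_pmf p" "l \<in> {1..L}" shows "valid_channel (c l) (\<lambda>z. \<theta> z (c l))"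
proof -
  have "c l \<in> {1..k - L + 1}" using allocations_bounds assms p by blast
  then show ?thesis using \<theta> unfolding marking_attack_def valid_channel_def by auto
qed

text \<open>A component of the product of bias laws has the bias law itself as distribution, so each
  channel contributes an integral over a single bias.\<close>

lemma component_info:
  assumes "c \<in> set_pmf p" "l \<in> {1..L}"
  shows "integrable \<mu> (\<lambda>w. channel_info (c l) (\<lambda>z. \<theta> z (c l)) (w l))"
    and "(\<integral>w. channel_info (c l) (\<lambda>z. \<theta> z (c l)) (w l) \<partial>\<mu>) = (\<integral>w. channel_info (c l) (\<lambda>z. \<theta> z (c l)) w \<partial>bias_law f)"
proof -
  have comp: "(\<lambda>w. w l) \<in> \<mu> \<rightarrow>\<^sub>M bias_law f" using assms by (intro measurable_component_singleton)
  have [measurable]: "channel_info (c l) (\<lambda>z. \<theta> z (c l)) \<in> borel_measurable (bias_law f)" by simp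
  show "integrable \<mu> (\<lambda>w. channel_info (c l) (\<lambda>z. \<theta> z (c l)) (w l))"
  proof (rule finite_measure.integrable_const_bound[OF finite_measure_mu, where B = 1])
    show "AE w in \<mu>. norm (channel_info (c l) (\<lambda>z. \<theta> z (c l)) (w l)) \<le> 1"
      using AE_w by eventually_elim (use assms channel_info_bounds[OF valid_channel_p[OF assms]] in auto)
    show "(\<lambda>w. channel_info (c l) (\<lambda>z. \<theta> z (c l)) (w l)) \<in> borel_measurable \<mu>"
      by (rule measurable_compose[OF comp]) simp
  qed
  have "distr \<mu> (bias_law f) (\<lambda>w. w l) = bias_law f"
    using assms by (intro distr_PiM_component P.prob_space_axioms) auto
  then show "(\<integral>w. channel_info (c l) (\<lambda>z. \<theta> z (c l)) (w l) \<partial>\<mu>) = (\<integral>w. channel_info (c l) (\<lambda>z. \<theta> z (c l)) w \<partial>bias_law f)"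
    using integral_distr[OF comp, of "channel_info (c l) (\<lambda>z. \<theta> z (c l))"] by simp
qed

lemma total_channel_info_sum:
  "total_channel_info w = (\<Sum>c\<in>set_pmf p. (\<Sum>l\<in>{1..L}. channel_info (c l) (\<lambda>z. \<theta> z (c l)) (w l)) * pmf p c)"
  unfolding total_channel_info_def using fin_p by (intro integral_measure_pmf_real) auto

lemma integral_total_channel_info:
  "integrable \<mu> total_channel_info"
  "(\<integral>w. total_channel_info w \<partial>\<mu>) = measure_pmf.expectation p (\<lambda>c. \<Sum>l\<in>{1..L}. (\<integral>w. channel_info (c l) (\<lambda>z. \<theta> z (c l)) w \<partial>bias_law f))"
proof -
  show "integrable \<mu> total_channel_info"
    unfolding total_channel_info_sum[abs_def]
    by (intro Bochner_Integration.integrable_sum integrable_mult_left component_info(1))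
  have "(\<integral>w. total_channel_info w \<partial>\<mu>) = (\<Sum>c\<in>set_pmf p. (\<Sum>l\<in>{1..L}. (\<integral>w. channel_info (c l) (\<lambda>z. \<theta> z (c l)) w \<partial>bias_law f)) * pmf p c)"
  proof -
    have int: "integrable \<mu> (\<lambda>w. \<Sum>l\<in>{1..L}. channel_info (c l) (\<lambda>z. \<theta> z (c l)) (w l))" if "c \<in> set_pmf p" for c
      using that by (intro Bochner_Integration.integrable_sum component_info(1))
    have eq: "(\<integral>w. (\<Sum>l\<in>{1..L}. channel_info (c l) (\<lambda>z. \<theta> z (c l)) (w l)) \<partial>\<mu>)
      = (\<Sum>l\<in>{1..L}. (\<integral>w. channel_info (c l) (\<lambda>z. \<theta> z (c l)) w \<partial>bias_law f))" if "c \<in> set_pmf p" for c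
    proof -
      have "(\<integral>w. (\<Sum>l\<in>{1..L}. channel_info (c l) (\<lambda>z. \<theta> z (c l)) (w l)) \<partial>\<mu>)
        = (\<Sum>l\<in>{1..L}. (\<integral>w. channel_info (c l) (\<lambda>z. \<theta> z (c l)) (w l) \<partial>\<mu>))"
        by (rule Bochner_Integration.integral_sum) (rule component_info(1)[OF that])
      also have "\<dots> = (\<Sum>l\<in>{1..L}. (\<integral>w. channel_info (c l) (\<lambda>z. \<theta> z (c l)) w \<partial>bias_law f))"
        by (intro sum.cong refl component_info(2)[OF that])
      finally show ?thesis .
    qed
    have "(\<integral>w. total_channel_info w \<partial>\<mu>)
      = (\<Sum>c\<in>set_pmf p. (\<integral>w. (\<Sum>l\<in>{1..L}. channel_info (c l) (\<lambda>z. \<theta> z (c l)) (w l)) * pmf p c \<partial>\<mu>))"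
      unfolding total_channel_info_sum[abs_def]
      by (intro Bochner_Integration.integral_sum integrable_mult_left int)
    also have "\<dots> = (\<Sum>c\<in>set_pmf p. (\<Sum>l\<in>{1..L}. (\<integral>w. channel_info (c l) (\<lambda>z. \<theta> z (c l)) w \<partial>bias_law f)) * pmf p c)"
      by (intro sum.cong refl) (simp only: integral_mult_left_zero eq)
    finally show ?thesis .
  qed
  then show "(\<integral>w. total_channel_info w \<partial>\<mu>) = measure_pmf.expectation p (\<lambda>c. \<Sum>l\<in>{1..L}. (\<integral>w. channel_info (c l) (\<lambda>z. \<theta> z (c l)) w \<partial>bias_law f))"
    using fin_p by (subst integral_measure_pmf_real[of "set_pmf p"]) auto
qed

theorem payoff_ge:
  "measure_pmf.expectation p (\<lambda>c. \<Sum>l\<in>{1..L}. (\<integral>w. channel_info (c l) (\<lambda>z. \<theta> z (c l)) w \<partial>bias_law f)) / (real k * ln 2)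
    \<le> payoff L k f \<theta> p"
proof -
  have "(\<integral>w. total_channel_info w \<partial>\<mu>) \<le> (\<integral>w. info w * ln 2 \<partial>\<mu>)"
    using integral_total_channel_info(1) integrable_info AE_w
    by (intro integral_mono_AE) (auto elim!: eventually_mono intro!: info_channels(1))
  also have "\<dots> = (\<integral>w. info w \<partial>\<mu>) * ln 2" by simp
  finally have "(\<integral>w. total_channel_info w \<partial>\<mu>) / ln 2 \<le> (\<integral>w. info w \<partial>\<mu>)"
    by (simp add: divide_le_eq)
  then have "(\<integral>w. total_channel_info w \<partial>\<mu>) / ln 2 / real k \<le> (\<integral>w. info w \<partial>\<mu>) / real k"
    by (intro divide_right_mono) auto
  then show ?thesis unfolding payoff_info integral_total_channel_info(2)
    by (simp add: mult.commute)
qed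

text \<open>A fixed allocation leaves nothing to be revealed about the sizes, so the previous bound
  is attained.\<close>

theorem payoff_return:
  assumes "p = return_pmf c"
  shows "payoff L k f \<theta> p = (\<Sum>l\<in>{1..L}. (\<integral>w. channel_info (c l) (\<lambda>z. \<theta> z (c l)) w \<partial>bias_law f)) / (real k * ln 2)"
proof -
  have "(\<integral>w. total_channel_info w \<partial>\<mu>) = (\<integral>w. info w * ln 2 \<partial>\<mu>)"
    using integral_total_channel_info(1) integrable_info AE_w
    by (intro integral_cong_AE) (auto elim!: eventually_mono intro!: info_channels(2)[OF _ assms])
  then show ?thesis unfolding payoff_info integral_total_channel_info(2)
    by (simp add: assms field_simps)
qed

end

section \<open>The arcsine tracer\<close>

text \<open>The arcsine distribution function shifted to run from -1/2 to 1/2; only its differences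
  are used.\<close>

definition arcsine_cdf :: "real \<Rightarrow> real" where
  "arcsine_cdf w = arcsin (2 * w - 1) / pi"

lemma arcsine_cdf_deriv:
  assumes "0 < w" "w < 1"
  shows "(arcsine_cdf has_real_derivative arcsine_density w) (at w)"
proof -
  have "1 - (2 * w - 1)\<^sup>2 = 4 * (w * (1 - w))" by (simp add: power2_eq_square algebra_simps)
  then have s: "sqrt (1 - (2 * w - 1)\<^sup>2) = 2 * sqrt (w * (1 - w))" by (simp add: real_sqrt_mult)
  have "(arcsine_cdf has_real_derivative inverse (sqrt (1 - (2 * w - 1)\<^sup>2)) * 2 / pi) (at w)"
    unfolding arcsine_cdf_def using assms by (auto intro!: derivative_eq_intros)
  then show ?thesis unfolding s arcsine_density_def by (simp add: field_simps)
qed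

lemma arcsine_density_measurable [measurable]: "arcsine_density \<in> borel_measurable borel"
  unfolding arcsine_density_def[abs_def] by measurable

lemma arcsine_density_nonneg: "0 < w \<Longrightarrow> w < 1 \<Longrightarrow> 0 \<le> arcsine_density w"
  by (simp add: arcsine_density_def)

lemma arcsine_density_continuous: "continuous_on {0<..<1} arcsine_density"
  unfolding arcsine_density_def[abs_def] by (intro continuous_intros) auto

lemma continuous_arcsine_cdf: "continuous_on {0..1} arcsine_cdf"
  unfolding arcsine_cdf_def[abs_def] by (intro continuous_intros) auto

text \<open>The density is unbounded at both ends, so the fundamental theorem of calculus is applied
  on the open interval with one-sided limits of the antiderivative.\<close>

lemma arcsine_total:
  "set_integrable lborel {0<..<1} arcsine_density" "(LBINT w:{0<..<1}. arcsine_density w) = 1"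
proof -
  have e: "einterval 0 1 = {0<..<1::real}" by (auto simp: einterval_def)
  have lim0: "((arcsine_cdf \<circ> real_of_ereal) \<longlongrightarrow> arcsine_cdf 0) (at_right 0)"
  proof -
    have "(arcsine_cdf \<longlongrightarrow> arcsine_cdf 0) (at_right 0)"
      using continuous_arcsine_cdf by (simp add: continuous_on_Icc_at_rightD)
    then show ?thesis using ereal_tendsto_simps(2)[of arcsine_cdf "arcsine_cdf 0" 0] by (simp add: zero_ereal_def)
  qed
  have lim1: "((arcsine_cdf \<circ> real_of_ereal) \<longlongrightarrow> arcsine_cdf 1) (at_left 1)"
  proof -
    have "(arcsine_cdf \<longlongrightarrow> arcsine_cdf 1) (at_left 1)"
      using continuous_arcsine_cdf by (simp add: continuous_on_Icc_at_leftD)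
    then show ?thesis using ereal_tendsto_simps(1)[of arcsine_cdf "arcsine_cdf 1" 1] by (simp add: one_ereal_def)
  qed
  have "set_integrable lborel (einterval 0 1) arcsine_density \<and> (LBINT x=0..1. arcsine_density x) = arcsine_cdf 1 - arcsine_cdf 0"
  proof (intro conjI)
    note * = interval_integral_FTC_nonneg[of 0 1 arcsine_cdf arcsine_density "arcsine_cdf 0" "arcsine_cdf 1", OF _ _ _ _ lim0 lim1]
    have c: "isCont arcsine_density x" if "0 < ereal x" "ereal x < 1" for x
      using arcsine_density_continuous that by (auto simp: continuous_on_eq_continuous_at)
    show "set_integrable lborel (einterval 0 1) arcsine_density"
      by (rule *(1)) (auto intro!: arcsine_cdf_deriv c arcsine_density_nonneg)
    show "(LBINT x=0..1. arcsine_density x) = arcsine_cdf 1 - arcsine_cdf 0"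
      by (rule *(2)) (auto intro!: arcsine_cdf_deriv c arcsine_density_nonneg)
  qed
  then show "set_integrable lborel {0<..<1} arcsine_density" "(LBINT w:{0<..<1}. arcsine_density w) = 1"
    by (auto simp: e interval_lebesgue_integral_def arcsine_cdf_def)
qed

lemma bias_density_arcsine: "bias_density arcsine_density"
  unfolding bias_density_def
proof (intro conjI ballI)
  have int: "integrable lborel (\<lambda>w. indicator {0<..<1} w * arcsine_density w)"
    using arcsine_total(1) by (simp add: set_integrable_def)
  have "(\<integral>\<^sup>+ w\<in>{0<..<1}. ennreal (arcsine_density w) \<partial>lborel)
     = (\<integral>\<^sup>+ w. ennreal (indicator {0<..<1} w * arcsine_density w) \<partial>lborel)"
    by (intro nn_integral_cong) (auto split: split_indicator)
  also have "\<dots> = ennreal (\<integral>w. indicator {0<..<1} w * arcsine_density w \<partial>lborel)"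
    by (rule nn_integral_eq_integral[OF int]) (auto simp: arcsine_density_nonneg split: split_indicator)
  finally show "(\<integral>\<^sup>+ w\<in>{0<..<1}. ennreal (arcsine_density w) \<partial>lborel) = 1"
    using arcsine_total(2) by (simp add: set_lebesgue_integral_def)
qed (auto simp: arcsine_density_nonneg)

text \<open>The logarithmic derivative of the binomial weights is the score \<open>z - c * w\<close>
  over \<open>w * (1 - w)\<close>, so the slope of the mean output is a covariance. Centring
  \<open>t\<close> costs nothing, because the score has mean 0.\<close>

lemma mean_output_deriv:
  fixes c :: nat and t :: "nat \<Rightarrow> real"
  assumes w: "0 < w" "w < 1"
  defines "D \<equiv> (\<Sum>z\<le>c. Bernstein c z w * (t z - mean_output c t w) * (real z - real c * w)) / (w * (1 - w))"
  shows "(mean_output c t has_real_derivative D) (at w)"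
proof -
  have "(mean_output c t has_real_derivative (\<Sum>z\<le>c. (real z - real c * w) * Bernstein c z w / (w * (1 - w)) * t z)) (at w)"
    unfolding mean_output_def[abs_def]
    by (rule DERIV_sum) (rule derivative_eq_intros Bernstein_deriv[OF w] refl | simp)+
  moreover have "(\<Sum>z\<le>c. (real z - real c * w) * Bernstein c z w / (w * (1 - w)) * t z)
     = (\<Sum>z\<le>c. Bernstein c z w * t z * (real z - real c * w)) / (w * (1 - w))"
    unfolding sum_divide_distrib by (intro sum.cong refl) (simp add: mult_ac)
  moreover have "(\<Sum>z\<le>c. Bernstein c z w * t z * (real z - real c * w))
     = (\<Sum>z\<le>c. Bernstein c z w * (t z - mean_output c t w) * (real z - real c * w))"
  proof -
    have "(\<Sum>z\<le>c. Bernstein c z w * (t z - mean_output c t w) * (real z - real c * w))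
      = (\<Sum>z\<le>c. Bernstein c z w * t z * (real z - real c * w)) - mean_output c t w * central_moment 1 c w"
      unfolding central_moment_def sum_distrib_left sum_subtractf[symmetric]
      by (intro sum.cong refl) (simp add: algebra_simps)
    then show ?thesis unfolding central_moments(2)[OF w] by simp
  qed
  ultimately show ?thesis by (simp add: D_def)
qed

abbreviation arcsine_info :: "nat \<Rightarrow> (nat \<Rightarrow> real) \<Rightarrow> real" where
  "arcsine_info c t \<equiv> (\<integral>w. channel_info c t w \<partial>bias_law arcsine_density)"

lemma arcsine_info_lborel:
  assumes v: "valid_channel c t"
  shows "integrable lborel (\<lambda>w. indicator {0<..<1} w * arcsine_density w * channel_info c t w)"
    and "arcsine_info c t = (\<integral>w. indicator {0<..<1} w * arcsine_density w * channel_info c t w \<partial>lborel)"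
proof -
  have int: "integrable lborel (\<lambda>w. indicator {0<..<1} w * arcsine_density w)"
    using arcsine_total(1) by (simp add: set_integrable_def)
  show "integrable lborel (\<lambda>w. indicator {0<..<1} w * arcsine_density w * channel_info c t w)"
  proof (rule Bochner_Integration.integrable_bound[OF int])
    show "AE w in lborel. norm (indicator {0<..<1} w * arcsine_density w * channel_info c t w) \<le> norm (indicator {0<..<1} w * arcsine_density w)"
      by (intro AE_I2) (auto simp: channel_info_bounds[OF v] abs_mult arcsine_density_nonneg mult_left_le split: split_indicator)
  qed simp
  have "bias_law arcsine_density = density lborel (\<lambda>w. ennreal (indicator {0<..<1} w * arcsine_density w))"
    unfolding bias_law_def by (intro density_cong) (auto split: split_indicator)
  then show "arcsine_info c t = (\<integral>w. indicator {0<..<1} w * arcsine_density w * channel_info c t w \<partial>lborel)"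
    by (simp add: integral_real_density arcsine_density_nonneg split: split_indicator)
qed

text \<open>If the main term of the pointwise bound is an exact derivative, integration telescopes
  to the end values of \<open>H\<close>. Outside \<open>{a..b}\<close> the information is
  nonnegative and is dropped.\<close>

lemma arcsine_info_ge:
  assumes v: "valid_channel c t" and ab: "0 < a" "a \<le> b" "b < 1"
    and H: "\<And>w. a \<le> w \<Longrightarrow> w \<le> b \<Longrightarrow> (H has_real_derivative h w) (at w)" and h: "continuous_on {a..b} h"
    and le: "\<And>w. a \<le> w \<Longrightarrow> w \<le> b \<Longrightarrow> h w - \<kappa> * arcsine_density w \<le> arcsine_density w * channel_info c t w"
  shows "H b - H a - \<kappa> * (arcsine_cdf b - arcsine_cdf a) \<le> arcsine_info c t"
proof -
  have ab': "{a..b} \<subseteq> {0<..<1}" using ab by auto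
  let ?g = "\<lambda>w. h w - \<kappa> * arcsine_density w" and ?G = "\<lambda>w. H w - \<kappa> * arcsine_cdf w"
  have "has_bochner_integral lborel (\<lambda>w. indicator {a..b} w *\<^sub>R ?g w) (?G b - ?G a)"
  proof (rule has_bochner_integral_FTC_Icc[OF ab(2)])
    fix w assume w: "a \<le> w" "w \<le> b"
    then have "0 < w" "w < 1" using ab by auto
    then have "(?G has_real_derivative ?g w) (at w)"
      using w by (auto intro!: derivative_eq_intros H arcsine_cdf_deriv)
    then show "(?G has_vector_derivative ?g w) (at w within {a..b})"
      by (simp add: has_real_derivative_iff_has_vector_derivative has_vector_derivative_at_within)
  next
    show "continuous_on {a..b} ?g"
      by (intro continuous_intros h continuous_on_subset[OF arcsine_density_continuous ab'])
  qed
  then have i: "integrable lborel (\<lambda>w. indicator {a..b} w * ?g w)" "(\<integral>w. indicator {a..b} w * ?g w \<partial>lborel) = ?G b - ?G a"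
    by (auto simp: has_bochner_integral_iff)
  have "?G b - ?G a \<le> arcsine_info c t"
    unfolding i(2)[symmetric] arcsine_info_lborel(2)[OF v]
  proof (rule integral_mono[OF i(1) arcsine_info_lborel(1)[OF v]])
    fix w
    show "indicator {a..b} w * ?g w \<le> indicator {0<..<1} w * arcsine_density w * channel_info c t w"
      using le[of w] ab arcsine_density_nonneg[of w] channel_info_bounds[OF v, of w]
      by (auto split: split_indicator)
  qed
  then show ?thesis by (simp add: algebra_simps)
qed

lemma mean_deriv_continuous:
  assumes "0 < a" "b < 1"
  shows "continuous_on {a..b} (\<lambda>w. (\<Sum>z\<le>c. Bernstein c z w * (t z - mean_output c t w) * (real z - real c * w)) / (w * (1 - w)))"
  using assms unfolding mean_output_def Bernstein_def
  by (intro continuous_intros) auto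

lemma continuous_mean_output: "continuous_on S (mean_output c t)"
  unfolding mean_output_def[abs_def] Bernstein_def by (intro continuous_intros)

text \<open>Averages a dual bound whose test function is linear in the score: the linear term
  becomes the covariance, the quadratic term the binomial variance, and \<open>R\<close> collects
  the remainders.\<close>

lemma channel_info_cov_lower:
  assumes v: "valid_channel c t" and w: "0 < w" "w < 1"
    and le: "\<And>z. z \<le> c \<Longrightarrow> s * (real z - real c * w) * (t z - mean_output c t w) - A * (real z - real c * w)\<^sup>2 - R z
      \<le> bin_kl (t z) (mean_output c t w)"
  shows "s * (\<Sum>z\<le>c. Bernstein c z w * (t z - mean_output c t w) * (real z - real c * w)) - A * (real c * (w * (1 - w)))
     - (\<Sum>z\<le>c. Bernstein c z w * R z) \<le> channel_info c t w"
proof -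
  have "s * (\<Sum>z\<le>c. Bernstein c z w * (t z - mean_output c t w) * (real z - real c * w)) - A * central_moment 2 c w
     - (\<Sum>z\<le>c. Bernstein c z w * R z)
    = (\<Sum>z\<le>c. Bernstein c z w * (s * (real z - real c * w) * (t z - mean_output c t w) - A * (real z - real c * w)\<^sup>2 - R z))"
    unfolding central_moment_def sum_distrib_left sum_subtractf[symmetric]
    by (intro sum.cong refl) (simp add: algebra_simps)
  also have "\<dots> \<le> channel_info c t w" unfolding channel_info_def
    using w le by (intro sum_mono mult_left_mono Bernstein_nonneg) auto
  finally show ?thesis by (simp add: central_moments[OF w])
qed

text \<open>The constant is too small for the asymptotics, but the bound holds up to the ends of the unit
  interval: it makes \<open>p\<close> small near 0 and close to 1 near 1 unless the information is already large,
  and it covers channels with few colluders.\<close>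

lemma arcsine_weak_linear:
  assumes v: "valid_channel c t" and ab: "0 < a" "a \<le> b" "b < 1"
  shows "l * (mean_output c t b - mean_output c t a) / (pi * real c) - l\<^sup>2 / (2 * real c) * (arcsine_cdf b - arcsine_cdf a) \<le> arcsine_info c t"
proof -
  let ?S = "\<lambda>w. (\<Sum>z\<le>c. Bernstein c z w * (t z - mean_output c t w) * (real z - real c * w))"
  let ?h = "\<lambda>w. l * (?S w / (w * (1 - w))) / (pi * real c)"
  have c: "0 < real c" using v by (simp add: valid_channel_def)
  have "(\<lambda>w. l * mean_output c t w / (pi * real c)) b - (\<lambda>w. l * mean_output c t w / (pi * real c)) a
     - l\<^sup>2 / (2 * real c) * (arcsine_cdf b - arcsine_cdf a) \<le> arcsine_info c t"
  proof (rule arcsine_info_ge[OF v ab, where h = ?h])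
    fix w assume "a \<le> w" "w \<le> b"
    then have w: "0 < w" "w < 1" using ab by auto
    show "((\<lambda>w. l * mean_output c t w / (pi * real c)) has_real_derivative ?h w) (at w)"
      by (rule DERIV_cdivide, rule DERIV_cmult, rule mean_output_deriv[OF w])
    define X where "X = w * (1 - w)"
    have X: "0 < X" using w by (simp add: X_def)
    \<comment> \<open>This slope makes \<open>arcsine_density w * \<mu>\<close> a multiple of
      \<open>1 / (w * (1 - w))\<close>, so the main term is a constant times the derivative of the
      mean output, and it makes the quadratic cost independent of \<open>w\<close>.\<close>
    define \<mu> where "\<mu> = l / (real c * sqrt X)"
    have p: "0 < mean_output c t w" "mean_output c t w < 1" using valid_mean_output[OF v w] by auto
    have "\<mu> * ?S w - (\<mu>\<^sup>2 / 2) * (real c * X) - (\<Sum>z\<le>c. Bernstein c z w * 0) \<le> channel_info c t w"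
      unfolding X_def
    proof (rule channel_info_cov_lower[OF v w])
      fix z assume z: "z \<le> c"
      define d where "d = \<mu> * (real z - real c * w)"
      have "d * (t z - mean_output c t w) - d\<^sup>2 / 2 \<le> (t z - mean_output c t w)\<^sup>2 / 2"
        using zero_le_power2[of "d - (t z - mean_output c t w)"] by (simp add: power2_eq_square algebra_simps)
      also have "\<dots> \<le> bin_kl (t z) (mean_output c t w)"
        using v z p by (intro bin_kl_ge_square) (auto simp: valid_channel_def)
      finally show "\<mu> * (real z - real c * w) * (t z - mean_output c t w) - \<mu>\<^sup>2 / 2 * (real z - real c * w)\<^sup>2 - 0
        \<le> bin_kl (t z) (mean_output c t w)" by (simp add: d_def power_mult_distrib)
    qed
    then have "arcsine_density w * (\<mu> * ?S w - (\<mu>\<^sup>2 / 2) * (real c * X)) \<le> arcsine_density w * channel_info c t w"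
      using w by (intro mult_left_mono arcsine_density_nonneg) auto
    also have "arcsine_density w * (\<mu> * ?S w - (\<mu>\<^sup>2 / 2) * (real c * X)) = ?h w - l\<^sup>2 / (2 * real c) * arcsine_density w"
    proof -
      have d: "arcsine_density w = 1 / (pi * sqrt X)" by (simp add: arcsine_density_def X_def)
      have e1: "\<mu>\<^sup>2 * (real c * X) = l\<^sup>2 / real c" using X c by (simp add: \<mu>_def power_divide power_mult_distrib field_simps power2_eq_square)
      have e2: "arcsine_density w * \<mu> = l / (X * (pi * real c))"
      proof -
        have "sqrt X * sqrt X = X" using X by simp
        then show ?thesis unfolding d \<mu>_def by (simp add: mult_ac)
      qed
      have e3: "arcsine_density w * (\<mu> * S - (\<mu>\<^sup>2 / 2) * (real c * X))
        = (arcsine_density w * \<mu>) * S - arcsine_density w * (\<mu>\<^sup>2 * (real c * X)) / 2" for S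
        by (simp add: algebra_simps)
      show ?thesis unfolding X_def[symmetric] e3 e1 e2 by (simp add: mult_ac)
    qed
    finally show "?h w - l\<^sup>2 / (2 * real c) * arcsine_density w \<le> arcsine_density w * channel_info c t w" .
  next
    show "continuous_on {a..b} ?h"
      by (intro continuous_intros mean_deriv_continuous[OF ab(1,3), THEN continuous_on_mult_left, THEN continuous_on_divide]) (use c in auto)
  qed
  then show ?thesis by (simp add: diff_divide_distrib right_diff_distrib)
qed

text \<open>The linear bound is a concave quadratic in \<open>l\<close>; its maximiser is the
  increase of the mean output over pi times that of the distribution function.\<close>

lemma arcsine_weak:
  assumes v: "valid_channel c t" and ab: "0 < a" "a < b" "b < 1"
  shows "(mean_output c t b - mean_output c t a)\<^sup>2 \<le> 2 * pi\<^sup>2 * real c * arcsine_info c t * (arcsine_cdf b - arcsine_cdf a)"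
proof -
  define F where "F = arcsine_cdf b - arcsine_cdf a"
  define m where "m = mean_output c t b - mean_output c t a"
  have c: "0 < real c" using v by (simp add: valid_channel_def)
  have F: "0 < F" unfolding F_def arcsine_cdf_def using ab
    by (simp add: diff_divide_distrib[symmetric] arcsin_less_arcsin)
  have "(m / (pi * F)) * m / (pi * real c) - (m / (pi * F))\<^sup>2 / (2 * real c) * F \<le> arcsine_info c t"
    unfolding F_def m_def by (rule arcsine_weak_linear[OF v]) (use ab in auto)
  also have "(m / (pi * F)) * m / (pi * real c) - (m / (pi * F))\<^sup>2 / (2 * real c) * F = m\<^sup>2 / (2 * pi\<^sup>2 * real c * F)"
    using F c by (simp add: field_simps power2_eq_square)
  finally show ?thesis using F c by (simp add: divide_le_eq F_def m_def mult_ac)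
qed

lemma arcsine_info_nonneg: "valid_channel c t \<Longrightarrow> 0 \<le> arcsine_info c t"
  unfolding arcsine_info_lborel(2)
  by (intro Bochner_Integration.integral_nonneg)
    (auto simp: arcsine_density_nonneg channel_info_bounds split: split_indicator)

lemma mean_output_0_1: "valid_channel c t \<Longrightarrow> mean_output c t 0 = 0" "valid_channel c t \<Longrightarrow> mean_output c t 1 = 1"
proof -
  assume v: "valid_channel c t"
  have *: "Bernstein c z 0 * t z = 0" for z
    using v by (cases "z = 0") (auto simp: Bernstein_def valid_channel_def)
  show "mean_output c t 0 = 0" unfolding mean_output_def by (rule sum.neutral) (use * in blast)
  have "mean_output c t 1 = (\<Sum>z\<le>c. if z = c then 1 else 0)" unfolding mean_output_def using v
    by (intro sum.cong refl) (auto simp: Bernstein_def valid_channel_def)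
  then show "mean_output c t 1 = 1" by simp
qed

text \<open>The ends matter because the marking assumption fixes the mean output there. Both sides
  are continuous, so shrunken intervals suffice.\<close>

lemma arcsine_weak_closed:
  assumes v: "valid_channel c t" and ab: "0 \<le> a" "a < b" "b \<le> 1"
  shows "(mean_output c t b - mean_output c t a)\<^sup>2 \<le> 2 * pi\<^sup>2 * real c * arcsine_info c t * (arcsine_cdf b - arcsine_cdf a)"
proof -
  \<comment> \<open>A third of the length keeps \<open>a + r n < b - r n\<close> from the first
    index on.\<close>
  define r where "r = (\<lambda>n. (b - a) / 3 / real (Suc n))"
  have r0: "r \<longlonglongrightarrow> 0" unfolding r_def using tendsto_divide_0[OF tendsto_const filterlim_real_at_infinity_sequentially, of "(b-a)/3"]
    by (subst filterlim_sequentially_Suc)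
  have r: "0 < r n" "r n \<le> (b - a) / 3" for n
  proof -
    show "0 < r n" using ab by (simp add: r_def)
    have "r n \<le> (b - a) / 3 / 1" unfolding r_def using ab by (intro divide_left_mono) auto
    then show "r n \<le> (b - a) / 3" by simp
  qed
  have "a + r n \<in> {0..1}" "b - r n \<in> {0..1}" for n using r[of n] ab by auto
  then have in01: "\<forall>\<^sub>F n in sequentially. a + r n \<in> {0..1}" "\<forall>\<^sub>F n in sequentially. b - r n \<in> {0..1}"
    by (auto intro: always_eventually)
  have la: "(\<lambda>n. a + r n) \<longlonglongrightarrow> a" and lb: "(\<lambda>n. b - r n) \<longlonglongrightarrow> b"
    using tendsto_add[OF tendsto_const r0, of a] tendsto_diff[OF tendsto_const r0, of b] by auto
  have cm: "isCont (mean_output c t) x" for x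
    using continuous_mean_output[of UNIV c t] by (simp add: continuous_on_eq_continuous_at)
  show ?thesis
  proof (rule tendsto_le[OF sequentially_bot])
    show "(\<lambda>n. (mean_output c t (b - r n) - mean_output c t (a + r n))\<^sup>2) \<longlonglongrightarrow> (mean_output c t b - mean_output c t a)\<^sup>2"
      by (intro tendsto_intros isCont_tendsto_compose[OF cm] la lb)
    show "(\<lambda>n. 2 * pi\<^sup>2 * real c * arcsine_info c t * (arcsine_cdf (b - r n) - arcsine_cdf (a + r n)))
      \<longlonglongrightarrow> 2 * pi\<^sup>2 * real c * arcsine_info c t * (arcsine_cdf b - arcsine_cdf a)"
      by (intro tendsto_intros continuous_on_tendsto_compose[OF continuous_arcsine_cdf] la lb in01) (use ab in auto)
    show "\<forall>\<^sub>F n in sequentially. (mean_output c t (b - r n) - mean_output c t (a + r n))\<^sup>2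
      \<le> 2 * pi\<^sup>2 * real c * arcsine_info c t * (arcsine_cdf (b - r n) - arcsine_cdf (a + r n))"
    proof (rule always_eventually, rule allI)
      fix n show "(mean_output c t (b - r n) - mean_output c t (a + r n))\<^sup>2
      \<le> 2 * pi\<^sup>2 * real c * arcsine_info c t * (arcsine_cdf (b - r n) - arcsine_cdf (a + r n))"
        by (rule arcsine_weak[OF v]) (use r[of n] ab in auto)
    qed
  qed
qed

text \<open>Over the whole interval both the mean output and the distribution function increase by
  exactly 1. The value is below the asymptotic one by the factor pi^2, but it holds for every
  channel size.\<close>

lemma arcsine_info_weak_bound:
  assumes v: "valid_channel c t" shows "1 / (2 * pi\<^sup>2 * real c) \<le> arcsine_info c t"
proof -
  have c: "0 < real c" using v by (simp add: valid_channel_def)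
  have "1 \<le> 2 * pi\<^sup>2 * real c * arcsine_info c t"
    using arcsine_weak_closed[OF v, of 0 1] by (simp add: mean_output_0_1[OF v] arcsine_cdf_def)
  then show ?thesis using c by (simp add: divide_le_eq mult_ac)
qed

section \<open>Third-order errors and the sharp lower bound for large channels\<close>

lemma central_abs_moment3:
  assumes w: "0 < w" "w < 1" and c: "1 \<le> c"
  shows "(\<Sum>z\<le>c. Bernstein c z w * \<bar>real z - real c * w\<bar> ^ 3) \<le> 3 / 2 * (real c * sqrt (real c)) * (w * (1 - w))"
    and "central_moment 4 c w \<le> 2 * (real c)\<^sup>2 * (w * (1 - w))"
proof -
  define X where "X = w * (1 - w)"
  have X: "0 < X" "X \<le> 1/4" using w zero_le_power2[of "w - 1/2"] by (auto simp: X_def power2_eq_square algebra_simps)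
  have c1: "1 \<le> real c" using c by simp
  have "real c * (1 - 6 * X) + 3 * (real c)\<^sup>2 * X \<le> (real c)\<^sup>2 * 1 + 3 * (real c)\<^sup>2 * (1/4)"
  proof (intro add_mono)
    have "real c * (1 - 6 * X) \<le> real c * 1" using X by (intro mult_left_mono) auto
    also have "\<dots> \<le> (real c)\<^sup>2 * 1" using c1 by (simp add: power2_eq_square)
    finally show "real c * (1 - 6 * X) \<le> (real c)\<^sup>2 * 1" .
    show "3 * (real c)\<^sup>2 * X \<le> 3 * (real c)\<^sup>2 * (1/4)" using X by (intro mult_left_mono) auto
  qed
  also have "\<dots> \<le> 2 * (real c)\<^sup>2" by simp
  finally have "X * (real c * (1 - 6 * X) + 3 * (real c)\<^sup>2 * X) \<le> X * (2 * (real c)\<^sup>2)"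
    using X by (intro mult_left_mono) auto
  then show m4: "central_moment 4 c w \<le> 2 * (real c)\<^sup>2 * (w * (1 - w))"
    using central_moments(5)[OF w, of c] by (simp add: X_def[symmetric] mult_ac)
  define q where "q = sqrt (real c)"
  have q: "0 < q" "q * q = real c" using c1 by (auto simp: q_def)
  \<comment> \<open>AM-GM with weight \<open>q = sqrt c\<close>, which balances a second moment of
    order c against a fourth moment of order c^2.\<close>
  have cube: "\<bar>d\<bar> ^ 3 \<le> (q * d\<^sup>2 + d ^ 4 / q) / 2" for d :: real
  proof -
    have "0 \<le> d\<^sup>2 * (q - \<bar>d\<bar>)\<^sup>2" by simp
    also have "\<dots> = q\<^sup>2 * d\<^sup>2 - 2 * q * \<bar>d\<bar> ^ 3 + d ^ 4"
      by (simp add: power2_eq_square power3_eq_cube power4_eq_xxxx algebra_simps)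
    finally show ?thesis using q(1) by (simp add: field_simps power2_eq_square)
  qed
  have "(\<Sum>z\<le>c. Bernstein c z w * \<bar>real z - real c * w\<bar> ^ 3)
    \<le> (\<Sum>z\<le>c. Bernstein c z w * ((q * (real z - real c * w)\<^sup>2 + (real z - real c * w) ^ 4 / q) / 2))"
    using w by (intro sum_mono mult_left_mono cube Bernstein_nonneg) auto
  also have "\<dots> = (q * central_moment 2 c w + central_moment 4 c w / q) / 2"
    unfolding central_moment_def sum_distrib_left sum_divide_distrib sum.distrib[symmetric]
    by (intro sum.cong refl) (simp add: algebra_simps add_divide_distrib)
  also have "\<dots> \<le> (q * (real c * X) + 2 * (real c)\<^sup>2 * X / q) / 2"
    using m4 q by (intro divide_right_mono add_mono) (auto simp: central_moments[OF w] X_def divide_right_mono)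
  also have "\<dots> = 3 / 2 * (real c * q) * X"
    using q(1) unfolding q(2)[symmetric] by (simp add: field_simps power2_eq_square)
  finally show "(\<Sum>z\<le>c. Bernstein c z w * \<bar>real z - real c * w\<bar> ^ 3) \<le> 3 / 2 * (real c * sqrt (real c)) * (w * (1 - w))"
    by (simp add: q_def X_def)
qed

text \<open>As \<open>\<eta>\<close> tends to 0 the derivative of this function tends to \<open>1 / sqrt (p * (1 - p))\<close> and its total
  increase over the unit interval to \<open>pi\<close>; the shift by \<open>\<eta>\<close> keeps the test function bounded.\<close>

definition arc_scale :: "real \<Rightarrow> real \<Rightarrow> real" where
  "arc_scale \<eta> p = arcsin ((2 * p - 1) / (1 + 2 * \<eta>))"

lemma arc_scale_deriv:
  assumes "0 < \<eta>" "0 \<le> p" "p \<le> 1"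
  shows "(arc_scale \<eta> has_real_derivative 1 / sqrt ((p + \<eta>) * (1 + \<eta> - p))) (at p)"
proof -
  define r where "r = 1 + 2 * \<eta>"
  have r: "0 < r" using assms by (simp add: r_def)
  have a: "- 1 < (2 * p - 1) / r" "(2 * p - 1) / r < 1" using assms r by (auto simp: field_simps r_def)
  have "1 - ((2 * p - 1) / r)\<^sup>2 = 2\<^sup>2 * ((p + \<eta>) * (1 + \<eta> - p)) / r\<^sup>2"
  proof -
    have "1 - ((2 * p - 1) / r)\<^sup>2 = (r\<^sup>2 - (2 * p - 1)\<^sup>2) / r\<^sup>2"
      using r by (simp only: power_divide diff_divide_distrib[of "r\<^sup>2"]) simp
    also have "r\<^sup>2 - (2 * p - 1)\<^sup>2 = 2\<^sup>2 * ((p + \<eta>) * (1 + \<eta> - p))" by (simp add: r_def power2_eq_square algebra_simps)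
    finally show ?thesis .
  qed
  then have s: "sqrt (1 - ((2 * p - 1) / r)\<^sup>2) = 2 * sqrt ((p + \<eta>) * (1 + \<eta> - p)) / r"
    using r by (simp add: real_sqrt_mult real_sqrt_divide)
  have "(arc_scale \<eta> has_real_derivative inverse (sqrt (1 - ((2 * p - 1) / r)\<^sup>2)) * (2 / r)) (at p)"
    unfolding arc_scale_def r_def[symmetric] using a r by (auto intro!: derivative_eq_intros)
  moreover have "inverse (2 * A / r) * (2 / r) = 1 / A" for A :: real
    using r by (cases "A = 0") (auto simp: field_simps)
  ultimately show ?thesis unfolding s by simp
qed

lemma arc_scale_mono:
  assumes "0 < \<eta>" "0 \<le> p" "p \<le> q" "q \<le> 1" shows "arc_scale \<eta> p \<le> arc_scale \<eta> q"
  unfolding arc_scale_def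
proof (rule arcsin_le_arcsin)
  show "- 1 \<le> (2 * p - 1) / (1 + 2 * \<eta>)" "(2 * p - 1) / (1 + 2 * \<eta>) \<le> (2 * q - 1) / (1 + 2 * \<eta>)"
    "(2 * q - 1) / (1 + 2 * \<eta>) \<le> 1"
    using assms by (auto simp: le_divide_eq divide_le_eq intro!: divide_right_mono)
qed

text \<open>\<open>a\<close> and \<open>\<eta>\<close> bound the slope of the test function times
  the score, uniformly over channel sizes and attacks, so the cubic remainder is of order c^(-3/2).
  What is lost is the increase of \<open>arc_scale\<close> not covered between the mean outputs at
  \<open>a\<close> and \<open>1 - a\<close>.\<close>

lemma arcsine_sharp:
  assumes a: "0 < a" "a < 1/2" and \<eta>: "0 < \<eta>"
  shows "\<exists>C\<ge>0. \<forall>c t. valid_channel c t \<longrightarrow>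
    (arc_scale \<eta> (mean_output c t (1 - a)) - arc_scale \<eta> (mean_output c t a)) / (pi * real c)
      - 1 / (2 * real c) - C / (real c * sqrt (real c)) \<le> arcsine_info c t"
proof -
  define Y where "Y = a * (1 - a)"
  \<comment> \<open>Bound for slope times score: the score is at most \<open>c\<close> in absolute
    value, and the slope \<open>s\<close> below satisfies \<open>s * c = V / sqrt X\<close>.\<close>
  define T where "T = 1 / (sqrt \<eta> * sqrt Y)"
  define C where "C = exp T * (3 / 2) / (sqrt \<eta> ^ 3 * sqrt Y)"
  have Y: "0 < Y" using a by (simp add: Y_def)
  have C: "0 \<le> C" using Y \<eta> by (simp add: C_def)
  have "(arc_scale \<eta> (mean_output c t (1 - a)) - arc_scale \<eta> (mean_output c t a)) / (pi * real c)
      - 1 / (2 * real c) - C / (real c * sqrt (real c)) \<le> arcsine_info c t" if v: "valid_channel c t" for c t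
  proof -
    let ?m = "mean_output c t"
    let ?S = "\<lambda>w. (\<Sum>z\<le>c. Bernstein c z w * (t z - ?m w) * (real z - real c * w))"
    let ?v = "\<lambda>w. 1 / sqrt ((?m w + \<eta>) * (1 + \<eta> - ?m w))"
    let ?h = "\<lambda>w. ?v w * (?S w / (w * (1 - w))) / (pi * real c)"
    let ?\<kappa> = "1 / (2 * real c) + C / (real c * sqrt (real c))"
    have c: "1 \<le> c" "0 < real c" using v by (auto simp: valid_channel_def)
    have \<kappa>: "0 \<le> ?\<kappa>" using C c by simp
    have "(\<lambda>w. arc_scale \<eta> (?m w) / (pi * real c)) (1 - a) - (\<lambda>w. arc_scale \<eta> (?m w) / (pi * real c)) a
       - ?\<kappa> * (arcsine_cdf (1 - a) - arcsine_cdf a) \<le> arcsine_info c t"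
    proof (rule arcsine_info_ge[OF v, where h = ?h])
      show "0 < a" "a \<le> 1 - a" "1 - a < 1" using a by auto
      fix w assume aw: "a \<le> w" "w \<le> 1 - a"
      then have w: "0 < w" "w < 1" using a by auto
      have p: "0 < ?m w" "?m w < 1" using valid_mean_output[OF v w] by auto
      show "((\<lambda>w. arc_scale \<eta> (?m w) / (pi * real c)) has_real_derivative ?h w) (at w)"
        by (rule DERIV_cdivide, rule DERIV_chain2[OF arc_scale_deriv mean_output_deriv[OF w]]) (use \<eta> p in auto)
      define X where "X = w * (1 - w)"
      define q where "q = ?m w"
      define V where "V = ?v w"
      \<comment> \<open>Here the arcsine density cancels the weights: density times \<open>s\<close>
        times the covariance is the derivative of \<open>arc_scale\<close> of the mean output, over
        \<open>pi * c\<close>. The quadratic cost becomes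
        \<open>q * (1 - q) * V^2 / (2 * c)\<close>, which is at most
        \<open>1 / (2 * c)\<close>.\<close>
      define s where "s = V / (real c * sqrt X)"
      have X: "0 < X" "Y \<le> X"
      proof -
        show "0 < X" using w by (simp add: X_def)
        have "0 \<le> (w - a) * (1 - a - w)" using aw by simp
        then show "Y \<le> X" by (simp add: X_def Y_def algebra_simps)
      qed
      have pq: "0 < (q + \<eta>) * (1 + \<eta> - q)" "\<eta> \<le> (q + \<eta>) * (1 + \<eta> - q)" "q * (1 - q) \<le> (q + \<eta>) * (1 + \<eta> - q)"
      proof -
        have e: "(q + \<eta>) * (1 + \<eta> - q) = q * (1 - q) + \<eta> + \<eta>\<^sup>2" by (simp add: algebra_simps power2_eq_square)
        have "0 < q * (1 - q)" using p by (simp add: q_def)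
        then show "0 < (q + \<eta>) * (1 + \<eta> - q)" "\<eta> \<le> (q + \<eta>) * (1 + \<eta> - q)" "q * (1 - q) \<le> (q + \<eta>) * (1 + \<eta> - q)"
          unfolding e using \<eta> by (auto intro: add_pos_pos)
      qed
      have V: "0 < V" "V \<le> 1 / sqrt \<eta>" "q * (1 - q) * V\<^sup>2 \<le> 1"
      proof -
        show "0 < V" using pq by (simp add: V_def q_def)
        show "V \<le> 1 / sqrt \<eta>" using pq \<eta> by (simp add: V_def q_def field_simps)
        have "V\<^sup>2 = 1 / ((q + \<eta>) * (1 + \<eta> - q))" using pq by (simp add: V_def q_def power_divide)
        then show "q * (1 - q) * V\<^sup>2 \<le> 1" using pq by (simp add: divide_le_eq)
      qed
      have s: "0 < s" using V X c by (simp add: s_def)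
      have sT: "s * real c \<le> T"
      proof -
        have "s * real c = V / sqrt X" using c by (simp add: s_def)
        also have "\<dots> \<le> (1 / sqrt \<eta>) / sqrt Y" using V X Y \<eta> by (intro frac_le) auto
        finally show ?thesis by (simp add: T_def)
      qed
      define R where "R = (\<lambda>z. s ^ 3 * exp T * \<bar>real z - real c * w\<bar> ^ 3)"
      have "s * ?S w - (q * (1 - q) * s\<^sup>2 / 2) * (real c * X) - (\<Sum>z\<le>c. Bernstein c z w * R z) \<le> channel_info c t w"
        unfolding X_def
      proof (rule channel_info_cov_lower[OF v w])
        fix z assume z: "z \<le> c"
        define d where "d = s * (real z - real c * w)"
        have "\<bar>real z - real c * w\<bar> \<le> real c"
        proof -
          have "0 \<le> real c * w" "real c * w \<le> real c" using w c by (auto intro: mult_left_le)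
          moreover have "0 \<le> real z" "real z \<le> real c" using z by auto
          ultimately show ?thesis by linarith
        qed
        then have "s * \<bar>real z - real c * w\<bar> \<le> s * real c" using s by (intro mult_left_mono) auto
        then have "s * \<bar>real z - real c * w\<bar> \<le> T" using sT by linarith
        then have "\<bar>d\<bar> \<le> T" using s by (simp add: d_def abs_mult)
        then have "d * (t z - q) - q * (1 - q) * d\<^sup>2 / 2 - \<bar>d\<bar> ^ 3 * exp T \<le> bin_kl (t z) q"
          using v z p by (intro bin_kl_ge_taylor) (auto simp: valid_channel_def q_def)
        then show "s * (real z - real c * w) * (t z - ?m w) - q * (1 - q) * s\<^sup>2 / 2 * (real z - real c * w)\<^sup>2 - R z
          \<le> bin_kl (t z) (?m w)"
          using s by (simp add: d_def R_def q_def power_mult_distrib abs_mult mult_ac)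
      qed
      moreover have "(q * (1 - q) * s\<^sup>2 / 2) * (real c * X) \<le> 1 / (2 * real c)"
      proof -
        have "(q * (1 - q) * s\<^sup>2 / 2) * (real c * X) = (q * (1 - q) * V\<^sup>2) / (2 * real c)"
          using X c by (simp add: s_def power_divide power_mult_distrib field_simps power2_eq_square)
        also have "\<dots> \<le> 1 / (2 * real c)" using V c by (intro divide_right_mono) auto
        finally show ?thesis .
      qed
      moreover have "(\<Sum>z\<le>c. Bernstein c z w * R z) \<le> C / (real c * sqrt (real c))"
      proof -
        have "(\<Sum>z\<le>c. Bernstein c z w * R z) = s ^ 3 * exp T * (\<Sum>z\<le>c. Bernstein c z w * \<bar>real z - real c * w\<bar> ^ 3)"
          unfolding R_def sum_distrib_left by (intro sum.cong refl) (simp add: mult_ac)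
        also have "\<dots> \<le> s ^ 3 * exp T * (3 / 2 * (real c * sqrt (real c)) * X)"
          unfolding X_def using s by (intro mult_left_mono central_abs_moment3[OF w c(1)]) auto
        also have "\<dots> = exp T * (3 / 2) * (V ^ 3 / sqrt X) / (real c * sqrt (real c))"
        proof -
          define x y where "x = sqrt X" "y = sqrt (real c)"
          have xy: "0 < x" "0 < y" "X = x * x" "real c = y * y" using X c by (auto simp: x_y_def)
          have "sqrt X = x" "sqrt (real c) = y" by (simp_all add: x_y_def)
          then show ?thesis unfolding s_def xy(3,4) using xy(1,2)
            by (simp add: power_divide power_mult_distrib field_simps power3_eq_cube)
        qed
        also have "\<dots> \<le> exp T * (3 / 2) * ((1 / sqrt \<eta>) ^ 3 / sqrt Y) / (real c * sqrt (real c))"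
          using V X Y \<eta> c by (intro divide_right_mono mult_left_mono frac_le power_mono) auto
        also have "\<dots> = C / (real c * sqrt (real c))" by (simp add: C_def power_divide)
        finally show ?thesis .
      qed
      ultimately have "s * ?S w - ?\<kappa> \<le> channel_info c t w" by linarith
      then have "arcsine_density w * (s * ?S w - ?\<kappa>) \<le> arcsine_density w * channel_info c t w"
        using w by (intro mult_left_mono arcsine_density_nonneg) auto
      also have "arcsine_density w * (s * ?S w - ?\<kappa>) = (arcsine_density w * s) * ?S w - ?\<kappa> * arcsine_density w"
        by (simp add: algebra_simps)
      also have "arcsine_density w * s = V / (X * (pi * real c))"
      proof -
        have "sqrt X * sqrt X = X" using X by simp
        then show ?thesis unfolding arcsine_density_def s_def X_def[symmetric] by (simp add: mult_ac)
      qed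
      also have "V / (X * (pi * real c)) * ?S w = ?h w" by (simp add: V_def X_def)
      finally show "?h w - ?\<kappa> * arcsine_density w \<le> arcsine_density w * channel_info c t w" .
    next
      have m: "0 < (?m w + \<eta>) * (1 + \<eta> - ?m w)" if "w \<in> {a..1 - a}" for w
        using valid_mean_output[OF v, of w] that a \<eta> by (intro mult_pos_pos) auto
      have S: "continuous_on {a..1 - a} (\<lambda>w. ?S w / (w * (1 - w)))"
        by (rule mean_deriv_continuous) (use a in auto)
      show "continuous_on {a..1 - a} ?h"
        by (intro continuous_on_divide continuous_on_mult S continuous_on_real_sqrt continuous_on_const
            continuous_on_add continuous_on_diff continuous_mean_output) (use m c in \<open>force simp: less_imp_neq\<close>)+
    qed
    moreover have "?\<kappa> * (arcsine_cdf (1 - a) - arcsine_cdf a) \<le> ?\<kappa> * 1"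
    proof (rule mult_left_mono[OF _ \<kappa>])
      have "arcsin (2 * (1 - a) - 1) \<le> pi / 2" "- (pi / 2) \<le> arcsin (2 * a - 1)"
        using arcsin_bounded[of "2 * (1 - a) - 1"] arcsin_bounded[of "2 * a - 1"] a by auto
      then have "(arcsin (2 * (1 - a) - 1) - arcsin (2 * a - 1)) / pi \<le> pi / pi"
        by (intro divide_right_mono) auto
      then show "arcsine_cdf (1 - a) - arcsine_cdf a \<le> 1" by (simp add: arcsine_cdf_def diff_divide_distrib)
    qed
    ultimately show ?thesis by (simp add: diff_divide_distrib)
  qed
  then show ?thesis using C by blast
qed

text \<open>Argued by contradiction, because it is small information that makes the weak inequality
  strong: it pins the mean outputs at \<open>a\<close> and \<open>1 - a\<close> to within
  \<open>\<eta>\<close> of 0 and 1, and then the sharp bound gives the claim.\<close>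

theorem arcsine_info_asymptotic:
  assumes \<epsilon>: "0 < \<epsilon>"
  shows "\<exists>c0\<ge>1. \<forall>c\<ge>c0. \<forall>t. valid_channel c t \<longrightarrow> (1 - \<epsilon>) / (2 * real c) \<le> arcsine_info c t"
proof -
  \<comment> \<open>Between \<open>\<eta>\<close> and \<open>1 - \<eta>\<close> the function
    \<open>arc_scale \<eta>\<close> increases by twice this arcsine, which tends to pi.\<close>
  obtain \<eta> :: real where \<eta>: "0 < \<eta>" "\<eta> < 1/2" "pi / 2 * (1 - \<epsilon> / 4) \<le> arcsin ((1 - 2 * \<eta>) / (1 + 2 * \<eta>))"
  proof -
    have "((\<lambda>\<eta>::real. arcsin ((1 - 2 * \<eta>) / (1 + 2 * \<eta>))) \<longlongrightarrow> arcsin ((1 - 2 * 0) / (1 + 2 * 0))) (at_right 0)"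
    proof (rule continuous_on_tendsto_compose[OF continuous_on_arcsin'])
      show "((\<lambda>\<eta>::real. (1 - 2 * \<eta>) / (1 + 2 * \<eta>)) \<longlongrightarrow> (1 - 2 * 0) / (1 + 2 * 0)) (at_right 0)"
        by (intro tendsto_intros) auto
      show "\<forall>\<^sub>F \<eta> in at_right 0. (1 - 2 * \<eta>) / (1 + 2 * \<eta>) \<in> {- 1..1::real}"
        using eventually_at_right_less[of "0::real"]
        by eventually_elim (auto simp: field_simps)
    qed auto
    moreover have "pi / 2 * (1 - \<epsilon> / 4) < arcsin ((1 - 2 * 0) / (1 + 2 * 0))" using \<epsilon> pi_gt_zero by simp
    ultimately have "\<forall>\<^sub>F \<eta> in at_right 0. pi / 2 * (1 - \<epsilon> / 4) < arcsin ((1 - 2 * \<eta>) / (1 + 2 * \<eta>))"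
      by (rule order_tendstoD)
    moreover have "\<forall>\<^sub>F \<eta> in at_right 0. \<eta> \<in> {0<..<1/2::real}" by (rule eventually_at_right_real) simp
    ultimately have "\<forall>\<^sub>F \<eta> in at_right 0. 0 < \<eta> \<and> \<eta> < 1/2 \<and> pi / 2 * (1 - \<epsilon> / 4) \<le> arcsin ((1 - 2 * \<eta>) / (1 + 2 * \<eta>))"
      by eventually_elim auto
    then show thesis using eventually_happens'[of "at_right (0::real)"] that by (auto simp: trivial_limit_at_right_real)
  qed
  \<comment> \<open>With information at most \<open>1 / (2 * c)\<close> the weak inequality says
    that the squared increase of the mean output over \<open>{0..a}\<close> is at most pi^2 times
    the arcsine mass of that interval.\<close>
  obtain a :: real where a: "0 < a" "a < 1/2" "pi\<^sup>2 * (arcsine_cdf a - arcsine_cdf 0) \<le> \<eta>\<^sup>2"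
  proof -
    have "(arcsine_cdf \<longlongrightarrow> arcsine_cdf 0) (at_right 0)"
      using continuous_arcsine_cdf by (simp add: continuous_on_Icc_at_rightD)
    then have "((\<lambda>a. pi\<^sup>2 * (arcsine_cdf a - arcsine_cdf 0)) \<longlongrightarrow> pi\<^sup>2 * (arcsine_cdf 0 - arcsine_cdf 0)) (at_right 0)"
      by (intro tendsto_intros)
    then have "\<forall>\<^sub>F a in at_right 0. pi\<^sup>2 * (arcsine_cdf a - arcsine_cdf 0) < \<eta>\<^sup>2"
      by (rule order_tendstoD) (use \<eta> in auto)
    moreover have "\<forall>\<^sub>F a in at_right 0. a \<in> {0<..<1/2::real}" by (rule eventually_at_right_real) simp
    ultimately have "\<forall>\<^sub>F a in at_right 0. 0 < a \<and> a < 1/2 \<and> pi\<^sup>2 * (arcsine_cdf a - arcsine_cdf 0) \<le> \<eta>\<^sup>2"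
      by eventually_elim auto
    then show thesis using eventually_happens'[of "at_right (0::real)"] that by (auto simp: trivial_limit_at_right_real)
  qed
  have sym: "arcsine_cdf 1 - arcsine_cdf (1 - a) = arcsine_cdf a - arcsine_cdf 0"
    using arcsin_minus[of "2 * a - 1"] a by (simp add: arcsine_cdf_def)
  obtain C where C: "0 \<le> C" "\<And>c t. valid_channel c t \<Longrightarrow>
    (arc_scale \<eta> (mean_output c t (1 - a)) - arc_scale \<eta> (mean_output c t a)) / (pi * real c)
      - 1 / (2 * real c) - C / (real c * sqrt (real c)) \<le> arcsine_info c t"
    using arcsine_sharp[OF a(1,2) \<eta>(1)] by blast
  \<comment> \<open>Makes \<open>C / sqrt c\<close> at most \<open>\<epsilon> / 4\<close>. With the
    loss \<open>\<epsilon> / 4\<close> in the increase of \<open>arc_scale\<close> this uses up the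
    allowed \<open>\<epsilon> / 2\<close>, all relative to \<open>1 / c\<close>.\<close>
  define c0 where "c0 = Suc (nat \<lceil>(4 * C / \<epsilon>)\<^sup>2\<rceil>)"
  have "(1 - \<epsilon>) / (2 * real c) \<le> arcsine_info c t" if c: "c0 \<le> c" and v: "valid_channel c t" for c t
  proof (rule ccontr)
    assume "\<not> (1 - \<epsilon>) / (2 * real c) \<le> arcsine_info c t"
    then have lt: "arcsine_info c t < (1 - \<epsilon>) / (2 * real c)" by simp
    have c1: "0 < real c" using v by (simp add: valid_channel_def)
    have "(1 - \<epsilon>) / (2 * real c) \<le> 1 / (2 * real c)" using c1 \<epsilon> by (intro divide_right_mono) auto
    then have "arcsine_info c t \<le> 1 / (2 * real c)" using lt by linarith
    then have I: "2 * real c * arcsine_info c t \<le> 1" using c1 by (simp add: field_simps)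
    let ?m = "mean_output c t"
    have bound: "x \<le> \<eta>" if "x\<^sup>2 \<le> 2 * pi\<^sup>2 * real c * arcsine_info c t * (arcsine_cdf a - arcsine_cdf 0)" for x
    proof (rule power2_le_imp_le)
      have "arcsine_cdf 0 \<le> arcsine_cdf a" unfolding arcsine_cdf_def using a
        by (intro divide_right_mono arcsin_le_arcsin) auto
      then have "2 * real c * arcsine_info c t * (pi\<^sup>2 * (arcsine_cdf a - arcsine_cdf 0)) \<le> 1 * (pi\<^sup>2 * (arcsine_cdf a - arcsine_cdf 0))"
        using I by (intro mult_right_mono) auto
      then show "x\<^sup>2 \<le> \<eta>\<^sup>2" using that a(3) by (simp add: mult_ac)
    qed (use \<eta> in simp)
    have ma: "?m a \<le> \<eta>"
      using arcsine_weak_closed[OF v, of 0 a] a by (intro bound) (simp add: mean_output_0_1[OF v])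
    have "1 - ?m (1 - a) \<le> \<eta>"
      using arcsine_weak_closed[OF v, of "1 - a" 1] a sym by (intro bound) (simp add: mean_output_0_1[OF v])
    then have mb: "1 - \<eta> \<le> ?m (1 - a)" by simp
    have "arc_scale \<eta> (1 - \<eta>) \<le> arc_scale \<eta> (?m (1 - a))" "arc_scale \<eta> (?m a) \<le> arc_scale \<eta> \<eta>"
      using ma mb \<eta> valid_mean_output[OF v, of a] valid_mean_output[OF v, of "1 - a"] a
      by (auto intro!: arc_scale_mono)
    moreover have "arc_scale \<eta> (1 - \<eta>) = arcsin ((1 - 2 * \<eta>) / (1 + 2 * \<eta>))" by (simp add: arc_scale_def algebra_simps)
    moreover have "arc_scale \<eta> \<eta> = - arcsin ((1 - 2 * \<eta>) / (1 + 2 * \<eta>))"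
    proof -
      have "(2 * \<eta> - 1) / (1 + 2 * \<eta>) = - ((1 - 2 * \<eta>) / (1 + 2 * \<eta>))" by (simp add: minus_divide_left)
      then show ?thesis unfolding arc_scale_def using \<eta> by (simp only:) (intro arcsin_minus; simp add: field_simps)
    qed
    ultimately have "pi * (1 - \<epsilon> / 4) \<le> arc_scale \<eta> (?m (1 - a)) - arc_scale \<eta> (?m a)" using \<eta>(3) by linarith
    then have "pi * (1 - \<epsilon> / 4) / (pi * real c) \<le> (arc_scale \<eta> (?m (1 - a)) - arc_scale \<eta> (?m a)) / (pi * real c)"
      using c1 by (intro divide_right_mono) auto
    then have 1: "(1 - \<epsilon> / 4) / real c - 1 / (2 * real c) - C / (real c * sqrt (real c)) \<le> arcsine_info c t"
      using C(2)[OF v] by simp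
    have "C / sqrt (real c) \<le> \<epsilon> / 4"
    proof -
      have "(4 * C / \<epsilon>)\<^sup>2 \<le> real c" using c unfolding c0_def by linarith
      then have "4 * C / \<epsilon> \<le> sqrt (real c)" by (rule real_le_rsqrt)
      then show ?thesis using c1 \<epsilon> by (simp add: field_simps)
    qed
    then have "C / sqrt (real c) / real c \<le> \<epsilon> / 4 / real c" using c1 by (intro divide_right_mono) auto
    then have "C / (real c * sqrt (real c)) \<le> \<epsilon> / 4 / real c" by (simp add: mult.commute)
    then have "(1 - \<epsilon> / 4) / real c - 1 / (2 * real c) - \<epsilon> / 4 / real c \<le> arcsine_info c t" using 1 by linarith
    moreover have "(1 - \<epsilon> / 4) / real c - 1 / (2 * real c) - \<epsilon> / 4 / real c = (1 - \<epsilon>) / (2 * real c)"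
      using c1 by (simp add: field_simps)
    ultimately show False using lt by linarith
  qed
  moreover have "1 \<le> c0" by (simp add: c0_def)
  ultimately show ?thesis by blast
qed

section \<open>Upper bounds from local regularity of the attack\<close>

lemma relative_moments:
  assumes w: "0 < w" "w < 1" and c: "1 \<le> c"
  shows "(\<Sum>z\<le>c. Bernstein c z w * (real z / real c - w)\<^sup>2) = w * (1 - w) / real c"
    and "(\<Sum>z\<le>c. Bernstein c z w * (real z / real c - w) ^ 4) \<le> 2 * (w * (1 - w)) / (real c)\<^sup>2"
    and "(\<Sum>z\<le>c. Bernstein c z w * \<bar>real z / real c - w\<bar> ^ 3) \<le> 3 / 2 * (w * (1 - w)) / (real c * sqrt (real c))"
proof -
  have c1: "0 < real c" using c by simp
  have e: "real z / real c - w = (real z - real c * w) / real c" for z using c1 by (simp add: field_simps)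
  have "(\<Sum>z\<le>c. Bernstein c z w * (real z / real c - w) ^ m) = central_moment m c w / real c ^ m" for m
    unfolding e central_moment_def sum_divide_distrib by (intro sum.cong refl) (simp add: power_divide)
  note m = this
  show "(\<Sum>z\<le>c. Bernstein c z w * (real z / real c - w)\<^sup>2) = w * (1 - w) / real c"
    unfolding m central_moments(3)[OF w] using c1 by (simp add: power2_eq_square)
  have "central_moment 4 c w / real c ^ 4 \<le> 2 * (real c)\<^sup>2 * (w * (1 - w)) / real c ^ 4"
    using central_abs_moment3(2)[OF w c] by (intro divide_right_mono) auto
  also have "\<dots> = 2 * (w * (1 - w)) / (real c)\<^sup>2" using c1 by (simp add: field_simps power2_eq_square power4_eq_xxxx)
  finally show "(\<Sum>z\<le>c. Bernstein c z w * (real z / real c - w) ^ 4) \<le> 2 * (w * (1 - w)) / (real c)\<^sup>2"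
    unfolding m .
  have "(\<Sum>z\<le>c. Bernstein c z w * \<bar>real z / real c - w\<bar> ^ 3) = (\<Sum>z\<le>c. Bernstein c z w * \<bar>real z - real c * w\<bar> ^ 3) / real c ^ 3"
    unfolding e sum_divide_distrib using c1 by (intro sum.cong refl) (simp add: power_divide)
  also have "\<dots> \<le> 3 / 2 * (real c * sqrt (real c)) * (w * (1 - w)) / real c ^ 3"
    using central_abs_moment3(1)[OF w c] by (intro divide_right_mono) auto
  also have "\<dots> = 3 / 2 * (w * (1 - w)) / (real c * sqrt (real c))"
  proof -
    define y where "y = sqrt (real c)"
    have y: "0 < y" "real c = y * y" using c1 by (auto simp: y_def)
    have "sqrt (real c) = y" by (simp add: y_def)
    then show ?thesis unfolding y(2) using y(1) by (simp add: field_simps power3_eq_cube)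
  qed
  finally show "(\<Sum>z\<le>c. Bernstein c z w * \<bar>real z / real c - w\<bar> ^ 3) \<le> 3 / 2 * (w * (1 - w)) / (real c * sqrt (real c))" .
qed

text \<open>\<open>M\<close> stands for a squared slope near \<open>w\<close>, and \<open>q\<close>
  for the reference output. The quartic term accounts for counts far from \<open>c * w\<close>:
  beyond a relative distance r the trivial bound 1 is majorised with \<open>K = 1 / r ^ 4\<close>,
  and the fourth moment makes this contribution of order c^(-2).\<close>

context
  fixes c :: nat and t :: "nat \<Rightarrow> real" and w q M K :: real
  assumes v: "valid_channel c t" and w: "0 < w" "w < 1" and q: "0 < q" "q < 1" and MK: "0 \<le> M" "0 \<le> K"
    and loc: "\<And>z. z \<le> c \<Longrightarrow> (t z - q)\<^sup>2 \<le> M * (real z / real c - w)\<^sup>2 + K * (real z / real c - w) ^ 4"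
begin

private lemma c_pos: "1 \<le> c" "0 < real c" using v by (auto simp: valid_channel_def)
private lemma B_nonneg: "0 \<le> Bernstein c z w" using w by (intro Bernstein_nonneg) auto
private lemma t_bounds: "z \<le> c \<Longrightarrow> 0 \<le> t z" "z \<le> c \<Longrightarrow> t z \<le> 1" using v by (auto simp: valid_channel_def)
private lemma q_pos: "0 < q * (1 - q)" using q by simp

private lemma local_variance: "(\<Sum>z\<le>c. Bernstein c z w * (t z - q)\<^sup>2)
    \<le> M * (w * (1 - w)) / real c + K * (2 * (w * (1 - w)) / (real c)\<^sup>2)"
proof -
  have "(\<Sum>z\<le>c. Bernstein c z w * (t z - q)\<^sup>2)
    \<le> (\<Sum>z\<le>c. Bernstein c z w * (M * (real z / real c - w)\<^sup>2 + K * (real z / real c - w) ^ 4))"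
    by (intro sum_mono mult_left_mono loc B_nonneg) auto
  also have "\<dots> = M * (\<Sum>z\<le>c. Bernstein c z w * (real z / real c - w)\<^sup>2) + K * (\<Sum>z\<le>c. Bernstein c z w * (real z / real c - w) ^ 4)"
    unfolding sum_distrib_left sum.distrib[symmetric] by (intro sum.cong refl) (simp add: algebra_simps)
  also have "\<dots> \<le> M * (w * (1 - w) / real c) + K * (2 * (w * (1 - w)) / (real c)\<^sup>2)"
    unfolding relative_moments(1)[OF w c_pos(1)] using MK
    by (intro add_left_mono mult_left_mono relative_moments(2)[OF w c_pos(1)]) auto
  finally show ?thesis by simp
qed

text \<open>Only the ratio of input to output variance enters, hence it is usable up to the ends of
  the unit interval, at the price of a factor 2 in the leading term.\<close>

lemma channel_info_chi2:
  "channel_info c t w \<le> (M * (w * (1 - w)) / real c + K * (2 * (w * (1 - w)) / (real c)\<^sup>2)) / (q * (1 - q))"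
proof -
  have "channel_info c t w \<le> (\<Sum>z\<le>c. Bernstein c z w * bin_kl (t z) q)"
    by (rule channel_info_le_reference[OF v w q])
  also have "\<dots> \<le> (\<Sum>z\<le>c. Bernstein c z w * ((t z - q)\<^sup>2 / (q * (1 - q))))"
    using t_bounds q by (intro sum_mono mult_left_mono bin_kl_chi2 B_nonneg) auto
  also have "\<dots> = (\<Sum>z\<le>c. Bernstein c z w * (t z - q)\<^sup>2) / (q * (1 - q))"
    by (simp add: sum_divide_distrib)
  also have "\<dots> \<le> (M * (w * (1 - w)) / real c + K * (2 * (w * (1 - w)) / (real c)\<^sup>2)) / (q * (1 - q))"
    using local_variance q_pos by (intro divide_right_mono) auto
  finally show ?thesis .
qed

text \<open>Sharp to leading order while \<open>q\<close> stays away from 0 and 1. The cubic term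
  needs only a Lipschitz bound; as relative distances are at most 1, \<open>K\<close> is merged into
  the squared slope there.\<close>

lemma channel_info_taylor:
  "channel_info c t w \<le> (M * (w * (1 - w)) / real c + K * (2 * (w * (1 - w)) / (real c)\<^sup>2)) / (2 * (q * (1 - q)))
     + sqrt (M + K) ^ 3 * (1 / (2 * q\<^sup>2) + 1 / (2 * (1 - q)\<^sup>2)) * (3 / 2 * (w * (1 - w)) / (real c * sqrt (real c)))"
proof -
  let ?Q = "1 / (2 * q\<^sup>2) + 1 / (2 * (1 - q)\<^sup>2)"
  have cube: "\<bar>t z - q\<bar> ^ 3 \<le> sqrt (M + K) ^ 3 * \<bar>real z / real c - w\<bar> ^ 3" if z: "z \<le> c" for z
  proof -
    define d where "d = real z / real c - w"
    have "0 \<le> real z / real c" "real z / real c \<le> 1" using z c_pos by auto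
    then have d: "\<bar>d\<bar> \<le> 1" using w unfolding d_def by linarith
    then have "d\<^sup>2 \<le> 1" by (simp add: abs_square_le_1)
    then have "d\<^sup>2 * d\<^sup>2 \<le> d\<^sup>2 * 1" by (intro mult_left_mono) auto
    then have "d ^ 4 \<le> d\<^sup>2" by (simp add: power2_eq_square power4_eq_xxxx mult.assoc)
    then have "K * d ^ 4 \<le> K * d\<^sup>2" using MK by (intro mult_left_mono) auto
    then have "(t z - q)\<^sup>2 \<le> (M + K) * d\<^sup>2" using loc[OF z] by (simp add: d_def distrib_right)
    then have "sqrt ((t z - q)\<^sup>2) \<le> sqrt ((M + K) * d\<^sup>2)" by (rule real_sqrt_le_mono)
    then have "\<bar>t z - q\<bar> \<le> sqrt (M + K) * \<bar>d\<bar>" by (simp add: real_sqrt_mult)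
    then have "\<bar>t z - q\<bar> ^ 3 \<le> (sqrt (M + K) * \<bar>d\<bar>) ^ 3" by (intro power_mono) auto
    then show ?thesis by (simp add: d_def power_mult_distrib)
  qed
  have Q: "0 \<le> ?Q" by simp
  have "channel_info c t w \<le> (\<Sum>z\<le>c. Bernstein c z w * bin_kl (t z) q)"
    by (rule channel_info_le_reference[OF v w q])
  also have "\<dots> \<le> (\<Sum>z\<le>c. Bernstein c z w * ((t z - q)\<^sup>2 / (2 * (q * (1 - q))) + sqrt (M + K) ^ 3 * \<bar>real z / real c - w\<bar> ^ 3 * ?Q))"
  proof (intro sum_mono mult_left_mono B_nonneg)
    fix z assume "z \<in> {..c}"
    then have z: "z \<le> c" by simp
    have "bin_kl (t z) q \<le> (t z - q)\<^sup>2 / (2 * (q * (1 - q))) + \<bar>t z - q\<bar> ^ 3 * ?Q"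
      using t_bounds[OF z] q by (rule bin_kl_le_taylor)
    also have "\<dots> \<le> (t z - q)\<^sup>2 / (2 * (q * (1 - q))) + sqrt (M + K) ^ 3 * \<bar>real z / real c - w\<bar> ^ 3 * ?Q"
      by (intro add_left_mono mult_right_mono cube[OF z] Q)
    finally show "bin_kl (t z) q \<le> (t z - q)\<^sup>2 / (2 * (q * (1 - q))) + sqrt (M + K) ^ 3 * \<bar>real z / real c - w\<bar> ^ 3 * ?Q" .
  qed
  also have "\<dots> = (\<Sum>z\<le>c. Bernstein c z w * (t z - q)\<^sup>2) / (2 * (q * (1 - q)))
     + sqrt (M + K) ^ 3 * ?Q * (\<Sum>z\<le>c. Bernstein c z w * \<bar>real z / real c - w\<bar> ^ 3)"
    unfolding sum_divide_distrib sum_distrib_left sum.distrib[symmetric]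
    by (intro sum.cong refl) (simp add: distrib_left mult_ac)
  also have "\<dots> \<le> (M * (w * (1 - w)) / real c + K * (2 * (w * (1 - w)) / (real c)\<^sup>2)) / (2 * (q * (1 - q)))
     + sqrt (M + K) ^ 3 * ?Q * (3 / 2 * (w * (1 - w)) / (real c * sqrt (real c)))"
    using local_variance q Q MK
    by (intro add_mono divide_right_mono mult_left_mono relative_moments(3)[OF w c_pos(1)] mult_nonneg_nonneg) auto
  finally show ?thesis .
qed

end

section \<open>Interleaving against a fixed tracer\<close>

lemma valid_interleaving: "1 \<le> c \<Longrightarrow> valid_channel c (\<lambda>z. real z / real c)"
  by (auto simp: valid_channel_def)

text \<open>With reference \<open>w\<close>, \<open>M = 1\<close> and \<open>K = 0\<close> input and
  output variances cancel. The first bound is the dominating constant for the integral over the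
  bias, the second gives the pointwise limit.\<close>

lemma interleaving_bounds:
  assumes w: "0 < w" "w < 1" and c: "1 \<le> c"
  shows "real c * channel_info c (\<lambda>z. real z / real c) w \<le> 1"
    and "real c * channel_info c (\<lambda>z. real z / real c) w
      \<le> 1 / 2 + (1 / (2 * w\<^sup>2) + 1 / (2 * (1 - w)\<^sup>2)) * (3 / 2 * (w * (1 - w))) / sqrt (real c)"
proof -
  have c1: "0 < real c" using c by simp
  have X: "0 < w * (1 - w)" using w by simp
  have "channel_info c (\<lambda>z. real z / real c) w \<le> (1 * (w * (1 - w)) / real c + 0 * (2 * (w * (1 - w)) / (real c)\<^sup>2)) / (w * (1 - w))"
    by (rule channel_info_chi2[OF valid_interleaving[OF c] w w]) auto
  also have "\<dots> = 1 / real c" using w by simp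
  finally have "real c * channel_info c (\<lambda>z. real z / real c) w \<le> real c * (1 / real c)" using c1 by (intro mult_left_mono) auto
  then show "real c * channel_info c (\<lambda>z. real z / real c) w \<le> 1" using c1 by simp
  let ?Q = "1 / (2 * w\<^sup>2) + 1 / (2 * (1 - w)\<^sup>2)"
  have "channel_info c (\<lambda>z. real z / real c) w \<le> (1 * (w * (1 - w)) / real c + 0 * (2 * (w * (1 - w)) / (real c)\<^sup>2)) / (2 * (w * (1 - w)))
    + sqrt (1 + 0) ^ 3 * ?Q * (3 / 2 * (w * (1 - w)) / (real c * sqrt (real c)))"
    by (rule channel_info_taylor[OF valid_interleaving[OF c] w w]) auto
  also have "\<dots> = (1 / 2 + ?Q * (3 / 2 * (w * (1 - w))) / sqrt (real c)) / real c"
  proof -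
    have "(1 * (w * (1 - w)) / real c + 0 * (2 * (w * (1 - w)) / (real c)\<^sup>2)) / (2 * (w * (1 - w))) = 1 / 2 / real c"
    proof -
      have "(1 * Y / r + 0) / (2 * Y) = 1 / 2 / r" if "0 < Y" for Y r :: real
        using that by simp
      from this[OF X] show ?thesis by simp
    qed
    then show ?thesis by (simp add: add_divide_distrib mult_ac)
  qed
  finally have "real c * channel_info c (\<lambda>z. real z / real c) w \<le> real c * ((1 / 2 + ?Q * (3 / 2 * (w * (1 - w))) / sqrt (real c)) / real c)"
    using c1 by (intro mult_left_mono) auto
  then show "real c * channel_info c (\<lambda>z. real z / real c) w \<le> 1 / 2 + ?Q * (3 / 2 * (w * (1 - w))) / sqrt (real c)"
    using c1 by simp
qed

theorem interleaving_asymptotic: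
  assumes f: "bias_density f" and e: "0 < \<epsilon>"
  shows "\<forall>\<^sub>F n in sequentially. real n * (\<integral>w. channel_info n (\<lambda>z. real z / real n) w \<partial>bias_law f) \<le> 1 / 2 + \<epsilon>"
proof -
  interpret prob_space "bias_law f" by (rule prob_space_bias_law[OF f])
  define h where "h = (\<lambda>n w. real n * channel_info n (\<lambda>z. real z / real n) w)"
  have hm [measurable]: "h n \<in> borel_measurable (bias_law f)" for n unfolding h_def[abs_def] by simp
  have AE01: "AE w in bias_law f. 0 < w \<and> w < 1" by (rule AE_bias_law[OF f])
  \<comment> \<open>Pointwise only an upper bound tends to 1/2. The maximum with 1/2 is squeezed
    into convergence, so that dominated convergence applies to it.\<close>
  have lim: "(\<lambda>n. \<integral>w. max (h n w) (1/2) \<partial>bias_law f) \<longlonglongrightarrow> (\<integral>w. 1/2 \<partial>bias_law f)"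
  proof (rule integral_dominated_convergence[where w = "\<lambda>_. 1"])
    show "AE w in bias_law f. (\<lambda>n. max (h n w) (1/2)) \<longlonglongrightarrow> 1/2"
      using AE01
    proof eventually_elim
      case (elim w)
      let ?A = "(1 / (2 * w\<^sup>2) + 1 / (2 * (1 - w)\<^sup>2)) * (3 / 2 * (w * (1 - w)))"
      have "(\<lambda>n. 1 / 2 + ?A / sqrt (real n)) \<longlonglongrightarrow> 1 / 2 + 0"
        by (intro tendsto_add tendsto_const tendsto_divide_0[OF tendsto_const]
            filterlim_at_top_imp_at_infinity filterlim_compose[OF sqrt_at_top filterlim_real_sequentially])
      then have u: "(\<lambda>n. 1 / 2 + ?A / sqrt (real n)) \<longlonglongrightarrow> 1 / 2" by simp
      show "(\<lambda>n. max (h n w) (1/2)) \<longlonglongrightarrow> 1/2"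
      proof (rule tendsto_sandwich[OF _ _ tendsto_const u])
        show "\<forall>\<^sub>F n in sequentially. max (h n w) (1/2) \<le> 1 / 2 + ?A / sqrt (real n)"
          using eventually_ge_at_top[of "1::nat"]
        proof eventually_elim
          case (elim n)
          have "0 \<le> ?A / sqrt (real n)" using \<open>0 < w \<and> w < 1\<close> by simp
          then show ?case using interleaving_bounds(2)[of w n] elim \<open>0 < w \<and> w < 1\<close> by (simp add: h_def)
        qed
      qed simp
    qed
    show "AE w in bias_law f. norm (max (h n w) (1/2)) \<le> 1" for n
      using AE01
    proof eventually_elim
      case (elim w)
      have "h n w \<le> 1" using interleaving_bounds(1)[of w n] elim by (cases "n = 0") (auto simp: h_def)
      then show ?case by (simp add: max_def)
    qed
  qed auto
  have "(\<integral>w. 1/2 \<partial>bias_law f) < 1/2 + \<epsilon>" using e by (simp add: prob_space)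
  with lim have "\<forall>\<^sub>F n in sequentially. (\<integral>w. max (h n w) (1/2) \<partial>bias_law f) < 1/2 + \<epsilon>"
    by (rule order_tendstoD)
  then show ?thesis
    using eventually_ge_at_top[of "1::nat"]
  proof eventually_elim
    case (elim n)
    have b: "AE w in bias_law f. 0 \<le> h n w \<and> h n w \<le> 1"
      using AE01
    proof eventually_elim
      case (elim w)
      then show ?case using interleaving_bounds(1)[of w n] \<open>1 \<le> n\<close>
          channel_info_bounds(1)[OF valid_interleaving[OF \<open>1 \<le> n\<close>], of w] by (simp add: h_def)
    qed
    have "(\<integral>w. h n w \<partial>bias_law f) \<le> (\<integral>w. max (h n w) (1/2) \<partial>bias_law f)"
    proof (rule integral_mono_AE)
      show "integrable (bias_law f) (h n)" using b by (intro integrable_const_bound[where B = 1]) auto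
      show "integrable (bias_law f) (\<lambda>w. max (h n w) (1/2))" using b by (intro integrable_const_bound[where B = 1]) (auto elim!: eventually_mono)
    qed simp
    then show ?case using elim by (simp add: h_def)
  qed
qed

section \<open>The flattened attack, good against all tracers at once\<close>

text \<open>For \<open>g = logit_power \<gamma>\<close> one has \<open>x * (1 - x) * g' x = \<gamma> * g x * (1 - g x)\<close>, and
  \<open>g x * (1 - g x) \<le> x * (1 - x)\<close> because \<open>g\<close> moves away from \<open>1/2\<close>. Hence the leading coefficient
  \<open>x * (1 - x) * (g' x)\<^sup>2 / (g x * (1 - g x))\<close> is at most \<open>\<gamma>\<^sup>2\<close>. Clipping \<open>g\<close> to the lines of slope \<open>1/2\<close>
  only matters near the ends, where it makes the chi-square bound sufficient despite the factor 2 it loses.\<close>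

definition logit_power :: "real \<Rightarrow> real \<Rightarrow> real" where
  "logit_power \<gamma> x = x powr \<gamma> / (x powr \<gamma> + (1 - x) powr \<gamma>)"

definition minimax_attack :: "real \<Rightarrow> real \<Rightarrow> real" where
  "minimax_attack \<gamma> x = max (x / 2) (min ((1 + x) / 2) (logit_power \<gamma> x))"

lemma logit_power_denominator: "0 \<le> x \<Longrightarrow> x \<le> 1 \<Longrightarrow> 0 < x powr \<gamma> + (1 - x) powr \<gamma>" for x :: real
  by (cases "x = 0") (auto intro: add_pos_nonneg)

lemma logit_power_bounds: "0 \<le> x \<Longrightarrow> x \<le> 1 \<Longrightarrow> 0 \<le> logit_power \<gamma> x \<and> logit_power \<gamma> x \<le> 1"
  using logit_power_denominator[of x \<gamma>] by (simp add: logit_power_def divide_le_eq)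

lemma logit_power_symm: "0 \<le> x \<Longrightarrow> x \<le> 1 \<Longrightarrow> logit_power \<gamma> (1 - x) = 1 - logit_power \<gamma> x"
  using logit_power_denominator[of x \<gamma>] by (simp add: logit_power_def field_simps)

text \<open>On the left half the odds \<open>x / (1 - x)\<close> are at most 1, and raising them to
  a power \<open>\<gamma> \<ge> 1\<close> lowers them.\<close>

lemma logit_power_le:
  assumes x: "0 \<le> x" "x \<le> 1 / 2" and l: "1 \<le> \<gamma>" shows "logit_power \<gamma> x \<le> x"
proof (cases "x = 0")
  case False
  then have x0: "0 < x" using x by simp
  have "x powr (\<gamma> - 1) \<le> (1 - x) powr (\<gamma> - 1)" using x l by (intro powr_mono2) auto
  then have "(x * (1 - x)) * x powr (\<gamma> - 1) \<le> (x * (1 - x)) * (1 - x) powr (\<gamma> - 1)"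
    using x by (intro mult_left_mono) auto
  moreover have "x * x powr (\<gamma> - 1) = x powr \<gamma>" "(1 - x) * (1 - x) powr (\<gamma> - 1) = (1 - x) powr \<gamma>"
    using x0 x by (simp_all add: powr_diff)
  moreover have "(x * (1 - x)) * x powr (\<gamma> - 1) = (1 - x) * (x * x powr (\<gamma> - 1))"
    "(x * (1 - x)) * (1 - x) powr (\<gamma> - 1) = x * ((1 - x) * (1 - x) powr (\<gamma> - 1))" by simp_all
  ultimately have "(1 - x) * x powr \<gamma> \<le> x * (1 - x) powr \<gamma>" by metis
  then have "x powr \<gamma> \<le> x * (x powr \<gamma> + (1 - x) powr \<gamma>)" by (simp add: algebra_simps)
  then show ?thesis using logit_power_denominator[of x \<gamma>] x by (simp add: logit_power_def divide_le_eq)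
qed (simp add: logit_power_def)

lemma prod_compl_mono:
  fixes a b :: real assumes "a \<le> b" "b \<le> 1 / 2" shows "a * (1 - a) \<le> b * (1 - b)"
proof -
  have "0 \<le> (b - a) * (1 - a - b)" using assms by simp
  then show ?thesis by (simp add: algebra_simps)
qed

lemma logit_power_var_le:
  assumes x: "0 \<le> x" "x \<le> 1" and l: "1 \<le> \<gamma>"
  shows "logit_power \<gamma> x * (1 - logit_power \<gamma> x) \<le> x * (1 - x)"
proof (cases "x \<le> 1 / 2")
  case True
  then show ?thesis using logit_power_le[OF x(1) True l] by (intro prod_compl_mono)
next
  case False
  then have "logit_power \<gamma> (1 - x) \<le> 1 - x" using x l by (intro logit_power_le) auto
  then have "logit_power \<gamma> (1 - x) * (1 - logit_power \<gamma> (1 - x)) \<le> (1 - x) * (1 - (1 - x))"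
    using False by (intro prod_compl_mono) auto
  then show ?thesis unfolding logit_power_symm[OF x] by (simp add: mult.commute)
qed

lemma logit_power_deriv:
  assumes x: "0 < x" "x < 1"
  shows "(logit_power \<gamma> has_real_derivative \<gamma> * (logit_power \<gamma> x * (1 - logit_power \<gamma> x)) / (x * (1 - x))) (at x)"
proof -
  define A B where "A = x powr \<gamma>" "B = (1 - x) powr \<gamma>"
  have AB: "0 < A" "0 < B" using x by (auto simp: A_B_def)
  have "((\<lambda>x. x powr \<gamma>) has_real_derivative \<gamma> * A / x) (at x)"
    using x by (auto intro!: derivative_eq_intros simp: A_B_def powr_diff)
  moreover have "((\<lambda>x. (1 - x) powr \<gamma>) has_real_derivative - (\<gamma> * B / (1 - x))) (at x)"
    using x by (auto intro!: derivative_eq_intros simp: A_B_def powr_diff)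
  ultimately have "(logit_power \<gamma> has_real_derivative
     ((\<gamma> * A / x) * (A + B) - A * (\<gamma> * A / x + - (\<gamma> * B / (1 - x)))) / ((A + B) * (A + B))) (at x)"
    unfolding logit_power_def[abs_def] A_B_def using logit_power_denominator[of x \<gamma>] x
    by (intro DERIV_divide DERIV_add) auto
  moreover have "((\<gamma> * A / x) * (A + B) - A * (\<gamma> * A / x + - (\<gamma> * B / (1 - x)))) / ((A + B) * (A + B))
    = \<gamma> * (A / (A + B) * (1 - A / (A + B))) / (x * (1 - x))"
  proof -
    have 1: "1 - A / (A + B) = B / (A + B)" using AB by (simp add: field_simps)
    have "(\<gamma> * A / x) * (A + B) - A * (\<gamma> * A / x + - (\<gamma> * B / (1 - x))) = \<gamma> * A * B * (1 / x + 1 / (1 - x))"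
      by (simp add: algebra_simps add_divide_distrib)
    also have "1 / x + 1 / (1 - x) = 1 / (x * (1 - x))" using x by (simp add: field_simps)
    finally have 2: "(\<gamma> * A / x) * (A + B) - A * (\<gamma> * A / x + - (\<gamma> * B / (1 - x))) = \<gamma> * A * B * (1 / (x * (1 - x)))" .
    show ?thesis unfolding 1 2 by (simp add: mult_ac)
  qed
  ultimately show ?thesis by (simp add: logit_power_def A_B_def)
qed

lemma minimax_attack_bounds:
  assumes x: "0 \<le> x" "x \<le> 1"
  shows "x / 2 \<le> minimax_attack \<gamma> x" "minimax_attack \<gamma> x \<le> (1 + x) / 2"
    "0 \<le> minimax_attack \<gamma> x" "minimax_attack \<gamma> x \<le> 1"
  using x by (auto simp: minimax_attack_def max_def min_def)

text \<open>The clipping lines keep the value between \<open>x / 2\<close> and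
  \<open>(1 + x) / 2\<close>. This permits division by the output variance up to the ends, where for
  \<open>\<gamma> > 1\<close> that of \<open>logit_power\<close> itself would vanish too
  fast.\<close>

lemma minimax_attack_var_ge_half:
  assumes x: "0 \<le> x" "x \<le> 1"
  shows "x * (1 - x) / 2 \<le> minimax_attack \<gamma> x * (1 - minimax_attack \<gamma> x)"
proof -
  define q where "q = minimax_attack \<gamma> x"
  have q: "x / 2 \<le> q" "q \<le> (1 + x) / 2" using minimax_attack_bounds[OF x] by (auto simp: q_def)
  have *: "x * (1 - x) / 2 \<le> x / 2 * (1 - x / 2)" "x * (1 - x) / 2 \<le> (1 - x) / 2 * (1 - (1 - x) / 2)"
    using x zero_le_power2[of "1 - x"] by (simp_all add: field_simps power2_eq_square)
  show ?thesis
  proof (cases "q \<le> 1 / 2")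
    case True
    then show ?thesis using prod_compl_mono[OF q(1) True] * by (simp add: q_def)
  next
    case False
    have "(1 - x) / 2 * (1 - (1 - x) / 2) \<le> (1 - q) * (1 - (1 - q))" using q False by (intro prod_compl_mono) auto
    then show ?thesis using * by (simp add: q_def mult.commute)
  qed
qed

text \<open>Clipping can only pull the value towards 1/2, without crossing it, and this increases
  the variance.\<close>

lemma minimax_attack_var_ge:
  assumes x: "0 \<le> x" "x \<le> 1" and l: "1 \<le> \<gamma>"
  shows "logit_power \<gamma> x * (1 - logit_power \<gamma> x) \<le> minimax_attack \<gamma> x * (1 - minimax_attack \<gamma> x)"
proof (cases "x \<le> 1 / 2")
  case True
  have "logit_power \<gamma> x \<le> x" by (rule logit_power_le[OF x(1) True l])
  then have "logit_power \<gamma> x \<le> minimax_attack \<gamma> x" "minimax_attack \<gamma> x \<le> 1 / 2"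
    using True x by (auto simp: minimax_attack_def max_def min_def)
  then show ?thesis by (rule prod_compl_mono)
next
  case False
  have "logit_power \<gamma> (1 - x) \<le> 1 - x" using False x l by (intro logit_power_le) auto
  then have "x \<le> logit_power \<gamma> x" unfolding logit_power_symm[OF x] by simp
  then have "1 - logit_power \<gamma> x \<le> 1 - minimax_attack \<gamma> x" "1 - minimax_attack \<gamma> x \<le> 1 / 2"
    using False x by (auto simp: minimax_attack_def max_def min_def)
  then have "(1 - logit_power \<gamma> x) * (1 - (1 - logit_power \<gamma> x)) \<le> (1 - minimax_attack \<gamma> x) * (1 - (1 - minimax_attack \<gamma> x))"
    by (rule prod_compl_mono)
  then show ?thesis by (simp add: mult.commute)
qed

lemma abs_max_diff: "\<bar>max a b - max c d\<bar> \<le> max \<bar>a - c\<bar> \<bar>b - d\<bar>" for a b c d :: real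
  by linarith

lemma abs_min_diff: "\<bar>min a b - min c d\<bar> \<le> max \<bar>a - c\<bar> \<bar>b - d\<bar>" for a b c d :: real
  by linarith

text \<open>Maximum and minimum are nonexpansive, so increments are controlled without knowing which
  branch is active and without derivatives at the kinks.\<close>

lemma minimax_attack_diff:
  "\<bar>minimax_attack \<gamma> x - minimax_attack \<gamma> w\<bar> \<le> max (\<bar>x - w\<bar> / 2) \<bar>logit_power \<gamma> x - logit_power \<gamma> w\<bar>"
proof -
  let ?m = "\<lambda>x. min ((1 + x) / 2) (logit_power \<gamma> x)"
  have e: "\<bar>x / 2 - w / 2\<bar> = \<bar>x - w\<bar> / 2" "\<bar>(1 + x) / 2 - (1 + w) / 2\<bar> = \<bar>x - w\<bar> / 2"
  proof -
    have "x / 2 - w / 2 = (x - w) / 2" "(1 + x) / 2 - (1 + w) / 2 = (x - w) / 2" by (simp_all add: field_simps)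
    then show "\<bar>x / 2 - w / 2\<bar> = \<bar>x - w\<bar> / 2" "\<bar>(1 + x) / 2 - (1 + w) / 2\<bar> = \<bar>x - w\<bar> / 2"
      by (simp_all only: abs_divide abs_numeral)
  qed
  have "\<bar>?m x - ?m w\<bar> \<le> max (\<bar>x - w\<bar> / 2) \<bar>logit_power \<gamma> x - logit_power \<gamma> w\<bar>"
    using abs_min_diff[of "(1 + x) / 2" _ "(1 + w) / 2"] unfolding e(2) .
  moreover have "\<bar>minimax_attack \<gamma> x - minimax_attack \<gamma> w\<bar> \<le> max (\<bar>x - w\<bar> / 2) \<bar>?m x - ?m w\<bar>"
    using abs_max_diff[of "x / 2" _ "w / 2"] unfolding e(1) minimax_attack_def .
  ultimately show ?thesis by (meson max.boundedI max.cobounded1 order_trans)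
qed

text \<open>The threshold gives \<open>x powr e \<le> 1/8\<close>, and the denominator is at least
  1/4; the quotient of the two is the factor 1/2.\<close>

lemma logit_power_small:
  assumes e: "0 < e" "e \<le> 1" and x: "0 \<le> x" "x \<le> (1/8) powr (1/e)"
  shows "logit_power (1 + e) x \<le> x / 2"
proof (cases "x = 0")
  case False
  then have x0: "0 < x" using x by simp
  have "(1/8::real) powr (1/e) \<le> (1/8) powr 1" using e by (intro powr_mono') auto
  then have x8: "x \<le> 1/8" using x by simp
  have "x powr e \<le> ((1/8) powr (1/e)) powr e" using x e by (intro powr_mono2) auto
  also have "\<dots> = 1/8" using e by (simp add: powr_powr)
  finally have xe: "x powr e \<le> 1/8" .
  have "(1/2)\<^sup>2 \<le> (1 - x)\<^sup>2" using x8 by (intro power_mono) auto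
  also have "\<dots> = (1 - x) powr 2" using x8 by simp
  also have "\<dots> \<le> (1 - x) powr (1 + e)" using x8 x0 e by (intro powr_mono') auto
  finally have "(1/2)\<^sup>2 \<le> (1 - x) powr (1 + e)" .
  moreover have "(1/2)\<^sup>2 = (1/4 :: real)" by (simp add: power2_eq_square)
  moreover have "0 \<le> x powr (1 + e)" by simp
  ultimately have N: "1/4 \<le> x powr (1 + e) + (1 - x) powr (1 + e)" by linarith
  have "x powr (1 + e) \<le> x * (1/8)" using xe x0 by (simp add: powr_add)
  moreover have "x / 2 * (1/4) \<le> x / 2 * (x powr (1 + e) + (1 - x) powr (1 + e))"
    using N x0 by (intro mult_left_mono) auto
  ultimately have "x powr (1 + e) \<le> x / 2 * (x powr (1 + e) + (1 - x) powr (1 + e))" by linarith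
  then show ?thesis using logit_power_denominator[of x "1 + e"] x8 x by (simp add: logit_power_def divide_le_eq)
qed (simp add: logit_power_def)

lemma minimax_attack_edges:
  assumes e: "0 < e" "e \<le> 1" and x: "0 \<le> x" "x \<le> (1/8) powr (1/e)"
  shows "minimax_attack (1 + e) x = x / 2" "minimax_attack (1 + e) (1 - x) = (1 + (1 - x)) / 2"
proof -
  have "(1/8::real) powr (1/e) \<le> (1/8) powr 1" using e by (intro powr_mono') auto
  then have x8: "x \<le> 1/8" using x by simp
  have s: "logit_power (1 + e) x \<le> x / 2" by (rule logit_power_small[OF e x])
  then show "minimax_attack (1 + e) x = x / 2" by (auto simp: minimax_attack_def max_def min_def)
  have "logit_power (1 + e) (1 - x) = 1 - logit_power (1 + e) x" using x x8 by (intro logit_power_symm) auto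
  then show "minimax_attack (1 + e) (1 - x) = (1 + (1 - x)) / 2"
    using s x x8 by (auto simp: minimax_attack_def max_def min_def)
qed

definition sampled :: "(real \<Rightarrow> real) \<Rightarrow> nat \<Rightarrow> nat \<Rightarrow> real" where
  "sampled g c z = g (real z / real c)"

lemma valid_minimax_attack: "1 \<le> c \<Longrightarrow> valid_channel c (sampled (minimax_attack \<gamma>) c)"
proof -
  assume c: "1 \<le> c"
  have "minimax_attack \<gamma> 0 = 0" "minimax_attack \<gamma> 1 = 1" by (simp_all add: minimax_attack_def logit_power_def)
  then show ?thesis using c minimax_attack_bounds(3,4)[of "real _ / real c" \<gamma>]
    by (auto simp: valid_channel_def sampled_def)
qed

lemma le_max_square:
  fixes d x y m :: real
  assumes "\<bar>d\<bar> \<le> max (\<bar>x\<bar> / 2) \<bar>y\<bar>" "y\<^sup>2 \<le> m * x\<^sup>2" shows "d\<^sup>2 \<le> max (1 / 4) m * x\<^sup>2"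
proof -
  have d: "d\<^sup>2 \<le> (max (\<bar>x\<bar> / 2) \<bar>y\<bar>)\<^sup>2" using assms(1) power_mono[of "\<bar>d\<bar>" _ 2] by simp
  have "(max (\<bar>x\<bar> / 2) \<bar>y\<bar>)\<^sup>2 \<le> max (1 / 4) m * x\<^sup>2"
  proof (cases "\<bar>x\<bar> / 2 \<le> \<bar>y\<bar>")
    case True
    then have "(max (\<bar>x\<bar> / 2) \<bar>y\<bar>)\<^sup>2 \<le> m * x\<^sup>2" using assms(2) by (simp add: max_def)
    also have "\<dots> \<le> max (1 / 4) m * x\<^sup>2" by (intro mult_right_mono) auto
    finally show ?thesis .
  next
    case False
    then have "(max (\<bar>x\<bar> / 2) \<bar>y\<bar>)\<^sup>2 = 1 / 4 * x\<^sup>2" by (simp add: max_def power_divide)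
    also have "\<dots> \<le> max (1 / 4) m * x\<^sup>2" by (intro mult_right_mono) auto
    finally show ?thesis .
  qed
  then show ?thesis using d by linarith
qed

text \<open>If both points lie in the same linear end piece, the increment is exactly half the
  distance. Otherwise they are at least \<open>b / 2\<close> apart, and \<open>16 / b ^ 4\<close> is
  the inverse fourth power of that distance.\<close>

lemma minimax_attack_edge_local:
  assumes e: "0 < e" "e \<le> 1" and b: "b = (1/8) powr (1/e)" and w: "0 < w" "w < 1" "w \<le> b / 2 \<or> 1 - b / 2 \<le> w"
    and x: "0 \<le> x" "x \<le> 1"
  shows "(minimax_attack (1 + e) x - minimax_attack (1 + e) w)\<^sup>2 \<le> 1 / 4 * (x - w)\<^sup>2 + 16 / b ^ 4 * (x - w) ^ 4"
proof -
  have b0: "0 < b" by (simp add: b)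
  have r: "0 \<le> 16 / b ^ 4 * (x - w) ^ 4" "0 \<le> 1 / 4 * (x - w)\<^sup>2" using b0 by auto
  have far: ?thesis if "b / 2 \<le> \<bar>x - w\<bar>"
  proof -
    have "\<bar>minimax_attack (1 + e) x - minimax_attack (1 + e) w\<bar> \<le> 1"
      using minimax_attack_bounds(3,4)[of x "1 + e"] minimax_attack_bounds(3,4)[of w "1 + e"] x w by (simp add: abs_le_iff)
    then have "(minimax_attack (1 + e) x - minimax_attack (1 + e) w)\<^sup>2 \<le> 1" by (simp add: abs_square_le_1)
    also have "(b / 2) ^ 4 \<le> \<bar>x - w\<bar> ^ 4" using that b0 by (intro power_mono) auto
    then have "1 \<le> 16 / b ^ 4 * (x - w) ^ 4" using b0 by (simp add: power_divide field_simps)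
    finally show ?thesis using r by linarith
  qed
  have near: ?thesis if "minimax_attack (1 + e) x - minimax_attack (1 + e) w = (x - w) / 2"
    unfolding that using r(1) by (simp add: power_divide)
  show ?thesis
  proof (cases "w \<le> b / 2")
    case True
    show ?thesis
    proof (cases "x \<le> b")
      case xb: True
      have "minimax_attack (1 + e) x = x / 2" "minimax_attack (1 + e) w = w / 2"
        by (rule minimax_attack_edges(1)[OF e]; use xb True b0 w x in \<open>simp add: b[symmetric]\<close>)+
      then show ?thesis by (intro near) simp
    qed (use True in \<open>intro far; linarith\<close>)
  next
    case False
    then have w': "1 - w \<le> b / 2" using w by auto
    show ?thesis
    proof (cases "1 - x \<le> b")
      case xb: True
      have "minimax_attack (1 + e) (1 - (1 - x)) = (1 + (1 - (1 - x))) / 2" "minimax_attack (1 + e) (1 - (1 - w)) = (1 + (1 - (1 - w))) / 2"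
        by (rule minimax_attack_edges(2)[OF e]; use xb w' b0 w x in \<open>simp add: b[symmetric]\<close>)+
      then show ?thesis by (intro near) (simp add: field_simps)
    qed (use w' in \<open>intro far; linarith\<close>)
  qed
qed

text \<open>The squared slope 1/4 is divided by an output variance of at least half the input
  variance, which leaves exactly the factor 1/2.\<close>

lemma minimax_attack_edge_info:
  assumes e: "0 < e" "e \<le> 1" and b: "b = (1/8) powr (1/e)" and w: "0 < w" "w < 1" "w \<le> b / 2 \<or> 1 - b / 2 \<le> w" and c: "1 \<le> c"
  shows "channel_info c (sampled (minimax_attack (1 + e)) c) w \<le> 1 / (2 * real c) + 64 / b ^ 4 / (real c)\<^sup>2"
proof -
  let ?q = "minimax_attack (1 + e) w" and ?X = "w * (1 - w)"
  have X: "0 < ?X" using w by simp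
  have qX: "?X / 2 \<le> ?q * (1 - ?q)" using w by (intro minimax_attack_var_ge_half) auto
  have q: "0 < ?q" "?q < 1" using minimax_attack_bounds(1,2)[of w "1 + e"] w by auto
  have b0: "0 < b" by (simp add: b)
  have "channel_info c (sampled (minimax_attack (1 + e)) c) w
    \<le> (1 / 4 * ?X / real c + 16 / b ^ 4 * (2 * ?X / (real c)\<^sup>2)) / (?q * (1 - ?q))"
  proof (rule channel_info_chi2[OF valid_minimax_attack[OF c] w(1,2) q])
    show "(sampled (minimax_attack (1 + e)) c z - ?q)\<^sup>2 \<le> 1 / 4 * (real z / real c - w)\<^sup>2 + 16 / b ^ 4 * (real z / real c - w) ^ 4"
      if "z \<le> c" for z
      unfolding sampled_def using that c by (intro minimax_attack_edge_local[OF e b w]) auto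
  qed (use b0 in auto)
  also have "\<dots> \<le> (1 / 4 * ?X / real c + 16 / b ^ 4 * (2 * ?X / (real c)\<^sup>2)) / (?X / 2)"
    using qX X b0 by (intro divide_left_mono) (auto intro!: add_nonneg_nonneg)
  also have "\<dots> = 1 / (2 * real c) + 64 / b ^ 4 / (real c)\<^sup>2"
  proof -
    have "(1 / 4 * Y / r + K * (2 * Y / s)) / (Y / 2) = 1 / (2 * r) + 4 * K / s" if "0 < Y" for Y r s K :: real
      using that by (simp add: add_divide_distrib)
    from this[OF X, of "real c" "16 / b ^ 4" "(real c)\<^sup>2"] show ?thesis by (simp only:)
  qed
  finally show ?thesis .
qed

text \<open>Mean value theorem and uniform continuity of the squared slope. The larger interval
  \<open>{b/4..1 - b/4}\<close> leaves room for intermediate points at distance below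
  \<open>r \<le> b / 4\<close>.\<close>

lemma logit_power_bulk_local:
  fixes \<gamma> :: real
  assumes b: "0 < b" "b \<le> 1/2" and \<eta>: "0 < \<eta>"
  defines "D \<equiv> \<lambda>w. \<gamma> * (logit_power \<gamma> w * (1 - logit_power \<gamma> w)) / (w * (1 - w))"
  shows "\<exists>r>0. \<forall>w\<in>{b/2..1 - b/2}. \<forall>x\<in>{0..1}. \<bar>x - w\<bar> < r \<longrightarrow> (logit_power \<gamma> x - logit_power \<gamma> w)\<^sup>2 \<le> ((D w)\<^sup>2 + \<eta>) * (x - w)\<^sup>2"
proof -
  let ?I = "{b/4..1 - b/4}"
  have I: "0 < x" "x < 1" if "x \<in> ?I" for x using that b by auto
  have cg: "continuous_on ?I (logit_power \<gamma>)"
    using logit_power_deriv[of _ \<gamma>] I by (intro continuous_at_imp_continuous_on ballI) (blast intro: DERIV_isCont)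
  have "continuous_on ?I (\<lambda>w. (D w)\<^sup>2)"
    unfolding D_def using I by (intro continuous_intros cg) force
  then have "uniformly_continuous_on ?I (\<lambda>w. (D w)\<^sup>2)" by (rule compact_uniformly_continuous) simp
  then obtain d where d: "0 < d" "\<And>x y. x \<in> ?I \<Longrightarrow> y \<in> ?I \<Longrightarrow> dist y x < d \<Longrightarrow> dist ((D y)\<^sup>2) ((D x)\<^sup>2) < \<eta>"
    using \<eta> unfolding uniformly_continuous_on_def by meson
  define r where "r = min d (b / 4)"
  have "0 < r" using d b by (simp add: r_def)
  moreover have "(logit_power \<gamma> x - logit_power \<gamma> w)\<^sup>2 \<le> ((D w)\<^sup>2 + \<eta>) * (x - w)\<^sup>2"
    if w: "w \<in> {b/2..1 - b/2}" and x: "\<bar>x - w\<bar> < r" for x w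
  proof -
    have xr: "\<bar>x - w\<bar> < d" "\<bar>x - w\<bar> < b / 4" using x by (auto simp: r_def)
    have bw: "b / 2 \<le> w" "w \<le> 1 - b / 2" using w by auto
    have *: "\<exists>\<xi>. \<bar>\<xi> - w\<bar> \<le> \<bar>x - w\<bar> \<and> logit_power \<gamma> x - logit_power \<gamma> w = (x - w) * D \<xi>"
    proof -
      consider "x < w" | "x = w" | "w < x" by linarith
      then show ?thesis
      proof cases
        case 1
        have "\<exists>\<xi>>x. \<xi> < w \<and> logit_power \<gamma> w - logit_power \<gamma> x = (w - x) * D \<xi>"
          unfolding D_def by (rule MVT2[OF 1]) (use bw xr 1 b in \<open>auto intro!: logit_power_deriv\<close>)
        then obtain \<xi> where "x < \<xi>" "\<xi> < w" "logit_power \<gamma> w - logit_power \<gamma> x = (w - x) * D \<xi>" by blast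
        then show ?thesis by (intro exI[of _ \<xi>]) (auto simp: algebra_simps)
      next
        case 3
        have "\<exists>\<xi>>w. \<xi> < x \<and> logit_power \<gamma> x - logit_power \<gamma> w = (x - w) * D \<xi>"
          unfolding D_def by (rule MVT2[OF 3]) (use bw xr 3 b in \<open>auto intro!: logit_power_deriv\<close>)
        then obtain \<xi> where "w < \<xi>" "\<xi> < x" "logit_power \<gamma> x - logit_power \<gamma> w = (x - w) * D \<xi>" by blast
        then show ?thesis by (intro exI[of _ \<xi>]) auto
      qed auto
    qed
    then obtain \<xi> where \<xi>: "\<bar>\<xi> - w\<bar> \<le> \<bar>x - w\<bar>" "logit_power \<gamma> x - logit_power \<gamma> w = (x - w) * D \<xi>" by blast
    have "w \<in> ?I" "\<xi> \<in> ?I" using bw \<xi>(1) xr(2) b by (auto simp: abs_le_iff abs_less_iff)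
    then have "dist ((D \<xi>)\<^sup>2) ((D w)\<^sup>2) < \<eta>" using d(2)[of w \<xi>] \<xi>(1) xr(1) by (simp add: dist_real_def)
    then have "(D \<xi>)\<^sup>2 \<le> (D w)\<^sup>2 + \<eta>" by (simp add: dist_real_def abs_less_iff)
    then have "(D \<xi>)\<^sup>2 * (x - w)\<^sup>2 \<le> ((D w)\<^sup>2 + \<eta>) * (x - w)\<^sup>2" by (intro mult_right_mono) auto
    then show ?thesis unfolding \<xi>(2) by (simp add: power_mult_distrib mult.commute)
  qed
  ultimately show ?thesis by blast
qed

text \<open>Away from the ends the remainders of the Taylor bound have constants uniform in
  \<open>w\<close>, and the leading coefficient is governed by the comparison \<open>MX\<close> of
  slope and variances.\<close>

lemma minimax_attack_bulk_info:
  assumes g: "1 \<le> \<gamma>" "\<gamma> \<le> 2" and b: "0 < b" "b \<le> 1/2" and \<eta>: "0 < \<eta>" "\<eta> \<le> 1"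
  shows "\<exists>C\<ge>0. \<forall>c\<ge>1. \<forall>w\<in>{b/2..1 - b/2}. channel_info c (sampled (minimax_attack \<gamma>) c) w
    \<le> (\<gamma>\<^sup>2 + 2 * \<eta>) / (2 * real c) + C / (real c * sqrt (real c))"
proof -
  let ?g = "logit_power \<gamma>" and ?m = "minimax_attack \<gamma>"
  define D where "D = (\<lambda>w. \<gamma> * (?g w * (1 - ?g w)) / (w * (1 - w)))"
  obtain r where r: "0 < r" "\<And>w x. w \<in> {b/2..1 - b/2} \<Longrightarrow> x \<in> {0..1} \<Longrightarrow> \<bar>x - w\<bar> < r \<Longrightarrow>
     (?g x - ?g w)\<^sup>2 \<le> ((D w)\<^sup>2 + \<eta>) * (x - w)\<^sup>2"
    using logit_power_bulk_local[OF b \<eta>(1), of \<gamma>] unfolding D_def by blast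
  \<comment> \<open>Beyond distance \<open>r\<close> the quartic term alone dominates the trivial
    bound 1.\<close>
  define K where "K = 1 / r ^ 4"
  define C where "C = 2 * K + sqrt (5 + K) ^ 3 * (16 / b\<^sup>2) * (3 / 2)"
  have K: "0 \<le> K" using r by (simp add: K_def)
  have C: "0 \<le> C" using K by (simp add: C_def)
  have "channel_info c (sampled ?m c) w \<le> (\<gamma>\<^sup>2 + 2 * \<eta>) / (2 * real c) + C / (real c * sqrt (real c))"
    if c: "1 \<le> c" and w: "w \<in> {b/2..1 - b/2}" for c w
  proof -
    have c1: "1 \<le> real c" using c by simp
    have w01: "0 < w" "w < 1" using w b by auto
    define X where "X = w * (1 - w)"
    define q where "q = ?m w"
    \<comment> \<open>The squared slope of whichever branch is active: 1/4 on the clipping lines,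
      \<open>(D w)^2 + \<eta>\<close> on \<open>logit_power\<close>.\<close>
    define M where "M = max (1 / 4) ((D w)\<^sup>2 + \<eta>)"
    have X: "0 < X" "X \<le> 1" using w01 by (auto simp: X_def intro!: mult_le_one)
    have q: "0 < q" "q < 1" "b / 4 \<le> q" "b / 4 \<le> 1 - q"
      using minimax_attack_bounds(1,2)[of w \<gamma>] w w01 b by (auto simp: q_def)
    have qX: "X / 2 \<le> q * (1 - q)" unfolding X_def q_def using w01 by (intro minimax_attack_var_ge_half) auto
    have gX: "?g w * (1 - ?g w) \<le> X" unfolding X_def using w01 g by (intro logit_power_var_le) auto
    have gq: "?g w * (1 - ?g w) \<le> q * (1 - q)" unfolding q_def using w01 g by (intro minimax_attack_var_ge) auto
    have g0: "0 \<le> ?g w * (1 - ?g w)" using logit_power_bounds[of w \<gamma>] w01 by auto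
    have q0: "0 < q * (1 - q)" using q by simp
    \<comment> \<open>\<open>(D w)^2 * X\<close> contains two factors \<open>g * (1 - g)\<close>:
      one is compared with the variance of the clipped attack, the other with
      \<open>X\<close>.\<close>
    have DX: "(D w)\<^sup>2 * X \<le> \<gamma>\<^sup>2 * (q * (1 - q))"
    proof -
      have "(D w)\<^sup>2 * X = \<gamma>\<^sup>2 * ((?g w * (1 - ?g w)) * ((?g w * (1 - ?g w)) / X))"
        using X by (simp add: D_def X_def[symmetric] power_divide power_mult_distrib power2_eq_square)
      also have "\<dots> \<le> \<gamma>\<^sup>2 * ((q * (1 - q)) * 1)"
      proof (rule mult_left_mono)
        have "?g w * (1 - ?g w) / X \<le> 1" "0 \<le> ?g w * (1 - ?g w) / X" using gX g0 X by auto
        then show "(?g w * (1 - ?g w)) * ((?g w * (1 - ?g w)) / X) \<le> (q * (1 - q)) * 1"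
          using gq q0 by (intro mult_mono[of "?g w * (1 - ?g w)" "q * (1 - q)"]) auto
      qed simp
      finally show ?thesis by simp
    qed
    \<comment> \<open>Leads to \<open>M \<le> 5\<close>, so that the constant of the cubic remainder
      does not depend on \<open>w\<close>.\<close>
    have D4: "(D w)\<^sup>2 \<le> 4"
    proof -
      define h where "h = (?g w * (1 - ?g w)) / X"
      have h: "h \<le> 1" "0 \<le> h" using gX g0 X unfolding h_def by auto
      have Dh: "D w = \<gamma> * h" unfolding D_def X_def h_def by (rule times_divide_eq_right[symmetric])
      have "\<gamma> * h \<le> 2 * 1" by (rule mult_mono) (use g h in auto)
      moreover have "0 \<le> \<gamma> * h" by (rule mult_nonneg_nonneg) (use g h in auto)
      ultimately have "0 \<le> D w" "D w \<le> 2" unfolding Dh by auto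
      then have "(D w)\<^sup>2 \<le> 2\<^sup>2" by (intro power_mono) auto
      then show ?thesis by simp
    qed
    have M: "0 \<le> M" "M \<le> 5" using D4 \<eta> by (auto simp: M_def)
    have MX: "M * X \<le> (\<gamma>\<^sup>2 + 2 * \<eta>) * (q * (1 - q))"
    proof -
      have "1 \<le> \<gamma>\<^sup>2" using g by (simp add: one_le_power)
      have "1 / 4 * X \<le> 1 * (q * (1 - q))" using qX X by simp
      also have "\<dots> \<le> (\<gamma>\<^sup>2 + 2 * \<eta>) * (q * (1 - q))" using \<open>1 \<le> \<gamma>\<^sup>2\<close> \<eta> q0 by (intro mult_right_mono) auto
      finally have 1: "1 / 4 * X \<le> (\<gamma>\<^sup>2 + 2 * \<eta>) * (q * (1 - q))" .
      \<comment> \<open>The slack \<open>\<eta>\<close> is paid twice, since \<open>X\<close> is at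
        most twice the output variance.\<close>
      have "\<eta> * X \<le> \<eta> * (2 * (q * (1 - q)))" using qX \<eta> by (intro mult_left_mono) auto
      then have 2: "((D w)\<^sup>2 + \<eta>) * X \<le> (\<gamma>\<^sup>2 + 2 * \<eta>) * (q * (1 - q))" using DX by (simp add: algebra_simps)
      show ?thesis using 1 2 by (simp add: M_def max_def)
    qed
    have loc: "(sampled ?m c z - q)\<^sup>2 \<le> M * (real z / real c - w)\<^sup>2 + K * (real z / real c - w) ^ 4" if z: "z \<le> c" for z
    proof -
      define x where "x = real z / real c"
      have x: "x \<in> {0..1}" using z c by (auto simp: x_def)
      have K4: "0 \<le> K * (x - w) ^ 4" using K by simp
      have M2: "0 \<le> M * (x - w)\<^sup>2" using M by simp
      show ?thesis
      proof (cases "\<bar>x - w\<bar> < r")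
        case True
        have "(?m x - ?m w)\<^sup>2 \<le> M * (x - w)\<^sup>2"
          unfolding M_def by (rule le_max_square[OF minimax_attack_diff r(2)[OF w x True]])
        then show ?thesis using K4 by (simp add: sampled_def x_def q_def)
      next
        case False
        have "\<bar>?m x - ?m w\<bar> \<le> 1"
          using minimax_attack_bounds(3,4)[of x \<gamma>] minimax_attack_bounds(3,4)[of w \<gamma>] x w01 by (simp add: abs_le_iff)
        then have "(?m x - ?m w)\<^sup>2 \<le> 1" by (simp add: abs_square_le_1)
        moreover have "r ^ 4 \<le> \<bar>x - w\<bar> ^ 4" using False r by (intro power_mono) auto
        then have "1 \<le> K * (x - w) ^ 4" using r by (simp add: K_def)
        ultimately show ?thesis using M2 by (simp add: sampled_def x_def q_def)
      qed
    qed
    let ?Q = "1 / (2 * q\<^sup>2) + 1 / (2 * (1 - q)\<^sup>2)"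
    have "channel_info c (sampled ?m c) w \<le> (M * X / real c + K * (2 * X / (real c)\<^sup>2)) / (2 * (q * (1 - q)))
      + sqrt (M + K) ^ 3 * ?Q * (3 / 2 * X / (real c * sqrt (real c)))"
      unfolding X_def by (rule channel_info_taylor[OF valid_minimax_attack[OF c] w01 q(1,2) M(1) K loc])
    also have "(M * X / real c + K * (2 * X / (real c)\<^sup>2)) / (2 * (q * (1 - q)))
      \<le> (\<gamma>\<^sup>2 + 2 * \<eta>) / (2 * real c) + 2 * K / (real c * sqrt (real c))"
    proof -
      have "M * X / real c / (2 * (q * (1 - q))) \<le> (\<gamma>\<^sup>2 + 2 * \<eta>) * (q * (1 - q)) / real c / (2 * (q * (1 - q)))"
        using MX q0 c1 by (intro divide_right_mono) auto
      also have "\<dots> = (\<gamma>\<^sup>2 + 2 * \<eta>) / (2 * real c)"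
      proof -
        have "G * Y / s / (2 * Y) = G / (2 * s)" if "0 < Y" for G Y s :: real using that by simp
        from this[OF q0] show ?thesis .
      qed
      finally have 1: "M * X / real c / (2 * (q * (1 - q))) \<le> (\<gamma>\<^sup>2 + 2 * \<eta>) / (2 * real c)" .
      have "K * (2 * X / (real c)\<^sup>2) / (2 * (q * (1 - q))) \<le> K * (2 * X / (real c)\<^sup>2) / (2 * (X / 2))"
        using qX X K q0 by (intro divide_left_mono) auto
      also have "\<dots> = 2 * K / (real c)\<^sup>2" using X by simp
      also have "\<dots> \<le> 2 * K / (real c * sqrt (real c))"
      proof -
        have "1 * sqrt (real c) \<le> sqrt (real c) * sqrt (real c)" by (rule mult_right_mono) (use c1 in auto)
        then have "sqrt (real c) \<le> real c" using c1 by simp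
        then have "real c * sqrt (real c) \<le> (real c)\<^sup>2" unfolding power2_eq_square using c1 by (intro mult_left_mono) auto
        then show ?thesis using K c1 by (intro divide_left_mono) auto
      qed
      finally have 2: "K * (2 * X / (real c)\<^sup>2) / (2 * (q * (1 - q))) \<le> 2 * K / (real c * sqrt (real c))" .
      show ?thesis using 1 2 by (simp add: add_divide_distrib)
    qed
    also have "sqrt (M + K) ^ 3 * ?Q * (3 / 2 * X / (real c * sqrt (real c)))
      \<le> sqrt (5 + K) ^ 3 * (16 / b\<^sup>2) * (3 / 2 * 1 / (real c * sqrt (real c)))"
    proof -
      have s: "1 / (2 * y\<^sup>2) \<le> 8 / b\<^sup>2" if "b / 4 \<le> y" for y
      proof -
        have "(b / 4)\<^sup>2 \<le> y\<^sup>2" using that b by (intro power_mono) auto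
        then have "1 / (2 * y\<^sup>2) \<le> 1 / (2 * (b / 4)\<^sup>2)" by (intro frac_le) (use b in auto)
        then show ?thesis by (simp add: power_divide)
      qed
      have "?Q \<le> 16 / b\<^sup>2" using s[OF q(3)] s[OF q(4)] by simp
      then show ?thesis
        using M K X c1 b by (intro mult_mono power_mono divide_right_mono mult_nonneg_nonneg) auto
    qed
    finally have "channel_info c (sampled ?m c) w \<le> (\<gamma>\<^sup>2 + 2 * \<eta>) / (2 * real c) + 2 * K / (real c * sqrt (real c))
      + sqrt (5 + K) ^ 3 * (16 / b\<^sup>2) * (3 / 2 * 1 / (real c * sqrt (real c)))" by simp
    moreover have "2 * K / S + sqrt (5 + K) ^ 3 * (16 / b\<^sup>2) * (3 / 2 * 1 / S) = C / S" for S
      by (simp add: C_def add_divide_distrib)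
    ultimately show ?thesis by (simp only: add.assoc)
  qed
  then show ?thesis using C by blast
qed

text \<open>The attack, the edge width \<open>b\<close> and all constants depend on
  \<open>\<epsilon>\<close> only, so one threshold serves every \<open>w\<close>, hence every
  tracer.\<close>

theorem minimax_attack_uniform:
  assumes \<epsilon>: "0 < \<epsilon>"
  shows "\<exists>g. \<exists>c0\<ge>1. \<forall>c\<ge>c0. valid_channel c (sampled g c) \<and>
    (\<forall>w. 0 < w \<and> w < 1 \<longrightarrow> channel_info c (sampled g c) w \<le> (1 + \<epsilon>) / (2 * real c))"
proof -
  \<comment> \<open>The bulk bound is used with \<open>\<gamma> = 1 + e\<close> and
    \<open>\<eta> = e\<close>, and
    \<open>(1 + e)^2 + 2 * e \<le> 1 + 5 * e \<le> 1 + \<epsilon> / 2\<close>.\<close>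
  define e where "e = min 1 (\<epsilon> / 12)"
  have e: "0 < e" "e \<le> 1" "12 * e \<le> \<epsilon>" using \<epsilon> by (auto simp: e_def)
  define b where "b = (1/8::real) powr (1/e)"
  have b0: "0 < b" by (simp add: b_def)
  have "b \<le> (1/8) powr 1" unfolding b_def using e by (intro powr_mono') auto
  then have b1: "b \<le> 1/2" by simp
  obtain C where C: "0 \<le> C" "\<And>c w. 1 \<le> c \<Longrightarrow> w \<in> {b/2..1 - b/2} \<Longrightarrow> channel_info c (sampled (minimax_attack (1 + e)) c) w
    \<le> ((1 + e)\<^sup>2 + 2 * e) / (2 * real c) + C / (real c * sqrt (real c))"
    using minimax_attack_bulk_info[of "1 + e" b e] e b0 b1 by auto
  \<comment> \<open>A common constant for the errors in the bulk and at the edges, both brought to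
    the order c^(-3/2).\<close>
  define E where "E = C + 64 / b ^ 4"
  have E: "0 \<le> E" "C \<le> E" "64 / b ^ 4 \<le> E" using C b0 by (auto simp: E_def)
  define c0 where "c0 = Suc (nat \<lceil>(4 * E / \<epsilon>)\<^sup>2\<rceil>)"
  have "channel_info c (sampled (minimax_attack (1 + e)) c) w \<le> (1 + \<epsilon>) / (2 * real c)"
    if c: "c0 \<le> c" and w: "0 < w" "w < 1" for c w
  proof -
    have c1: "1 \<le> c" "1 \<le> real c" using c by (auto simp: c0_def)
    define s where "s = sqrt (real c)"
    have s: "1 \<le> s" "s * s = real c" using c1 by (auto simp: s_def)
    have sum: "channel_info c (sampled (minimax_attack (1 + e)) c) w \<le> (1 + \<epsilon> / 2) / (2 * real c) + E / (real c * s)"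
    proof (cases "w \<in> {b/2..1 - b/2}")
      case True
      have "e * e \<le> e * 1" using e by (intro mult_left_mono) auto
      moreover have "(1 + e)\<^sup>2 + 2 * e = 1 + 4 * e + e * e" by (simp add: power2_eq_square algebra_simps)
      ultimately have "(1 + e)\<^sup>2 + 2 * e \<le> 1 + \<epsilon> / 2" using e by linarith
      then have "((1 + e)\<^sup>2 + 2 * e) / (2 * real c) \<le> (1 + \<epsilon> / 2) / (2 * real c)" using c1 by (intro divide_right_mono) auto
      moreover have "C / (real c * s) \<le> E / (real c * s)" using E s c1 by (intro divide_right_mono) auto
      ultimately show ?thesis using C(2)[OF c1(1) True] unfolding s_def by linarith
    next
      case False
      then have "w \<le> b / 2 \<or> 1 - b / 2 \<le> w" by auto
      then have "channel_info c (sampled (minimax_attack (1 + e)) c) w \<le> 1 / (2 * real c) + 64 / b ^ 4 / (real c)\<^sup>2"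
        using minimax_attack_edge_info[OF e(1,2) b_def w] c1 by blast
      moreover have "1 / (2 * real c) \<le> (1 + \<epsilon> / 2) / (2 * real c)" using c1 \<epsilon> by (intro divide_right_mono) auto
      moreover have "64 / b ^ 4 / (real c)\<^sup>2 \<le> E / (real c * s)"
      proof (rule frac_le)
        have "real c * (s * 1) \<le> real c * (s * s)" using s c1 by (intro mult_left_mono) auto
        then show "real c * s \<le> (real c)\<^sup>2" using s by (simp add: power2_eq_square)
      qed (use E s c1 in auto)
      ultimately show ?thesis by linarith
    qed
    have "E / s \<le> \<epsilon> / 4"
    proof -
      have "(4 * E / \<epsilon>)\<^sup>2 \<le> real c" using c unfolding c0_def by linarith
      then have "4 * E / \<epsilon> \<le> s" unfolding s_def by (rule real_le_rsqrt)
      then show ?thesis using s \<epsilon> by (simp add: field_simps)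
    qed
    then have "E / s / real c \<le> \<epsilon> / 4 / real c" using c1 by (intro divide_right_mono) auto
    then have "E / (real c * s) \<le> \<epsilon> / 4 / real c" by (simp add: mult.commute)
    moreover have "(1 + \<epsilon> / 2) / (2 * real c) + \<epsilon> / 4 / real c = (1 + \<epsilon>) / (2 * real c)" using c1 by (simp add: field_simps)
    ultimately show ?thesis using sum by linarith
  qed
  moreover have "1 \<le> c0" by (simp add: c0_def)
  ultimately show ?thesis using valid_minimax_attack by (meson order_trans)
qed

section \<open>The game\<close>

lemma uniform_allocation_eq:
  assumes "1 \<le> L" shows "uniform_allocation L (L * n) = return_pmf (\<lambda>l\<in>{1..L}. n)"
  using assms by (simp add: uniform_allocation_def)

lemma uniform_in_allocations: "1 \<le> L \<Longrightarrow> 1 \<le> n \<Longrightarrow> (\<lambda>l\<in>{1..L}. n) \<in> allocations L (L * n)"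
  by (auto simp: allocations_def)

lemma valid_uniform_allocation:
  assumes "1 \<le> L" "1 \<le> n" shows "valid_allocation_law L (L * n) (uniform_allocation L (L * n))"
  unfolding valid_allocation_law_def uniform_allocation_eq[OF assms(1)]
proof (intro conjI allI impI)
  show "set_pmf (return_pmf (\<lambda>l\<in>{1..L}. n)) \<subseteq> allocations L (L * n)" using uniform_in_allocations[OF assms] by simp
  fix \<rho> assume \<rho>: "\<rho> permutes {1..L}"
  have "(\<lambda>l\<in>{1..L}. n) \<circ> \<rho> = (\<lambda>l\<in>{1..L}. n)"
    using permutes_in_image[OF \<rho>] by (simp add: fun_eq_iff restrict_def)
  then show "map_pmf (\<lambda>c. c \<circ> \<rho>) (return_pmf (\<lambda>l\<in>{1..L}. n)) = return_pmf (\<lambda>l\<in>{1..L}. n)" by simp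
qed

section \<open>Regular attacks prescribed at one coalition size\<close>

lemma twice_differentiable_poly: "twice_differentiable_on (poly q) {0..1}"
proof -
  have "poly (pderiv q) differentiable_on {0..1}"
    using poly_DERIV[of "pderiv q"]
    by (auto simp: differentiable_on_def real_differentiable_def intro!: DERIV_subset[OF poly_DERIV])
  moreover have "\<forall>x\<in>{0..1}. (poly q has_real_derivative poly (pderiv q) x) (at x within {0..1})"
    using poly_DERIV[of q] DERIV_subset by blast
  ultimately show ?thesis unfolding twice_differentiable_on_def by blast
qed

lemma bounded_poly_image: "bounded (poly q ` {0..1::real})"
  by (intro compact_imp_bounded compact_continuous_image continuous_on_poly continuous_on_id) auto

text \<open>Newton's scheme: each new node is fitted by adding a multiple of the polynomial that
  vanishes at the earlier ones.\<close>

lemma polynomial_interpolation: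
  fixes x y :: "nat \<Rightarrow> real"
  assumes "inj_on x {..c}" shows "\<exists>q. \<forall>z\<le>c. poly q (x z) = y z"
  using assms
proof (induction c)
  case 0
  show ?case by (intro exI[of _ "[:y 0:]"]) simp
next
  case (Suc c)
  then obtain q where q: "\<forall>z\<le>c. poly q (x z) = y z" using inj_on_subset[of x "{..Suc c}" "{..c}"] by auto
  define r where "r = (\<Prod>i\<le>c. [:- x i, 1:])"
  have r0: "poly r (x z) = 0" if "z \<le> c" for z using that by (auto simp: r_def poly_prod)
  have "x (Suc c) \<noteq> x z" if "z \<le> c" for z using inj_onD[OF Suc.prems, of "Suc c" z] that by auto
  then have r1: "poly r (x (Suc c)) \<noteq> 0" by (auto simp: r_def poly_prod)
  show ?case
  proof (intro exI[of _ "q + smult ((y (Suc c) - poly q (x (Suc c))) / poly r (x (Suc c))) r"] allI impI)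
    fix z assume "z \<le> Suc c"
    then consider "z \<le> c" | "z = Suc c" by linarith
    then show "poly (q + smult ((y (Suc c) - poly q (x (Suc c))) / poly r (x (Suc c))) r) (x z) = y z"
      by cases (use q r0 r1 in auto)
  qed
qed

text \<open>Regularity constrains only whole sequences, so at a single coalition size any attack can be
  used: it is interpolated there by a polynomial.\<close>

definition one_shot_attack :: "nat \<Rightarrow> nat \<Rightarrow> (nat \<Rightarrow> real) \<Rightarrow> nat \<Rightarrow> nat \<Rightarrow> nat \<Rightarrow> real" where
  "one_shot_attack k0 c0 t k z c = (if k = k0 \<and> c = c0 then t z else real z / real c)"

lemma regular_one_shot:
  assumes L: "1 \<le> L" and n: "1 \<le> n0" and t: "valid_channel n0 t"
  shows "regular_strategy L interleaving (one_shot_attack (L * n0) n0 t) (uniform_allocation L)"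
  unfolding regular_strategy_def
proof (intro conjI allI impI)
  fix n :: nat assume n': "0 < n"
  show "valid_allocation_law L (L * n) (uniform_allocation L (L * n))" using valid_uniform_allocation[OF L] n' by simp
  show "marking_attack L (L * n) (one_shot_attack (L * n0) n0 t (L * n))"
    unfolding marking_attack_def one_shot_attack_def using t by (auto simp: valid_channel_def)
next
  have "inj_on (\<lambda>z. real z / real n0) {..n0}" using n by (auto simp: inj_on_def)
  then obtain q where q: "\<And>z. z \<le> n0 \<Longrightarrow> poly q (real z / real n0) = t z"
    using polynomial_interpolation[of "\<lambda>z. real z / real n0" n0 t] by blast
  have q01: "poly q 0 = 0" "poly q 1 = 1" using q[of 0] q[of n0] t n by (auto simp: valid_channel_def)
  define G where "G = (\<lambda>k c. poly (if k = L * n0 \<and> c = n0 then q else [:0, 1:]))"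
  show "regular_attack L interleaving (one_shot_attack (L * n0) n0 t)"
    unfolding regular_attack_def
  proof (intro exI[of _ G] conjI allI impI ballI)
    fix n c :: nat and x
    show "bounded (G (L * n) c ` {0..1})" "twice_differentiable_on (G (L * n) c) {0..1}"
      unfolding G_def by (rule bounded_poly_image twice_differentiable_poly)+
    show "G (L * n) c 0 = 0" "G (L * n) c 1 = 1" using q01 by (auto simp: G_def)
    show "one_shot_attack (L * n0) n0 t (L * n) z c = G (L * n) c (real z / real c)" if "z \<le> c" for z
      using q that by (auto simp: one_shot_attack_def G_def)
  next
    fix c :: "nat \<Rightarrow> nat" and x :: real
    \<comment> \<open>The prescribed table sits at coalition size \<open>L * n0\<close> only, so it
      leaves no trace in the limit.\<close>
    have "\<forall>\<^sub>F n in sequentially. G (L * n) (c n) x = x"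
      using eventually_gt_at_top[of n0] by eventually_elim (use L in \<open>auto simp: G_def\<close>)
    then have "(\<lambda>n. G (L * n) (c n) x) \<longlonglongrightarrow> x" by (rule tendsto_eventually)
    then show "(\<lambda>n. G (L * n) (c n) x) \<longlonglongrightarrow> interleaving x" by (simp add: interleaving_def)
  qed
qed

lemma regular_interleaving:
  assumes L: "1 \<le> L" shows "regular_strategy L interleaving (attack_of interleaving) (uniform_allocation L)"
proof -
  \<comment> \<open>At channel size 1 the prescribed table \<open>z / 1\<close> already is
    interleaving, so nothing is altered and the one-shot regularity lemma covers interleaving
    itself.\<close>
  have "one_shot_attack (L * 1) 1 (\<lambda>z. real z / real 1) = attack_of interleaving"
    by (auto simp: one_shot_attack_def attack_of_def interleaving_def fun_eq_iff)
  then show ?thesis using regular_one_shot[OF L, of 1 "\<lambda>z. real z / real 1"] valid_interleaving[of 1] by simp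
qed

text \<open>With \<open>k = L * n\<close> and L equal channels the scaled payoff is k^2 * L / k =
  L^2 * n times the information of one channel, converted to bits.\<close>

lemma payoff_uniform_allocation:
  assumes L: "1 \<le> L" and n: "1 \<le> n" and f: "bias_density f" and \<theta>: "marking_attack L (L * n) \<theta>"
  shows "(real (L * n))\<^sup>2 * payoff L (L * n) f \<theta> (uniform_allocation L (L * n))
    = (real L)\<^sup>2 / ln 2 * (real n * (\<integral>w. channel_info n (\<lambda>z. \<theta> z n) w \<partial>bias_law f))"
proof -
  have "fingerprinting L (L * n) f \<theta> (uniform_allocation L (L * n))"
    using f \<theta> uniform_in_allocations[OF L n] by unfold_locales (auto simp: uniform_allocation_eq[OF L])
  then have "payoff L (L * n) f \<theta> (uniform_allocation L (L * n))
    = (\<Sum>l\<in>{1..L}. \<integral>w. channel_info ((\<lambda>l\<in>{1..L}. n) l) (\<lambda>z. \<theta> z ((\<lambda>l\<in>{1..L}. n) l)) w \<partial>bias_law f) / (real (L * n) * ln 2)"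
    by (rule fingerprinting.payoff_return) (rule uniform_allocation_eq[OF L])
  also have "\<dots> = real L * (\<integral>w. channel_info n (\<lambda>z. \<theta> z n) w \<partial>bias_law f) / (real (L * n) * ln 2)"
    by simp
  finally show ?thesis using L n by (simp add: power2_eq_square field_simps)
qed

text \<open>Provides the lower bound that the infimum over strategies, an infimum of reals,
  requires.\<close>

lemma payoff_nonneg:
  assumes f: "bias_density f" and \<theta>: "marking_attack L k \<theta>" and p: "set_pmf p \<subseteq> allocations L k"
  shows "0 \<le> payoff L k f \<theta> p"
proof -
  interpret fingerprinting L k f \<theta> p by unfold_locales (use f \<theta> p in auto)
  have "0 \<le> measure_pmf.expectation p (\<lambda>c. \<Sum>l\<in>{1..L}. (\<integral>w. channel_info (c l) (\<lambda>z. \<theta> z (c l)) w \<partial>bias_law f))"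
  proof (rule integral_nonneg_AE, rule AE_pmfI, rule sum_nonneg, rule integral_nonneg_AE)
    fix c l assume "c \<in> set_pmf p" "l \<in> {1..L}"
    then have v: "valid_channel (c l) (\<lambda>z. \<theta> z (c l))" by (rule valid_channel_p)
    show "AE w in bias_law f. 0 \<le> channel_info (c l) (\<lambda>z. \<theta> z (c l)) w"
      by (rule eventually_mono[OF AE_bias_law[OF f]]) (use channel_info_bounds(1)[OF v] in blast)
  qed
  then have "0 \<le> measure_pmf.expectation p (\<lambda>c. \<Sum>l\<in>{1..L}. (\<integral>w. channel_info (c l) (\<lambda>z. \<theta> z (c l)) w \<partial>bias_law f)) / (real k * ln 2)"
    by (intro divide_nonneg_nonneg) auto
  then show ?thesis using payoff_ge by linarith
qed

text \<open>Convexity of 1 / x through its tangent at the mean size \<open>m = k / L\<close>; equal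
  sizes give equality.\<close>

lemma sum_inverse_ge:
  assumes L: "1 \<le> L" and c: "\<And>l. l \<in> {1..L} \<Longrightarrow> 1 \<le> c l" and k: "(\<Sum>l\<in>{1..L}. c l) = k" and k0: "1 \<le> k"
  shows "(real L)\<^sup>2 / real k \<le> (\<Sum>l\<in>{1..L}. 1 / real (c l))"
proof -
  define m where "m = real k / real L"
  have m: "0 < m" using L k0 by (simp add: m_def)
  have tangent: "2 / m - x / m\<^sup>2 \<le> 1 / x" if "0 < x" for x
  proof -
    have "1 / x - (2 / m - x / m\<^sup>2) = (x - m)\<^sup>2 / (x * m\<^sup>2)"
      using that m by (simp add: field_simps power2_eq_square)
    moreover have "0 \<le> (x - m)\<^sup>2 / (x * m\<^sup>2)" using that m by simp
    ultimately show ?thesis by linarith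
  qed
  have "(real L)\<^sup>2 / real k = 2 * real L / m - real k / m\<^sup>2"
    using L k0 by (simp add: m_def field_simps power2_eq_square)
  also have "\<dots> = (\<Sum>l\<in>{1..L}. 2 / m - real (c l) / m\<^sup>2)"
    by (simp add: sum_subtractf sum_divide_distrib[symmetric] flip: k)
  also have "\<dots> \<le> (\<Sum>l\<in>{1..L}. 1 / real (c l))"
    using c by (intro sum_mono tangent) (simp add: Suc_le_lessD)
  finally show ?thesis .
qed

text \<open>If all channels reach the size \<open>c0\<close>, the sharp bound and convexity apply;
  if one stays below, that channel alone is enough. The threshold on n is uniform in attack and
  allocation.\<close>

lemma arcsine_payoff_lower:
  assumes L: "1 \<le> L" and e: "0 < \<epsilon>"
  shows "\<exists>N\<ge>1. \<forall>n\<ge>N. \<forall>\<theta> p. marking_attack L (L * n) \<theta> \<and> set_pmf p \<subseteq> allocations L (L * n) \<longrightarrow>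
    (1 - \<epsilon>) * ((real L)\<^sup>2 / (2 * ln 2)) \<le> (real (L * n))\<^sup>2 * payoff L (L * n) arcsine_density \<theta> p"
proof -
  obtain c0 where c0: "1 \<le> c0" "\<And>c t. c0 \<le> c \<Longrightarrow> valid_channel c t \<Longrightarrow> (1 - \<epsilon>) / (2 * real c) \<le> arcsine_info c t"
    using arcsine_info_asymptotic[OF e] by blast
  \<comment> \<open>From here on the weak bound \<open>1 / (2 * pi^2 * c0)\<close> for a single
    channel below size \<open>c0\<close> reaches the target \<open>L^2 / (2 * k)\<close> for the
    whole sum.\<close>
  define N where "N = Suc (nat \<lceil>pi\<^sup>2 * real c0 * (real L)\<^sup>2\<rceil>)"
  have "(1 - \<epsilon>) * ((real L)\<^sup>2 / (2 * ln 2)) \<le> (real (L * n))\<^sup>2 * payoff L (L * n) arcsine_density \<theta> p"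
    if n: "N \<le> n" and \<theta>: "marking_attack L (L * n) \<theta>" and p: "set_pmf p \<subseteq> allocations L (L * n)" for n \<theta> p
  proof -
    define k where "k = L * n"
    interpret fingerprinting L k arcsine_density \<theta> p
      by unfold_locales (use bias_density_arcsine \<theta> p in \<open>auto simp: k_def\<close>)
    let ?I = "\<lambda>c l. arcsine_info (c l) (\<lambda>z. \<theta> z (c l))"
    have n1: "1 \<le> n" using n by (simp add: N_def)
    have k1: "1 \<le> k" using L n1 by (simp add: k_def)
    have k0: "0 < real k" using k1 by simp
    have big: "pi\<^sup>2 * real c0 * (real L)\<^sup>2 \<le> real k"
    proof -
      have "pi\<^sup>2 * real c0 * (real L)\<^sup>2 \<le> real n" using n unfolding N_def by linarith
      also have "1 * real n \<le> real L * real n" using L by (intro mult_right_mono) auto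
      then have "real n \<le> real k" by (simp add: k_def)
      finally show ?thesis .
    qed
    have chan: "(1 - \<epsilon>) * (real L)\<^sup>2 / (2 * real k) \<le> (\<Sum>l\<in>{1..L}. ?I c l)" if c: "c \<in> set_pmf p" for c
    proof -
      have v: "valid_channel (c l) (\<lambda>z. \<theta> z (c l))" if "l \<in> {1..L}" for l using valid_channel_p[OF c that] .
      have c1: "1 \<le> c l" if "l \<in> {1..L}" for l using v[OF that] by (simp add: valid_channel_def)
      have I0: "0 \<le> ?I c l" if "l \<in> {1..L}" for l using v[OF that] by (rule arcsine_info_nonneg)
      have ck: "(\<Sum>l\<in>{1..L}. c l) = k" using c p by (auto simp: allocations_def k_def)
      show ?thesis
      \<comment> \<open>For \<open>\<epsilon> \<ge> 1\<close> the target is not positive; otherwise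
        multiplication by \<open>1 - \<epsilon>\<close> is monotone.\<close>
      proof (cases "1 \<le> \<epsilon>")
        case True
        then have "(1 - \<epsilon>) * (real L)\<^sup>2 / (2 * real k) \<le> 0" using k0 by (simp add: divide_nonpos_pos mult_nonpos_nonneg)
        also have "0 \<le> (\<Sum>l\<in>{1..L}. ?I c l)" by (intro sum_nonneg I0)
        finally show ?thesis .
      next
        case False
        show ?thesis
        proof (cases "\<forall>l\<in>{1..L}. c0 \<le> c l")
          case True
          have "(1 - \<epsilon>) * (real L)\<^sup>2 / (2 * real k) = (1 - \<epsilon>) / 2 * ((real L)\<^sup>2 / real k)" by simp
          also have "\<dots> \<le> (1 - \<epsilon>) / 2 * (\<Sum>l\<in>{1..L}. 1 / real (c l))"
            using False by (intro mult_left_mono sum_inverse_ge[OF L c1 ck k1]) auto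
          also have "\<dots> = (\<Sum>l\<in>{1..L}. (1 - \<epsilon>) / (2 * real (c l)))" by (simp add: sum_distrib_left)
          also have "\<dots> \<le> (\<Sum>l\<in>{1..L}. ?I c l)" using True by (intro sum_mono c0(2) v) auto
          finally show ?thesis .
        next
          case F: False
          then obtain l where l: "l \<in> {1..L}" "c l < c0" by auto
          have "(1 - \<epsilon>) * (real L)\<^sup>2 / (2 * real k) \<le> 1 * (real L)\<^sup>2 / (2 * real k)"
            using e k0 by (intro divide_right_mono mult_right_mono) auto
          also have "\<dots> \<le> (real L)\<^sup>2 / (2 * (pi\<^sup>2 * real c0 * (real L)\<^sup>2))"
            using big c0 L k0 by (simp only: mult_1) (intro divide_left_mono; simp)
          also have "\<dots> = 1 / (2 * pi\<^sup>2 * real c0)" using L by simp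
          also have "\<dots> \<le> 1 / (2 * pi\<^sup>2 * real (c l))"
            using l c1[OF l(1)] c0 by (intro divide_left_mono mult_left_mono mult_pos_pos) auto
          also have "\<dots> \<le> ?I c l" by (rule arcsine_info_weak_bound[OF v[OF l(1)]])
          also have "\<dots> \<le> (\<Sum>l\<in>{1..L}. ?I c l)" using l I0 by (intro member_le_sum) auto
          finally show ?thesis .
        qed
      qed
    qed
    have "(1 - \<epsilon>) * (real L)\<^sup>2 / (2 * real k) = measure_pmf.expectation p (\<lambda>_. (1 - \<epsilon>) * (real L)\<^sup>2 / (2 * real k))" by simp
    also have "\<dots> \<le> measure_pmf.expectation p (\<lambda>c. \<Sum>l\<in>{1..L}. ?I c l)"
      using chan fin_p by (intro integral_mono_AE AE_pmfI integrable_measure_pmf_finite) auto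
    finally have "(1 - \<epsilon>) * (real L)\<^sup>2 / (2 * real k) / (real k * ln 2)
      \<le> measure_pmf.expectation p (\<lambda>c. \<Sum>l\<in>{1..L}. ?I c l) / (real k * ln 2)"
      using k0 by (intro divide_right_mono) auto
    also have "\<dots> \<le> payoff L k arcsine_density \<theta> p" by (rule payoff_ge)
    finally have "(real k)\<^sup>2 * ((1 - \<epsilon>) * (real L)\<^sup>2 / (2 * real k) / (real k * ln 2)) \<le> (real k)\<^sup>2 * payoff L k arcsine_density \<theta> p"
      by (intro mult_left_mono) auto
    also have "(real k)\<^sup>2 * ((1 - \<epsilon>) * (real L)\<^sup>2 / (2 * real k) / (real k * ln 2)) = (1 - \<epsilon>) * ((real L)\<^sup>2 / (2 * ln 2))"
      using k0 by (simp add: power2_eq_square)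
    finally show ?thesis by (simp add: k_def)
  qed
  moreover have "1 \<le> N" by (simp add: N_def)
  ultimately show ?thesis by blast
qed

text \<open>The strategy may depend on n but not on the density; this order of quantifiers bounds
  the supremum over tracers at each fixed coalition size.\<close>

lemma uniform_payoff_upper:
  assumes L: "1 \<le> L" and e: "0 < \<epsilon>"
  shows "\<exists>N\<ge>1. \<forall>n\<ge>N. \<exists>\<theta> p. (\<theta>, p) \<in> regular_strategies L \<and> (\<forall>f. bias_density f \<longrightarrow>
    (real (L * n))\<^sup>2 * payoff L (L * n) f (\<theta> (L * n)) (p (L * n)) \<le> (1 + \<epsilon>) * ((real L)\<^sup>2 / (2 * ln 2)))"
proof -
  obtain g N where N: "1 \<le> N" "\<And>c. N \<le> c \<Longrightarrow> valid_channel c (sampled g c)"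
    "\<And>c w. N \<le> c \<Longrightarrow> 0 < w \<Longrightarrow> w < 1 \<Longrightarrow> channel_info c (sampled g c) w \<le> (1 + \<epsilon>) / (2 * real c)"
    using minimax_attack_uniform[OF e] by blast
  have "\<exists>\<theta> p. (\<theta>, p) \<in> regular_strategies L \<and> (\<forall>f. bias_density f \<longrightarrow>
    (real (L * n))\<^sup>2 * payoff L (L * n) f (\<theta> (L * n)) (p (L * n)) \<le> (1 + \<epsilon>) * ((real L)\<^sup>2 / (2 * ln 2)))"
    if n: "N \<le> n" for n
  proof (intro exI conjI allI impI)
    let ?\<theta> = "one_shot_attack (L * n) n (sampled g n)"
    have n1: "1 \<le> n" using n N(1) by simp
    have reg: "regular_strategy L interleaving ?\<theta> (uniform_allocation L)"
      by (rule regular_one_shot[OF L n1 N(2)[OF n]])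
    then show "(?\<theta>, uniform_allocation L) \<in> regular_strategies L" by (auto simp: regular_strategies_def)
    fix f assume f: "bias_density f"
    interpret prob_space "bias_law f" by (rule prob_space_bias_law[OF f])
    have m: "marking_attack L (L * n) (?\<theta> (L * n))" using reg n1 by (simp add: regular_strategy_def)
    have v: "valid_channel n (sampled g n)" by (rule N(2)[OF n])
    have "(\<integral>w. channel_info n (sampled g n) w \<partial>bias_law f) \<le> (1 + \<epsilon>) / (2 * real n)"
    proof (rule integral_le_const)
      show "integrable (bias_law f) (channel_info n (sampled g n))"
      proof (rule integrable_const_bound[where B = 1])
        show "AE w in bias_law f. norm (channel_info n (sampled g n) w) \<le> 1"
          by (rule eventually_mono[OF AE_bias_law[OF f]]) (use channel_info_bounds[OF v] in auto)
      qed simp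
      show "AE w in bias_law f. channel_info n (sampled g n) w \<le> (1 + \<epsilon>) / (2 * real n)"
        by (rule eventually_mono[OF AE_bias_law[OF f]]) (use N(3)[OF n] in blast)
    qed
    then have "real n * (\<integral>w. channel_info n (sampled g n) w \<partial>bias_law f) \<le> real n * ((1 + \<epsilon>) / (2 * real n))"
      by (intro mult_left_mono) auto
    also have "\<dots> = (1 + \<epsilon>) / 2" using n1 by simp
    finally have I: "real n * (\<integral>w. channel_info n (sampled g n) w \<partial>bias_law f) \<le> (1 + \<epsilon>) / 2" .
    have "(real (L * n))\<^sup>2 * payoff L (L * n) f (?\<theta> (L * n)) (uniform_allocation L (L * n))
      = (real L)\<^sup>2 / ln 2 * (real n * (\<integral>w. channel_info n (\<lambda>z. ?\<theta> (L * n) z n) w \<partial>bias_law f))"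
      by (rule payoff_uniform_allocation[OF L n1 f m])
    also have "(\<lambda>z. ?\<theta> (L * n) z n) = sampled g n" by (simp add: one_shot_attack_def)
    also have "(real L)\<^sup>2 / ln 2 * (real n * (\<integral>w. channel_info n (sampled g n) w \<partial>bias_law f)) \<le> (real L)\<^sup>2 / ln 2 * ((1 + \<epsilon>) / 2)"
      by (intro mult_left_mono I) auto
    finally show "(real (L * n))\<^sup>2 * payoff L (L * n) f (?\<theta> (L * n)) (uniform_allocation L (L * n)) \<le> (1 + \<epsilon>) * ((real L)\<^sup>2 / (2 * ln 2))"
      by (simp add: field_simps)
  qed
  then show ?thesis using N(1) by blast
qed

text \<open>Here one strategy serves all n while the threshold depends on the density, which is the
  order of quantifiers for \<open>asymptotic_min_payoff\<close>.\<close>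

lemma scaled_interleaving_upper:
  assumes L: "1 \<le> L" and f: "bias_density f" and e: "0 < \<epsilon>"
  shows "\<forall>\<^sub>F n in sequentially. scaled_payoff L f (attack_of interleaving) (uniform_allocation L) (L * n)
    \<le> (1 + \<epsilon>) * ((real L)\<^sup>2 / (2 * ln 2))"
proof -
  have "\<forall>\<^sub>F n in sequentially. real n * (\<integral>w. channel_info n (\<lambda>z. real z / real n) w \<partial>bias_law f) \<le> 1 / 2 + \<epsilon> / 2"
    using interleaving_asymptotic[OF f, of "\<epsilon> / 2"] e by simp
  then show ?thesis using eventually_ge_at_top[of "1::nat"]
  proof eventually_elim
    case (elim n)
    have m: "marking_attack L (L * n) (attack_of interleaving (L * n))"
      using regular_interleaving[OF L] elim(2) by (simp add: regular_strategy_def)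
    have "scaled_payoff L f (attack_of interleaving) (uniform_allocation L) (L * n)
      = (real L)\<^sup>2 / ln 2 * (real n * (\<integral>w. channel_info n (\<lambda>z. attack_of interleaving (L * n) z n) w \<partial>bias_law f))"
      unfolding scaled_payoff_def by (rule payoff_uniform_allocation[OF L elim(2) f m])
    also have "(\<lambda>z. attack_of interleaving (L * n) z n) = (\<lambda>z. real z / real n)" by (simp add: attack_of_def interleaving_def)
    also have "(real L)\<^sup>2 / ln 2 * (real n * (\<integral>w. channel_info n (\<lambda>z. real z / real n) w \<partial>bias_law f))
      \<le> (real L)\<^sup>2 / ln 2 * (1 / 2 + \<epsilon> / 2)" by (intro mult_left_mono elim) auto
    also have "\<dots> = (1 + \<epsilon>) * ((real L)\<^sup>2 / (2 * ln 2))" by (simp add: field_simps)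
    finally show ?case .
  qed
qed

section \<open>Value of the game and optimality of the strategies\<close>

lemma regular_strategies_at:
  assumes "(\<theta>, p) \<in> regular_strategies L" "1 \<le> n"
  shows "marking_attack L (L * n) (\<theta> (L * n))" "set_pmf (p (L * n)) \<subseteq> allocations L (L * n)"
  using assms by (auto simp: regular_strategies_def regular_strategy_def valid_allocation_law_def)

lemma ereal_le_all_eps:
  fixes x :: ereal assumes "0 < V" "\<And>\<epsilon>. 0 < \<epsilon> \<Longrightarrow> x \<le> ereal ((1 + \<epsilon>) * V)" shows "x \<le> ereal V"
proof (rule ereal_le_epsilon2)
  fix e :: real assume "0 < e"
  then have "x \<le> ereal ((1 + e / V) * V)" using assms by (intro assms(2)) auto
  also have "(1 + e / V) * V = V + e" using assms(1) by (simp add: field_simps)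
  finally show "x \<le> ereal V + ereal e" by simp
qed

lemma ereal_ge_all_eps:
  fixes x :: ereal assumes "0 < V" "\<And>\<epsilon>. 0 < \<epsilon> \<Longrightarrow> ereal ((1 - \<epsilon>) * V) \<le> x" shows "ereal V \<le> x"
proof (rule ereal_le_epsilon2)
  fix e :: real assume "0 < e"
  then have "ereal ((1 - e / V) * V) \<le> x" using assms by (intro assms(2)) auto
  then have "ereal (V - e) + ereal e \<le> x + ereal e" using assms(1)
    by (intro add_right_mono) (simp add: left_diff_distrib)
  then show "ereal V \<le> x + ereal e" by simp
qed

theorem theorem1:
  fixes L :: nat
  assumes "1 \<le> L"
  shows "(\<lambda>n. maximin_payoff L (L * n) / ((real L)\<^sup>2 / ((real (L * n))\<^sup>2 * 2 * ln 2))) \<longlonglongrightarrow> 1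
    \<and> (SUP f\<in>Collect bias_density. asymptotic_min_payoff L f) = ereal ((real L)\<^sup>2 / (2 * ln 2))
    \<and> asymptotically_optimal_tracer L arcsine_density
    \<and> asymptotically_optimal_colluders L arcsine_density interleaving
        (attack_of interleaving) (uniform_allocation L)"
proof -
  note L = assms
  define V where "V = (real L)\<^sup>2 / (2 * ln 2)"
  have V: "0 < V" using L by (simp add: V_def)
  have inter: "(attack_of interleaving, uniform_allocation L) \<in> regular_strategies L"
    using regular_interleaving[OF L] by (auto simp: regular_strategies_def)
  have low: "\<exists>N\<ge>1. \<forall>n\<ge>N. \<forall>(\<theta>, p)\<in>regular_strategies L.
      (1 - \<epsilon>) * V \<le> (real (L * n))\<^sup>2 * payoff L (L * n) arcsine_density (\<theta> (L * n)) (p (L * n))" if e: "0 < \<epsilon>" for \<epsilon>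
  proof -
    obtain N where N: "1 \<le> N" "\<And>n \<theta> p. N \<le> n \<Longrightarrow> marking_attack L (L * n) \<theta> \<Longrightarrow> set_pmf p \<subseteq> allocations L (L * n) \<Longrightarrow>
      (1 - \<epsilon>) * V \<le> (real (L * n))\<^sup>2 * payoff L (L * n) arcsine_density \<theta> p"
      using arcsine_payoff_lower[OF L e] unfolding V_def by blast
    show ?thesis
    proof (intro exI[of _ N] conjI allI impI ballI)
      fix n z assume n: "N \<le> n" and z: "z \<in> regular_strategies L"
      obtain \<theta> p where zp: "z = (\<theta>, p)" by (cases z)
      have "1 \<le> n" using N(1) n by simp
      then show "case z of (\<theta>, p) \<Rightarrow> (1 - \<epsilon>) * V \<le> (real (L * n))\<^sup>2 * payoff L (L * n) arcsine_density (\<theta> (L * n)) (p (L * n))"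
        using N(2)[OF n regular_strategies_at] z unfolding zp prod.case by blast
    qed (rule N(1))
  qed

  let ?INF = "\<lambda>n f. INF (\<theta>, p)\<in>regular_strategies L. payoff L (L * n) f (\<theta> (L * n)) (p (L * n))"
  \<comment> \<open>The real infimum is below each member only for families bounded from
    below.\<close>
  have bdd_below: "bdd_below ((\<lambda>(\<theta>, p). payoff L (L * n) f (\<theta> (L * n)) (p (L * n))) ` regular_strategies L)"
    if "bias_density f" "1 \<le> n" for f n
    using regular_strategies_at[OF _ that(2)] payoff_nonneg[OF that(1)] by (intro bdd_belowI[of _ 0]) auto
  have upper: "\<exists>N\<ge>1. \<forall>n\<ge>N. \<forall>f. bias_density f \<longrightarrow> (real (L * n))\<^sup>2 * ?INF n f \<le> (1 + \<epsilon>) * V" if e: "0 < \<epsilon>" for \<epsilon>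
  proof -
    obtain N where N: "1 \<le> N" "\<And>n. N \<le> n \<Longrightarrow> \<exists>\<theta> p. (\<theta>, p) \<in> regular_strategies L \<and> (\<forall>f. bias_density f \<longrightarrow>
      (real (L * n))\<^sup>2 * payoff L (L * n) f (\<theta> (L * n)) (p (L * n)) \<le> (1 + \<epsilon>) * V)"
      using uniform_payoff_upper[OF L e] unfolding V_def by blast
    have "(real (L * n))\<^sup>2 * ?INF n f \<le> (1 + \<epsilon>) * V" if n: "N \<le> n" and f: "bias_density f" for n f
    proof -
      obtain \<theta> p where \<theta>p: "(\<theta>, p) \<in> regular_strategies L"
        "(real (L * n))\<^sup>2 * payoff L (L * n) f (\<theta> (L * n)) (p (L * n)) \<le> (1 + \<epsilon>) * V" using N(2)[OF n] f by blast
      have "?INF n f \<le> payoff L (L * n) f (\<theta> (L * n)) (p (L * n))"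
        using cINF_lower[OF bdd_below[OF f] \<theta>p(1), of n] n N(1) by simp
      then have "(real (L * n))\<^sup>2 * ?INF n f \<le> (real (L * n))\<^sup>2 * payoff L (L * n) f (\<theta> (L * n)) (p (L * n))"
        by (intro mult_left_mono) auto
      then show ?thesis using \<theta>p(2) by linarith
    qed
    then show ?thesis using N(1) by blast
  qed

  \<comment> \<open>The arcsine density bounds the supremum from below and the uniform attacks bound
    it from above; the upper bound also shows that the supremum is over a bounded set.\<close>
  have sandwich: "\<forall>\<^sub>F n in sequentially. (1 - \<epsilon>) * V \<le> (real (L * n))\<^sup>2 * maximin_payoff L (L * n)
     \<and> (real (L * n))\<^sup>2 * maximin_payoff L (L * n) \<le> (1 + \<epsilon>) * V" if e: "0 < \<epsilon>" for \<epsilon>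
  proof -
    obtain N1 where N1: "1 \<le> N1" "\<And>n. N1 \<le> n \<Longrightarrow> \<forall>(\<theta>, p)\<in>regular_strategies L.
      (1 - \<epsilon>) * V \<le> (real (L * n))\<^sup>2 * payoff L (L * n) arcsine_density (\<theta> (L * n)) (p (L * n))" using low[OF e] by blast
    obtain N2 where N2: "1 \<le> N2" "\<And>n f. N2 \<le> n \<Longrightarrow> bias_density f \<Longrightarrow> (real (L * n))\<^sup>2 * ?INF n f \<le> (1 + \<epsilon>) * V"
      using upper[OF e] by blast
    show ?thesis using eventually_ge_at_top[of "max N1 N2"]
    proof eventually_elim
      case (elim n)
      define s where "s = (real L * real n)\<^sup>2"
      have s: "0 < s" using L elim N1 by (simp add: s_def)
      have le: "?INF n f \<le> (1 + \<epsilon>) * V / s" if "bias_density f" for f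
        using N2(2)[OF _ that, of n] elim s by (simp add: s_def[symmetric] le_divide_eq mult.commute)
      have mm: "maximin_payoff L (L * n) = (SUP f\<in>Collect bias_density. ?INF n f)" by (simp add: maximin_payoff_def)
      have "maximin_payoff L (L * n) \<le> (1 + \<epsilon>) * V / s"
        unfolding mm using bias_density_arcsine le by (intro cSUP_least) auto
      moreover have "(1 - \<epsilon>) * V / s \<le> ?INF n arcsine_density"
        using inter N1(2)[of n] elim s
        by (intro cINF_greatest) (auto simp: s_def[symmetric] divide_le_eq mult.commute)
      moreover have "?INF n arcsine_density \<le> maximin_payoff L (L * n)"
        unfolding mm using bias_density_arcsine le by (intro cSUP_upper bdd_aboveI[of _ "(1 + \<epsilon>) * V / s"]) auto
      ultimately have "(1 - \<epsilon>) * V / s \<le> maximin_payoff L (L * n)" "maximin_payoff L (L * n) \<le> (1 + \<epsilon>) * V / s"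
        by (blast intro: order_trans)+
      then show ?case using s by (simp add: s_def[symmetric] le_divide_eq divide_le_eq mult.commute)
    qed
  qed

  have 1: "(\<lambda>n. maximin_payoff L (L * n) / ((real L)\<^sup>2 / ((real (L * n))\<^sup>2 * 2 * ln 2))) \<longlonglongrightarrow> 1"
  proof (rule tendstoI)
    fix \<epsilon> :: real assume e: "0 < \<epsilon>"
    have "\<forall>\<^sub>F n in sequentially. (1 - \<epsilon> / 2) * V \<le> (real (L * n))\<^sup>2 * maximin_payoff L (L * n)
      \<and> (real (L * n))\<^sup>2 * maximin_payoff L (L * n) \<le> (1 + \<epsilon> / 2) * V" using e by (intro sandwich) simp
    then show "\<forall>\<^sub>F n in sequentially. dist (maximin_payoff L (L * n) / ((real L)\<^sup>2 / ((real (L * n))\<^sup>2 * 2 * ln 2))) 1 < \<epsilon>"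
    proof eventually_elim
      case (elim n)
      define s where "s = (real (L * n))\<^sup>2"
      have "maximin_payoff L (L * n) / ((real L)\<^sup>2 / (s * 2 * ln 2)) = s * maximin_payoff L (L * n) / V"
        by (simp add: V_def mult_ac)
      moreover have "1 - \<epsilon> / 2 \<le> s * maximin_payoff L (L * n) / V" "s * maximin_payoff L (L * n) / V \<le> 1 + \<epsilon> / 2"
        using elim V unfolding s_def[symmetric] by (simp_all add: le_divide_eq divide_le_eq)
      ultimately show ?case unfolding s_def[symmetric] using e by (simp add: dist_real_def abs_less_iff)
    qed
  qed

  have asym_low: "ereal V \<le> asymptotic_payoff L arcsine_density \<theta> p" if "(\<theta>, p) \<in> regular_strategies L" for \<theta> p
  proof (rule ereal_ge_all_eps[OF V])
    fix \<epsilon> :: real assume e: "0 < \<epsilon>"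
    obtain N where N: "\<And>n. N \<le> n \<Longrightarrow> \<forall>(\<theta>, p)\<in>regular_strategies L.
      (1 - \<epsilon>) * V \<le> (real (L * n))\<^sup>2 * payoff L (L * n) arcsine_density (\<theta> (L * n)) (p (L * n))" using low[OF e] by blast
    show "ereal ((1 - \<epsilon>) * V) \<le> asymptotic_payoff L arcsine_density \<theta> p"
      unfolding asymptotic_payoff_def scaled_payoff_def
    proof (rule Liminf_bounded)
      show "\<forall>\<^sub>F n in sequentially. ereal ((1 - \<epsilon>) * V) \<le> ereal ((real (L * n))\<^sup>2 * payoff L (L * n) arcsine_density (\<theta> (L * n)) (p (L * n)))"
        using eventually_ge_at_top[of N] by eventually_elim (use N that in force)
    qed
  qed
  have asym_up: "asymptotic_min_payoff L f \<le> ereal V" if f: "bias_density f" for f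
  proof (rule ereal_le_all_eps[OF V])
    fix \<epsilon> :: real assume e: "0 < \<epsilon>"
    have "asymptotic_min_payoff L f \<le> asymptotic_payoff L f (attack_of interleaving) (uniform_allocation L)"
      unfolding asymptotic_min_payoff_def using INF_lower[OF inter, of "\<lambda>(\<theta>, p). asymptotic_payoff L f \<theta> p"] by simp
    \<comment> \<open>The upper bound for interleaving holds eventually, hence for the limsup, and
      the liminf is no larger.\<close>
    also have "\<dots> \<le> limsup (\<lambda>n. ereal (scaled_payoff L f (attack_of interleaving) (uniform_allocation L) (L * n)))"
      unfolding asymptotic_payoff_def by (rule Liminf_le_Limsup) simp
    also have "\<dots> \<le> ereal ((1 + \<epsilon>) * V)"
      using scaled_interleaving_upper[OF L f e] by (intro Limsup_bounded) (simp add: V_def)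
    finally show "asymptotic_min_payoff L f \<le> ereal ((1 + \<epsilon>) * V)" .
  qed
  have asym_arcsine: "asymptotic_min_payoff L arcsine_density = ereal V"
  proof (rule antisym[OF asym_up[OF bias_density_arcsine]])
    show "ereal V \<le> asymptotic_min_payoff L arcsine_density"
      unfolding asymptotic_min_payoff_def using asym_low by (intro INF_greatest) auto
  qed
  have 2: "(SUP f\<in>Collect bias_density. asymptotic_min_payoff L f) = ereal V"
  proof (rule antisym)
    show "(SUP f\<in>Collect bias_density. asymptotic_min_payoff L f) \<le> ereal V" using asym_up by (intro SUP_least) auto
    show "ereal V \<le> (SUP f\<in>Collect bias_density. asymptotic_min_payoff L f)"
      unfolding asym_arcsine[symmetric] using bias_density_arcsine by (intro SUP_upper) auto
  qed
  have 3: "asymptotically_optimal_tracer L arcsine_density"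
    unfolding asymptotically_optimal_tracer_def asym_arcsine using bias_density_arcsine asym_up by blast
  \<comment> \<open>For interleaving, the lower bound common to all regular strategies meets its own
    upper bound, so the scaled payoff truly converges, as the definition of optimality
    demands.\<close>
  have "(\<lambda>n. scaled_payoff L arcsine_density (attack_of interleaving) (uniform_allocation L) (L * n)) \<longlonglongrightarrow> V"
  proof (rule tendstoI)
    fix \<epsilon> :: real assume e: "0 < \<epsilon>"
    define d where "d = \<epsilon> / (2 * V)"
    have d: "0 < d" "d * V < \<epsilon>" using e V by (auto simp: d_def)
    obtain N where N: "\<And>n. N \<le> n \<Longrightarrow> \<forall>(\<theta>, p)\<in>regular_strategies L.
      (1 - d) * V \<le> (real (L * n))\<^sup>2 * payoff L (L * n) arcsine_density (\<theta> (L * n)) (p (L * n))" using low[OF d(1)] by blast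
    show "\<forall>\<^sub>F n in sequentially. dist (scaled_payoff L arcsine_density (attack_of interleaving) (uniform_allocation L) (L * n)) V < \<epsilon>"
      using scaled_interleaving_upper[OF L bias_density_arcsine d(1)] eventually_ge_at_top[of N]
    proof eventually_elim
      case (elim n)
      have "(1 - d) * V \<le> scaled_payoff L arcsine_density (attack_of interleaving) (uniform_allocation L) (L * n)"
        using N[OF elim(2)] inter unfolding scaled_payoff_def by blast
      moreover have "scaled_payoff L arcsine_density (attack_of interleaving) (uniform_allocation L) (L * n) \<le> (1 + d) * V"
        using elim(1) by (simp add: V_def)
      ultimately show ?case using d(2) by (simp add: dist_real_def abs_less_iff algebra_simps)
    qed
  qed
  then have 4: "asymptotically_optimal_colluders L arcsine_density interleaving (attack_of interleaving) (uniform_allocation L)"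
    unfolding asymptotically_optimal_colluders_def using regular_interleaving[OF L] asym_low by auto
  show ?thesis using 1 2 3 4 by (simp add: V_def)
qed

end
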